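(* Consider a non-relativistic gas of a fixed number $N$ of electrons with Hamiltonian $\hat H_v=\hat K+\hat U+\hat V$ in an external potential $v$. Let $\beta>0$, let $\hat c=e^{-\beta\hat H_v}/Tr\,e^{-\beta\hat H_v}$ be the canonical density matrix at inverse temperature $\beta$, let $n_{eq}(x)=Tr(\hat c\,\hat n_x)$ be the equilibrium density, and let $E=Tr(\hat c\hat H_v)$. Then: (i) the trial density functional entropy $S_v(E;n]$, at this fixed energy $E$ and with $n$ varying subject to $\int d^3x\,n(x)=N$, assumes its maximum value at $n=n_{eq}$; at the maximum the multiplier function $\alpha(x)$ is a constant $\alpha_{eq}$, and the corresponding trial density matrix is equal to the canonical density matrix $\hat c$; (ii) equivalently, the density functional potential $\Omega_v(\beta;n]$, at fixed $\beta$ and with $n$ varying subject to $\int d^3x\,n(x)=N$, assumes its minimum at the same density $n=n_{eq}$.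
   Context: The Hilbert space is the antisymmetrized $N$-fold tensor product of the one-particle space of two-component spinor wave functions on $\mathbb R^3$. The Hamiltonian is $$\hat H_v=\hat K+\hat U+\hat V,\qquad \hat K=\sum_{i=1}^N\hat p_i^2,\quad \hat U=\frac12\sum_{j\ne k}\frac1{|\hat x_j-\hat x_k|},\quad \hat V=\sum_{l=1}^Nv(\hat x_l)$$ (constants are suppressed by choice of units), with $v:\mathbb R^3\to\mathbb R$. The density operator at $x\in\mathbb R^3$ is $\hat n_x=\sum_{i=1}^N\delta(\hat x_i-x)$, so $\int d^3x\,\alpha(x)\hat n_x=\sum_i\alpha(\hat x_i)$. For a density matrix $\hat\rho$ (positive, $Tr\hat\rho=1$), $\langle\hat A\rangle=Tr(\hat\rho\hat A)$. Trial density matrices are the maximizers of $-Tr(\hat\rho\log\hat\rho)$ (entropy relative to the uniform prior) subject to $Tr\hat\rho=1$, $Tr\hat\rho\hat H_v=E$ and $Tr\hat\rho\,\hat n_x=n(x)$ for every $x$, where $\int d^3x\,n(x)=N$. They have the form $$\hat\rho_n=\frac1{Z_v(\beta;\alpha]}\,e^{-\beta\hat H_v-\int d^3x\,\alpha(x)\hat n_x},\qquad Z_v(\beta;\alpha]=Tr\,e^{-\beta\hat H_v-\int d^3x\,\alpha(x)\hat n_x},$$ with Lagrange multipliers $\beta$ and $\alpha(x)$ determined by the constraints; in particular $-\frac{\delta\log Z_v}{\delta\alpha(x)}=n(x)$. The trial entropy is $$S_v(E;n]=-Tr(\hat\rho_n\log\hat\rho_n)=\beta E+\int d^3x\,\alpha(x)n(x)+\log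 Z_v(\beta;\alpha].$$ The trial density matrix may be labelled either by $(E,n)$ or by $(\beta,n)$. In terms of $(\beta,n)$, the Massieu functional is $\tilde S_v(\beta;n]=S_v-\beta E$ (with $E=\langle\hat H_v\rangle$ in the trial state), and the density functional potential is $$\Omega_v(\beta;n]=-\frac{\tilde S_v(\beta;n]}{\beta}=-\int d^3x\,\frac{\alpha(x)}{\beta}n(x)-\frac1\beta\log Z_v(\beta;\alpha].$$ The densities $n$ considered are those for which the trial density matrix exists and the displayed quantities are finite; the canonical density matrix is assumed to exist with finite energy and entropy. *)

theory Defs
  imports "HOL-Analysis.Analysis"
begin

section \<open>Wave functions of \<open>N\<close> electrons\<close>

text \<open>
  The number of electrons is \<open>N = CARD('n)\<close>; particles are labelled by the finite type \<open>'n\<close>.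
  A wave function depends on the \<open>N\<close> positions and the \<open>N\<close> two-valued spin variables, so that the
  square-integrable ones form the \<open>N\<close>-fold tensor product of \<open>L\<^sup>2(\<real>\<^sup>3; \<complex>\<^sup>2)\<close>. Elements of the Hilbert
  space are represented by functions, and equality of vectors is equality almost everywhere.
\<close>

type_synonym 'n wf = "((real^3)^'n) \<times> (bool^'n) \<Rightarrow> complex"

definition conf :: "(((real^3)^'n::finite) \<times> (bool^'n)) measure" where
  "conf = lborel \<Otimes>\<^sub>M count_space UNIV"

definition wf_eq :: "'n::finite wf \<Rightarrow> 'n wf \<Rightarrow> bool" where
  "wf_eq \<phi> \<psi> \<longleftrightarrow> (AE z in conf. \<phi> z = \<psi> z)"

definition sq_int :: "'n::finite wf set" where
  "sq_int = {\<psi>. \<psi> \<in> borel_measurable conf \<and> integrable conf (\<lambda>z. (cmod (\<psi> z))\<^sup>2)}"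

definition antisymmetric :: "'n::finite wf \<Rightarrow> bool" where
  "antisymmetric \<psi> \<longleftrightarrow> (\<forall>\<pi>. \<pi> permutes (UNIV :: 'n set) \<longrightarrow>
     (AE z in conf. \<psi> (\<chi> i. fst z $ \<pi> i, \<chi> i. snd z $ \<pi> i) = of_int (sign \<pi>) * \<psi> z))"

definition hilb :: "'n::finite wf set" where
  "hilb = {\<psi> \<in> sq_int. antisymmetric \<psi>}"

definition ip :: "'n::finite wf \<Rightarrow> 'n wf \<Rightarrow> complex" where
  "ip \<phi> \<psi> = (LINT z|conf. cnj (\<phi> z) * \<psi> z)"

definition hnorm :: "'n::finite wf \<Rightarrow> real" where
  "hnorm \<psi> = sqrt (Re (ip \<psi> \<psi>))"


section \<open>Operators, functional calculus and trace\<close>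

definition onb :: "(nat \<Rightarrow> 'n::finite wf) \<Rightarrow> bool" where
  "onb b \<longleftrightarrow> (\<forall>k. b k \<in> hilb) \<and> (\<forall>j k. ip (b j) (b k) = (if j = k then 1 else 0)) \<and>
     (\<forall>\<psi>\<in>hilb. (\<lambda>m. hnorm (\<lambda>z. \<psi> z - (\<Sum>k<m. ip (b k) \<psi> * b k z))) \<longlonglongrightarrow> 0)"

definition bounded_op :: "('n::finite wf \<Rightarrow> 'n wf) \<Rightarrow> bool" where
  "bounded_op T \<longleftrightarrow> (\<forall>\<psi>\<in>hilb. T \<psi> \<in> hilb) \<and>
     (\<forall>a. \<forall>\<phi>\<in>hilb. \<forall>\<psi>\<in>hilb. wf_eq (T (\<lambda>z. a * \<phi> z + \<psi> z)) (\<lambda>z. a * T \<phi> z + T \<psi> z)) \<and>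
     (\<exists>C. \<forall>\<psi>\<in>hilb. hnorm (T \<psi>) \<le> C * hnorm \<psi>)"

definition op_eq :: "('n::finite wf \<Rightarrow> 'n wf) \<Rightarrow> ('n wf \<Rightarrow> 'n wf) \<Rightarrow> bool" where
  "op_eq S T \<longleftrightarrow> (\<forall>\<psi>\<in>hilb. wf_eq (S \<psi>) (T \<psi>))"

text \<open>Unbounded operators are given by their graphs.\<close>

definition graph_of :: "('n::finite wf \<Rightarrow> 'n wf) \<Rightarrow> ('n wf \<times> 'n wf) set" where
  "graph_of T = {(\<psi>, \<eta>). \<psi> \<in> hilb \<and> \<eta> \<in> hilb \<and> wf_eq \<eta> (T \<psi>)}"

definition eigensystem :: "('n::finite wf \<times> 'n wf) set \<Rightarrow> (nat \<Rightarrow> 'n wf) \<Rightarrow> (nat \<Rightarrow> real) \<Rightarrow> bool" where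
  "eigensystem A b \<mu> \<longleftrightarrow> onb b \<and> (\<forall>k. (b k, \<lambda>z. of_real (\<mu> k) * b k z) \<in> A)"

text \<open>
  \<open>fun_of_op f A T\<close>: the bounded operator \<open>T\<close> is \<open>f(A)\<close>. This is the functional calculus for operators
  with a complete orthonormal system of eigenvectors. It is all that is needed: positive operators of
  finite trace are of this kind, and so is every \<open>A\<close> for which \<open>exp (- A)\<close> has finite trace.
\<close>

definition fun_of_op ::
  "(real \<Rightarrow> real) \<Rightarrow> ('n::finite wf \<times> 'n wf) set \<Rightarrow> ('n wf \<Rightarrow> 'n wf) \<Rightarrow> bool" where
  "fun_of_op f A T \<longleftrightarrow> bounded_op T \<and>
     (\<exists>b \<mu>. eigensystem A b \<mu> \<and> (\<forall>k. wf_eq (T (b k)) (\<lambda>z. of_real (f (\<mu> k)) * b k z)))"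

definition has_trace :: "('n::finite wf \<Rightarrow> 'n wf) \<Rightarrow> complex \<Rightarrow> bool" where
  "has_trace T t \<longleftrightarrow> (\<forall>b. onb b \<longrightarrow> ((\<lambda>k. ip (b k) (T (b k))) has_sum t) UNIV)"

definition density_matrix :: "('n::finite wf \<Rightarrow> 'n wf) \<Rightarrow> bool" where
  "density_matrix \<rho> \<longleftrightarrow> bounded_op \<rho> \<and> (\<forall>\<psi>\<in>hilb. ip \<psi> (\<rho> \<psi>) \<in> \<real> \<and> 0 \<le> Re (ip \<psi> (\<rho> \<psi>))) \<and>
     has_trace \<rho> 1"

text \<open>\<open>s = - Tr (\<rho> log \<rho>)\<close>; note \<open>0 * ln 0 = 0\<close>.\<close>

definition has_entropy :: "('n::finite wf \<Rightarrow> 'n wf) \<Rightarrow> real \<Rightarrow> bool" where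
  "has_entropy \<rho> s \<longleftrightarrow>
     (\<exists>L. fun_of_op (\<lambda>p. p * ln p) (graph_of \<rho>) L \<and> has_trace L (of_real (- s)))"


section \<open>The Hamiltonian\<close>

text \<open>
  Compactly supported \<open>C\<^sup>1\<close> functions \<open>f\<close> with derivative \<open>f'\<close>. Since the momenta are of first order, they
  give the same weak derivatives as smooth test functions.
\<close>

definition test_function :: "((real^3)^'n::finite \<Rightarrow> real) \<Rightarrow> ((real^3)^'n \<Rightarrow> ((real^3)^'n) \<Rightarrow>\<^sub>L real) \<Rightarrow> bool" where
  "test_function f f' \<longleftrightarrow> (\<forall>x. (f has_derivative blinfun_apply (f' x)) (at x)) \<and>
     continuous_on UNIV f' \<and> bounded {x. f x \<noteq> 0}"

text \<open>\<open>\<eta> = p\<^bsub>i,a\<^esub> \<psi> = - \<i> \<partial>\<psi>/\<partial>x\<^bsub>i,a\<^esub>\<close> in the weak sense (particle \<open>i\<close>, coordinate \<open>a\<close>).\<close>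

definition has_momentum :: "'n::finite \<Rightarrow> 3 \<Rightarrow> 'n wf \<Rightarrow> 'n wf \<Rightarrow> bool" where
  "has_momentum i a \<psi> \<eta> \<longleftrightarrow> \<eta> \<in> sq_int \<and> (\<forall>f f' s. test_function f f' \<longrightarrow>
     (LINT x|lborel. \<eta> (x, s) * of_real (f x)) =
       \<i> * (LINT x|lborel. \<psi> (x, s) * of_real (blinfun_apply (f' x) (axis i (axis a 1)))))"

definition momentum :: "'n::finite \<Rightarrow> 3 \<Rightarrow> 'n wf \<Rightarrow> 'n wf" where
  "momentum i a \<psi> = (SOME \<eta>. has_momentum i a \<psi> \<eta>)"

definition mult :: "((real^3)^'n::finite \<Rightarrow> real) \<Rightarrow> 'n wf \<Rightarrow> 'n wf" where
  "mult w \<psi> = (\<lambda>z. of_real (w (fst z)) * \<psi> z)"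

definition coulomb :: "(real^3)^'n::finite \<Rightarrow> real" where
  "coulomb x = (1/2) * (\<Sum>j\<in>UNIV. \<Sum>k\<in>UNIV - {j}. 1 / norm (x $ j - x $ k))"

text \<open>\<open>mult (one_body g)\<close> is the operator \<open>\<integral> g(x) n\<^sub>x dx = \<Sum>\<^sub>i g(x\<^sub>i)\<close>.\<close>

definition one_body :: "(real^3 \<Rightarrow> real) \<Rightarrow> (real^3)^'n::finite \<Rightarrow> real" where
  "one_body g x = (\<Sum>i\<in>UNIV. g (x $ i))"

text \<open>
  Sums of unbounded operators are understood as form sums. A Hermitian form \<open>q\<close> on a form domain \<open>Q\<close>
  determines the operator \<open>form_op Q q\<close> in the usual way (first representation theorem).
\<close>

definition mult_dom :: "((real^3)^'n::finite \<Rightarrow> real) \<Rightarrow> 'n wf set" where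
  "mult_dom w = {\<psi> \<in> hilb. integrable conf (\<lambda>z. \<bar>w (fst z)\<bar> * (cmod (\<psi> z))\<^sup>2)}"

definition kinetic_dom :: "'n::finite wf set" where
  "kinetic_dom = {\<psi> \<in> hilb. \<forall>i a. \<exists>\<eta>. has_momentum i a \<psi> \<eta>}"

definition kinetic_form :: "'n::finite wf \<Rightarrow> 'n wf \<Rightarrow> complex" where
  "kinetic_form \<phi> \<psi> = (\<Sum>i\<in>UNIV. \<Sum>a\<in>UNIV. ip (momentum i a \<phi>) (momentum i a \<psi>))"

definition ham_dom :: "(real^3 \<Rightarrow> real) \<Rightarrow> 'n::finite wf set" where
  "ham_dom v = kinetic_dom \<inter> mult_dom coulomb \<inter> mult_dom (one_body v)"

definition ham_form :: "(real^3 \<Rightarrow> real) \<Rightarrow> 'n::finite wf \<Rightarrow> 'n wf \<Rightarrow> complex" where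
  "ham_form v \<phi> \<psi> = kinetic_form \<phi> \<psi> + ip \<phi> (mult coulomb \<psi>) + ip \<phi> (mult (one_body v) \<psi>)"

definition form_op ::
  "'n::finite wf set \<Rightarrow> ('n wf \<Rightarrow> 'n wf \<Rightarrow> complex) \<Rightarrow> ('n wf \<times> 'n wf) set" where
  "form_op Q q = {(\<psi>, \<eta>). \<psi> \<in> Q \<and> \<eta> \<in> hilb \<and> (\<forall>\<phi>\<in>Q. q \<phi> \<psi> = ip \<phi> \<eta>)}"

definition semibounded :: "'n::finite wf set \<Rightarrow> ('n wf \<Rightarrow> 'n wf \<Rightarrow> complex) \<Rightarrow> bool" where
  "semibounded Q q \<longleftrightarrow> (\<exists>C::real. \<forall>\<psi>\<in>Q. C * Re (ip \<psi> \<psi>) \<le> Re (q \<psi> \<psi>))"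

text \<open>
  \<open>\<rho> = exp (- A) / Tr exp (- A)\<close>, where \<open>A\<close> is the operator of the semibounded form \<open>q\<close>. An operator
  \<open>form_op Q q\<close> with a complete orthonormal system of eigenvectors is essentially self-adjoint, so its
  exponential is unambiguous. Semiboundedness is the usual condition for a form to define a Hamiltonian.
\<close>

definition normalized_exp ::
  "'n::finite wf set \<Rightarrow> ('n wf \<Rightarrow> 'n wf \<Rightarrow> complex) \<Rightarrow> ('n wf \<Rightarrow> 'n wf) \<Rightarrow> bool" where
  "normalized_exp Q q \<rho> \<longleftrightarrow> bounded_op \<rho> \<and> semibounded Q q \<and>
     (\<exists>G Z. fun_of_op (\<lambda>a. exp (- a)) (form_op Q q) G \<and> has_trace G (of_real Z) \<and>
        op_eq \<rho> (\<lambda>\<psi> z. G \<psi> z / of_real Z))"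

definition canonical :: "(real^3 \<Rightarrow> real) \<Rightarrow> real \<Rightarrow> ('n::finite wf \<Rightarrow> 'n wf) \<Rightarrow> bool" where
  "canonical v \<beta> c \<longleftrightarrow> normalized_exp (ham_dom v) (\<lambda>\<phi> \<psi>. of_real \<beta> * ham_form v \<phi> \<psi>) c"


section \<open>Trial density matrices\<close>

text \<open>\<open>Tr (\<rho> H\<^sub>v) = e\<close>, the trace being evaluated in an eigenbasis of \<open>\<rho>\<close>.\<close>

definition has_energy :: "(real^3 \<Rightarrow> real) \<Rightarrow> ('n::finite wf \<Rightarrow> 'n wf) \<Rightarrow> real \<Rightarrow> bool" where
  "has_energy v \<rho> e \<longleftrightarrow> (\<exists>b p. eigensystem (graph_of \<rho>) b p \<and>
     (\<forall>k. p k \<noteq> 0 \<longrightarrow> b k \<in> ham_dom v) \<and>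
     ((\<lambda>k. p k * Re (ham_form v (b k) (b k))) has_sum e) UNIV)"

text \<open>
  \<open>Tr (\<rho> n\<^sub>x) = n(x)\<close> with the distribution \<open>n\<^sub>x = \<Sum>\<^sub>i \<delta>(x\<^sub>i - x)\<close> smeared out:
  \<open>Tr (\<rho> \<Sum>\<^sub>i g(x\<^sub>i)) = \<integral> g(x) n(x) dx\<close> for all bounded Borel functions \<open>g\<close>. This determines \<open>n\<close> up to
  null sets.
\<close>

definition has_density :: "('n::finite wf \<Rightarrow> 'n wf) \<Rightarrow> (real^3 \<Rightarrow> real) \<Rightarrow> bool" where
  "has_density \<rho> n \<longleftrightarrow> integrable lborel n \<and> (LINT x|lborel. n x) = real CARD('n) \<and>
     (\<forall>g \<in> borel_measurable borel. bounded (range g) \<longrightarrow>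
        has_trace (\<lambda>\<psi>. \<rho> (mult (one_body g) \<psi>)) (of_real (LINT x|lborel. g x * n x)))"

definition constraints ::
  "(real^3 \<Rightarrow> real) \<Rightarrow> real \<Rightarrow> (real^3 \<Rightarrow> real) \<Rightarrow> ('n::finite wf \<Rightarrow> 'n wf) \<Rightarrow> bool" where
  "constraints v e n \<rho> \<longleftrightarrow> density_matrix \<rho> \<and> has_energy v \<rho> e \<and> has_density \<rho> n"

definition max_entropy ::
  "(real^3 \<Rightarrow> real) \<Rightarrow> real \<Rightarrow> (real^3 \<Rightarrow> real) \<Rightarrow> ('n::finite wf \<Rightarrow> 'n wf) \<Rightarrow> bool" where
  "max_entropy v e n \<rho> \<longleftrightarrow> constraints v e n \<rho> \<and>
     (\<exists>s. has_entropy \<rho> s \<and>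
        (\<forall>\<rho>' s'. constraints v e n (\<rho>' :: 'n wf \<Rightarrow> 'n wf) \<and> has_entropy \<rho>' s' \<longrightarrow> s' \<le> s))"

text \<open>
  \<open>trial v e n \<beta> \<alpha> \<rho>\<close>: \<open>\<rho>\<close> maximizes the entropy at energy \<open>e\<close> and density \<open>n\<close>, and it has the form
  \<open>exp (- \<beta> H\<^sub>v - \<integral> \<alpha>(x) n\<^sub>x dx) / Z\<close> with Lagrange multipliers \<open>\<beta>\<close> and \<open>\<alpha>\<close>.
\<close>

definition trial ::
  "(real^3 \<Rightarrow> real) \<Rightarrow> real \<Rightarrow> (real^3 \<Rightarrow> real) \<Rightarrow> real \<Rightarrow> (real^3 \<Rightarrow> real) \<Rightarrow>
     ('n::finite wf \<Rightarrow> 'n wf) \<Rightarrow> bool" where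
  "trial v e n \<beta> \<alpha> \<rho> \<longleftrightarrow> max_entropy v e n \<rho> \<and>
     \<alpha> \<in> borel_measurable borel \<and> integrable lborel (\<lambda>x. \<alpha> x * n x) \<and>
     normalized_exp (ham_dom v \<inter> mult_dom (one_body \<alpha>))
       (\<lambda>\<phi> \<psi>. of_real \<beta> * ham_form v \<phi> \<psi> + ip \<phi> (mult (one_body \<alpha>) \<psi>)) \<rho>"

text \<open>
  The functionals, each with the set of densities for which it is defined. The argument \<open>'n itself\<close>
  only carries the number of electrons.
\<close>

definition entropy_dom :: "'n::finite itself \<Rightarrow> (real^3 \<Rightarrow> real) \<Rightarrow> real \<Rightarrow> (real^3 \<Rightarrow> real) set" where
  "entropy_dom _ v e = {n. \<exists>\<beta> \<alpha> (\<rho> :: 'n wf \<Rightarrow> 'n wf). trial v e n \<beta> \<alpha> \<rho>}"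

definition trial_entropy :: "'n::finite itself \<Rightarrow> (real^3 \<Rightarrow> real) \<Rightarrow> real \<Rightarrow> (real^3 \<Rightarrow> real) \<Rightarrow> real" where
  "trial_entropy _ v e n =
     (THE s. \<exists>\<beta> \<alpha> (\<rho> :: 'n wf \<Rightarrow> 'n wf). trial v e n \<beta> \<alpha> \<rho> \<and> has_entropy \<rho> s)"

definition potential_dom :: "'n::finite itself \<Rightarrow> (real^3 \<Rightarrow> real) \<Rightarrow> real \<Rightarrow> (real^3 \<Rightarrow> real) set" where
  "potential_dom _ v \<beta> = {n. \<exists>e \<alpha> (\<rho> :: 'n wf \<Rightarrow> 'n wf). trial v e n \<beta> \<alpha> \<rho>}"

definition massieu :: "'n::finite itself \<Rightarrow> (real^3 \<Rightarrow> real) \<Rightarrow> real \<Rightarrow> (real^3 \<Rightarrow> real) \<Rightarrow> real" where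
  "massieu _ v \<beta> n =
     (THE m. \<exists>e \<alpha> (\<rho> :: 'n wf \<Rightarrow> 'n wf) s. trial v e n \<beta> \<alpha> \<rho> \<and> has_entropy \<rho> s \<and> m = s - \<beta> * e)"

definition density_potential :: "'n::finite itself \<Rightarrow> (real^3 \<Rightarrow> real) \<Rightarrow> real \<Rightarrow> (real^3 \<Rightarrow> real) \<Rightarrow> real" where
  "density_potential N v \<beta> n = - massieu N v \<beta> n / \<beta>"

end

theory Submission
  imports Defs
begin

text \<open>
  Among all density matrices with energy \<open>e\<close>, the Gibbs inequality bounds the entropy by
  \<open>\<beta> e + log Z\<close>, with equality only at the canonical density matrix \<open>c\<close>. Hence \<open>c\<close> is the trial state
  for \<open>n_eq\<close> with multiplier \<open>0\<close>, and both extremal properties follow. If another \<open>\<alpha>\<close> represents \<open>c\<close>,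
  then \<open>\<beta>' H\<^sub>v + \<Sum>\<^sub>i \<alpha>(x\<^sub>i)\<close> and \<open>\<beta> H\<^sub>v\<close> have common eigenvectors. Testing the eigenvalue equations with
  multiples of an eigenvector by symmetric test functions shows that \<open>\<Sum>\<^sub>i \<alpha>(x\<^sub>i)\<close> is constant on the
  support of each eigenvector. The finite multiplicity of the eigenvalues excludes \<open>\<beta>' \<noteq> \<beta>\<close>, so the
  constant is the same for all eigenvectors, whose supports exhaust configuration space.
\<close>

subsection \<open>Integration over configurations\<close>

text \<open>The form q = \<beta> H + A is semibounded but not known to be closed, and an occupied
  eigenvector \<psi> of a competing density matrix is only known to lie in its domain. The Gibbs
  inequality needs just this direction: for an eigenvalue p > 0 of the competitor, the tangent of
  exp (- x) is taken at - log (p Z), and a larger \<open>q \<psi> \<psi>\<close> only lowers the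
  resulting bound on \<langle>\<psi>, \<rho> \<psi>\<rangle>. That a Gibbs state attains its own
  bound is a separate point. It holds because exp (- \<mu> k) is summable, so that each eigenvalue
  of the state has finite multiplicity and its eigenvectors are finite combinations of eigenvectors
  of q.

  The same inequality with a multiplier \<alpha> makes the Massieu functional single-valued: the
  term \<integral> \<alpha> n depends on n alone.

  For the multiplier the obstacle is that v is merely Borel measurable, so nothing is known about
  the zeros of an eigenvector. The constants obtained on the supports of different eigenvectors are
  therefore compared through their eigenvalues and not through overlapping supports.\<close>

lemma pair_sigma_finite_conf:
  "pair_sigma_finite (lborel :: ((real^3)^'n::finite) measure) (count_space UNIV :: (bool^'n) measure)"
  by (simp add: pair_sigma_finite_def sigma_finite_measure_count_space_countable lborel.sigma_finite_measure_axioms)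

lemma space_conf [simp]: "space conf = UNIV"
  by (simp add: conf_def space_pair_measure)

lemma fst_measurable_conf [measurable]: "fst \<in> borel_measurable conf"
  by (simp add: conf_def)

lemma fst_conf_measurable:
  assumes "w \<in> borel_measurable borel" shows "(\<lambda>z. w (fst z)) \<in> borel_measurable conf"
  using measurable_compose[OF fst_measurable_conf assms] .

lemma slice_measurable:
  assumes "f \<in> borel_measurable conf" shows "(\<lambda>x. f (x, s)) \<in> borel_measurable borel"
proof -
  have "(\<lambda>x. (x, s)) \<in> borel \<rightarrow>\<^sub>M conf" by (simp add: conf_def)
  from measurable_compose[OF this assms] show ?thesis .
qed

lemma AE_conf_slice:
  assumes "AE z in conf. P z" shows "AE x in lborel. P (x, s)"
proof -
  have "AE x in lborel. AE s in count_space UNIV. P (x, s)"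
    using assms unfolding conf_def by (rule pair_sigma_finite.AE_pair[OF pair_sigma_finite_conf])
  then show ?thesis
    by eventually_elim (auto simp: AE_count_space)
qed

lemma AE_confI:
  assumes "Measurable.pred conf P" and "\<And>s. AE x in lborel. P (x, s)"
  shows "AE z in conf. P z"
  unfolding conf_def
proof (rule pair_sigma_finite.AE_pair_measure[OF pair_sigma_finite_conf])
  show "{x \<in> space (lborel \<Otimes>\<^sub>M count_space UNIV). P x} \<in> sets (lborel \<Otimes>\<^sub>M count_space UNIV)"
    using assms(1) by (simp add: pred_def conf_def)
  have "AE x in lborel. \<forall>s. P (x, s)"
    using assms(2) by (subst AE_all_countable) auto
  then show "AE x in lborel. AE s in count_space UNIV. P (x, s)"
    by eventually_elim auto
qed

text \<open>Fubini gives integrability for almost every spin configuration; under the counting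
  measure this means every one.\<close>

lemma integrable_conf_slice:
  fixes f :: "((real^3)^'n::finite) \<times> (bool^'n) \<Rightarrow> 'b::{banach, second_countable_topology}"
  assumes "integrable conf f" shows "integrable lborel (\<lambda>x. f (x, s))"
proof -
  interpret pair_sigma_finite "lborel :: ((real^3)^'n) measure" "count_space UNIV :: (bool^'n) measure"
    by (rule pair_sigma_finite_conf)
  interpret Q: pair_sigma_finite "count_space UNIV :: (bool^'n) measure" "lborel :: ((real^3)^'n) measure" ..
  have "integrable (count_space UNIV \<Otimes>\<^sub>M lborel) (\<lambda>(s, x). f (x, s))"
    using assms unfolding conf_def by (rule integrable_product_swap)
  from Q.AE_integrable_fst'[OF this]
  have "AE s in count_space UNIV. integrable lborel (\<lambda>x. f (x, s))" by simp
  then show ?thesis by (auto simp: AE_count_space)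
qed

lemma AE_conf_fst:
  assumes "AE z in conf. P (fst z)" shows "AE x in lborel. P x"
  using AE_conf_slice[OF assms] by simp

subsection \<open>The inner product\<close>

lemma borel_measurable_cnj [measurable]: "cnj \<in> borel_measurable borel"
  by (intro borel_measurable_continuous_onI continuous_on_cnj continuous_on_id)

lemma sq_int_measurable: "\<psi> \<in> sq_int \<Longrightarrow> \<psi> \<in> borel_measurable conf"
  by (simp add: sq_int_def)

lemma sq_int_integrable: "\<psi> \<in> sq_int \<Longrightarrow> integrable conf (\<lambda>z. (cmod (\<psi> z))\<^sup>2)"
  by (simp add: sq_int_def)

lemma norm_mult_le_sum_squares: "norm (a::real) * norm (b::real) \<le> a\<^sup>2 + b\<^sup>2"
proof -
  have "0 \<le> \<bar>a\<bar> * \<bar>b\<bar>" by (rule mult_nonneg_nonneg) auto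
  moreover have "2 * (\<bar>a\<bar> * \<bar>b\<bar>) \<le> a\<^sup>2 + b\<^sup>2"
    using sum_squares_bound[of "\<bar>a\<bar>" "\<bar>b\<bar>"] by (simp add: mult.assoc)
  ultimately show ?thesis unfolding real_norm_def by linarith
qed

lemma ip_integrable:
  assumes "\<phi> \<in> sq_int" "\<psi> \<in> sq_int" shows "integrable conf (\<lambda>z. cnj (\<phi> z) * \<psi> z)"
proof -
  note [measurable] = assms[THEN sq_int_measurable]
  show ?thesis
proof (rule Bochner_Integration.integrable_bound)
  show "integrable conf (\<lambda>z. (cmod (\<phi> z))\<^sup>2 + (cmod (\<psi> z))\<^sup>2)"
    using assms by (intro Bochner_Integration.integrable_add sq_int_integrable)
  show "(\<lambda>z. cnj (\<phi> z) * \<psi> z) \<in> borel_measurable conf"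
    by measurable
  show "AE z in conf. norm (cnj (\<phi> z) * \<psi> z) \<le> norm ((cmod (\<phi> z))\<^sup>2 + (cmod (\<psi> z))\<^sup>2)"
    using norm_mult_le_sum_squares[of "cmod _" "cmod _"] by (simp add: norm_mult)
qed
qed

section \<open>Square-integrable functions and the antisymmetric subspace\<close>

lemma sq_int_lin:
  assumes "\<phi> \<in> sq_int" "\<psi> \<in> sq_int" shows "(\<lambda>z. a * \<phi> z + \<psi> z) \<in> sq_int"
proof -
  note [measurable] = assms[THEN sq_int_measurable]
  have m: "(\<lambda>z. a * \<phi> z + \<psi> z) \<in> borel_measurable conf"
    by measurable
  have "integrable conf (\<lambda>z. (cmod (a * \<phi> z + \<psi> z))\<^sup>2)"
  proof (rule Bochner_Integration.integrable_bound)
    show "integrable conf (\<lambda>z. 2 * (cmod a)\<^sup>2 * (cmod (\<phi> z))\<^sup>2 + 2 * (cmod (\<psi> z))\<^sup>2)"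
      using assms by (intro Bochner_Integration.integrable_add integrable_mult_right sq_int_integrable)
    show "(\<lambda>z. (cmod (a * \<phi> z + \<psi> z))\<^sup>2) \<in> borel_measurable conf" using m by measurable
    have "(cmod (u + w))\<^sup>2 \<le> 2 * (cmod u)\<^sup>2 + 2 * (cmod w)\<^sup>2" for u w
    proof -
      have "(cmod (u + w))\<^sup>2 \<le> (cmod u + cmod w)\<^sup>2"
        by (intro power_mono norm_triangle_ineq) auto
      also have "\<dots> \<le> 2 * (cmod u)\<^sup>2 + 2 * (cmod w)\<^sup>2"
        using sum_squares_bound[of "cmod u" "cmod w"] by (simp add: power2_sum)
      finally show ?thesis .
    qed
    from this[of "a * \<phi> _" "\<psi> _"]
    show "AE z in conf. norm ((cmod (a * \<phi> z + \<psi> z))\<^sup>2)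
        \<le> norm (2 * (cmod a)\<^sup>2 * (cmod (\<phi> z))\<^sup>2 + 2 * (cmod (\<psi> z))\<^sup>2)"
      by (simp add: norm_mult power_mult_distrib mult.assoc)
  qed
  with m show ?thesis by (simp add: sq_int_def)
qed

lemma sq_int_zero: "(\<lambda>z. 0) \<in> sq_int"
  by (simp add: sq_int_def)

lemma sq_int_scale: "\<phi> \<in> sq_int \<Longrightarrow> (\<lambda>z. a * \<phi> z) \<in> sq_int"
  using sq_int_lin[OF _ sq_int_zero] by simp

lemma antisymmetric_lin:
  assumes "antisymmetric \<phi>" "antisymmetric \<psi>" shows "antisymmetric (\<lambda>z. a * \<phi> z + \<psi> z)"
  unfolding antisymmetric_def
proof (intro allI impI)
  fix \<pi> :: "'a \<Rightarrow> 'a" assume p: "\<pi> permutes UNIV"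
  show "AE z in conf. a * \<phi> (\<chi> i. fst z $ \<pi> i, \<chi> i. snd z $ \<pi> i) + \<psi> (\<chi> i. fst z $ \<pi> i, \<chi> i. snd z $ \<pi> i)
      = of_int (sign \<pi>) * (a * \<phi> z + \<psi> z)"
    using assms[unfolded antisymmetric_def, rule_format, OF p]
    by eventually_elim (auto simp: algebra_simps)
qed

lemma hilb_sq_int: "\<psi> \<in> hilb \<Longrightarrow> \<psi> \<in> sq_int"
  by (simp add: hilb_def)

lemma hilb_lin: "\<phi> \<in> hilb \<Longrightarrow> \<psi> \<in> hilb \<Longrightarrow> (\<lambda>z. a * \<phi> z + \<psi> z) \<in> hilb"
  by (simp add: hilb_def sq_int_lin antisymmetric_lin)

lemma hilb_zero: "(\<lambda>z. 0) \<in> hilb"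
  by (simp add: hilb_def sq_int_zero antisymmetric_def)

lemma hilb_scale: "\<phi> \<in> hilb \<Longrightarrow> (\<lambda>z. a * \<phi> z) \<in> hilb"
  using hilb_lin[OF _ hilb_zero] by simp

lemma hilb_diff: "\<phi> \<in> hilb \<Longrightarrow> \<psi> \<in> hilb \<Longrightarrow> (\<lambda>z. \<phi> z - \<psi> z) \<in> hilb"
  using hilb_lin[of \<psi> \<phi> "-1"] by simp

lemma hilb_sum:
  assumes "finite J" "\<And>k. k \<in> J \<Longrightarrow> b k \<in> hilb"
  shows "(\<lambda>z. \<Sum>k\<in>J. c k * b k z) \<in> hilb"
  using assms by (induction J rule: finite_induct) (auto simp: hilb_zero intro: hilb_lin)

lemma ip_cnj: "cnj (ip \<phi> \<psi>) = ip \<psi> \<phi>"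
proof -
  have "cnj (ip \<phi> \<psi>) = (LINT z|conf. cnj (cnj (\<phi> z) * \<psi> z))"
    unfolding ip_def by (rule Bochner_Integration.integral_cnj[symmetric])
  then show ?thesis by (simp add: ip_def mult.commute)
qed

lemma ip_lin:
  assumes "\<zeta> \<in> sq_int" "\<phi> \<in> sq_int" "\<psi> \<in> sq_int"
  shows "ip \<zeta> (\<lambda>z. a * \<phi> z + \<psi> z) = a * ip \<zeta> \<phi> + ip \<zeta> \<psi>"
proof -
  have "ip \<zeta> (\<lambda>z. a * \<phi> z + \<psi> z) = (LINT z|conf. a * (cnj (\<zeta> z) * \<phi> z) + cnj (\<zeta> z) * \<psi> z)"
    by (simp add: ip_def algebra_simps)
  also have "\<dots> = a * ip \<zeta> \<phi> + ip \<zeta> \<psi>"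
    using assms by (subst Bochner_Integration.integral_add) (auto simp: ip_def ip_integrable)
  finally show ?thesis .
qed

lemma ip_zero_right [simp]: "ip \<zeta> (\<lambda>z. 0) = 0"
  and ip_zero_left [simp]: "ip (\<lambda>z. 0) \<zeta> = 0"
  by (simp_all add: ip_def)

lemma ip_scale: "ip \<zeta> (\<lambda>z. a * \<phi> z) = a * ip \<zeta> \<phi>"
  by (simp add: ip_def mult.left_commute)

lemma ip_lin_left:
  assumes "\<zeta> \<in> sq_int" "\<phi> \<in> sq_int" "\<psi> \<in> sq_int"
  shows "ip (\<lambda>z. a * \<phi> z + \<psi> z) \<zeta> = cnj a * ip \<phi> \<zeta> + ip \<psi> \<zeta>"
  unfolding ip_cnj[of \<zeta> "\<lambda>z. a * \<phi> z + \<psi> z", symmetric] ip_lin[OF assms] by (simp add: ip_cnj)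

lemma ip_diff:
  assumes "\<zeta> \<in> sq_int" "\<phi> \<in> sq_int" "\<psi> \<in> sq_int"
  shows "ip \<zeta> (\<lambda>z. \<phi> z - \<psi> z) = ip \<zeta> \<phi> - ip \<zeta> \<psi>"
  using ip_lin[OF assms(1) assms(3) assms(2), of "-1"] by simp

lemma ip_sum:
  assumes "finite J" "\<zeta> \<in> hilb" "\<And>k. k \<in> J \<Longrightarrow> b k \<in> hilb"
  shows "ip \<zeta> (\<lambda>z. \<Sum>k\<in>J. c k * b k z) = (\<Sum>k\<in>J. c k * ip \<zeta> (b k))"
  using assms
proof (induction J rule: finite_induct)
  case (insert j J)
  then have "(\<lambda>z. \<Sum>k\<in>J. c k * b k z) \<in> sq_int" by (intro hilb_sq_int hilb_sum) auto
  with insert show ?case by (simp add: ip_lin hilb_sq_int)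
qed simp

lemma cnj_mult_self: "cnj w * w = complex_of_real ((cmod w)\<^sup>2)"
  by (metis complex_norm_square mult.commute)

lemma ip_self: "ip \<psi> \<psi> = of_real (LINT z|conf. (cmod (\<psi> z))\<^sup>2)"
  unfolding ip_def cnj_mult_self by (rule integral_complex_of_real)

lemma ip_self_nonneg: "0 \<le> Re (ip \<psi> \<psi>)"
  by (simp add: ip_self)

lemma ip_self_Re: "ip \<psi> \<psi> = of_real (Re (ip \<psi> \<psi>))"
  by (simp add: ip_self)

lemma hnorm_square: "(hnorm \<psi>)\<^sup>2 = Re (ip \<psi> \<psi>)"
  by (simp add: hnorm_def ip_self_nonneg)

lemma hnorm_nonneg: "0 \<le> hnorm \<psi>"
  by (simp add: hnorm_def ip_self_nonneg)

section \<open>Equality almost everywhere and the Cauchy-Schwarz inequality\<close>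

lemma wf_eq_refl: "wf_eq \<psi> \<psi>"
  by (simp add: wf_eq_def)

lemma wf_eq_sym: "wf_eq \<phi> \<psi> \<Longrightarrow> wf_eq \<psi> \<phi>"
  by (simp add: wf_eq_def eq_commute)

lemma wf_eq_trans [trans]: "wf_eq \<phi> \<psi> \<Longrightarrow> wf_eq \<psi> \<zeta> \<Longrightarrow> wf_eq \<phi> \<zeta>"
  unfolding wf_eq_def by (rule AE_mp, assumption, erule AE_mp) auto

lemma wf_eq_lin: "wf_eq \<phi> \<phi>' \<Longrightarrow> wf_eq \<psi> \<psi>' \<Longrightarrow> wf_eq (\<lambda>z. a * \<phi> z + \<psi> z) (\<lambda>z. a * \<phi>' z + \<psi>' z)"
  unfolding wf_eq_def by (rule AE_mp, assumption, erule AE_mp) auto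

lemma ip_cong:
  assumes "wf_eq \<phi> \<psi>" "\<zeta> \<in> sq_int" "\<phi> \<in> sq_int" "\<psi> \<in> sq_int"
  shows "ip \<zeta> \<phi> = ip \<zeta> \<psi>"
proof -
  note [measurable] = assms(2-4)[THEN sq_int_measurable]
  show ?thesis
    unfolding ip_def using assms(1) unfolding wf_eq_def
    by (intro integral_cong_AE) (measurable, auto)
qed

lemma ip_cong_left:
  assumes "wf_eq \<phi> \<psi>" "\<zeta> \<in> sq_int" "\<phi> \<in> sq_int" "\<psi> \<in> sq_int"
  shows "ip \<phi> \<zeta> = ip \<psi> \<zeta>"
  unfolding ip_cnj[of \<zeta> \<phi>, symmetric] ip_cong[OF assms] by (rule ip_cnj)

lemma ip_self_zero_iff:
  assumes "\<psi> \<in> sq_int" shows "ip \<psi> \<psi> = 0 \<longleftrightarrow> wf_eq \<psi> (\<lambda>z. 0)"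
  unfolding ip_self wf_eq_def
  using integral_nonneg_eq_0_iff_AE[OF sq_int_integrable[OF assms]] by simp

lemma wf_eq_iff_diff:
  assumes "\<phi> \<in> sq_int" "\<psi> \<in> sq_int"
  shows "wf_eq \<phi> \<psi> \<longleftrightarrow> ip (\<lambda>z. \<phi> z - \<psi> z) (\<lambda>z. \<phi> z - \<psi> z) = 0"
proof -
  have "(\<lambda>z. \<phi> z - \<psi> z) \<in> sq_int" using sq_int_lin[OF assms(2,1), of "-1"] by simp
  then show ?thesis by (subst ip_self_zero_iff) (auto simp: wf_eq_def)
qed

lemma Cauchy_Schwarz_ip:
  assumes "\<phi> \<in> sq_int" "\<psi> \<in> sq_int"
  shows "cmod (ip \<phi> \<psi>) \<le> hnorm \<phi> * hnorm \<psi>"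
proof (cases "ip \<phi> \<phi> = 0")
  case True
  then have "ip \<phi> \<psi> = ip (\<lambda>z. 0) \<psi>"
    using assms by (intro ip_cong_left) (auto simp: ip_self_zero_iff sq_int_zero)
  then show ?thesis by (simp add: hnorm_nonneg)
next
  case False
  define r where "r = Re (ip \<phi> \<phi>)"
  have r: "r > 0" "ip \<phi> \<phi> = of_real r"
    using False ip_self_nonneg[of \<phi>] ip_self_Re[of \<phi>] by (auto simp: r_def less_le)
  \<comment> \<open>The coefficient of the projection of \<psi> onto \<phi>, so that
    \<open>?d\<close> is orthogonal to \<phi>.\<close>
  define t where "t = ip \<phi> \<psi> / of_real r"
  let ?d = "\<lambda>z. (- t) * \<phi> z + \<psi> z"
  have d: "?d \<in> sq_int" using assms by (rule sq_int_lin)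
  have "ip \<phi> ?d = 0"
    using assms r by (simp only: ip_lin) (simp add: t_def)
  then have "ip ?d ?d = ip \<psi> ?d"
    using assms d by (simp only: ip_lin_left) simp
  also have "\<dots> = ip \<psi> \<psi> - t * ip \<psi> \<phi>"
    using assms by (simp only: ip_lin) simp
  also have "t * ip \<psi> \<phi> = of_real ((cmod (ip \<phi> \<psi>))\<^sup>2 / r)"
    unfolding t_def using ip_cnj[of \<phi> \<psi>] complex_norm_square[of "ip \<phi> \<psi>"] by simp
  finally have "0 \<le> Re (ip \<psi> \<psi>) - (cmod (ip \<phi> \<psi>))\<^sup>2 / r"
    using ip_self_nonneg[of ?d] by simp
  then have "(cmod (ip \<phi> \<psi>))\<^sup>2 \<le> (hnorm \<phi> * hnorm \<psi>)\<^sup>2"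
    using r(1) by (simp add: power_mult_distrib hnorm_square r_def[symmetric] field_simps)
  then show ?thesis
    by (rule power2_le_imp_le) (simp add: hnorm_nonneg)
qed

subsection \<open>Orthonormal bases and diagonal operators\<close>

lemma onbD:
  assumes "onb b"
  shows onb_hilb: "b k \<in> hilb" and onb_sq_int: "b k \<in> sq_int"
    and onb_ip: "ip (b j) (b k) = (if j = k then 1 else 0)"
  using assms by (auto simp: onb_def hilb_sq_int)

text \<open>Completeness in \<open>onb\<close> means convergence of the ordered partial sums, so the
  first version of Parseval's identity is about ordered series. The remainder is controlled by
  Cauchy-Schwarz.\<close>

lemma onb_parseval_sums:
  assumes b: "onb b" and "\<phi> \<in> hilb" "\<psi> \<in> hilb"
  shows "(\<lambda>k. ip \<phi> (b k) * ip (b k) \<psi>) sums ip \<phi> \<psi>"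
proof -
  let ?t = "\<lambda>m z. \<psi> z - (\<Sum>k<m. ip (b k) \<psi> * b k z)"
  have s: "(\<lambda>z. \<Sum>k<m. ip (b k) \<psi> * b k z) \<in> hilb" for m
    by (intro hilb_sum) (auto simp: onb_hilb[OF b])
  have t: "?t m \<in> hilb" for m by (intro hilb_diff assms s)
  have "(\<lambda>m. hnorm (?t m)) \<longlonglongrightarrow> 0" using assms by (simp add: onb_def)
  then have lim: "(\<lambda>m. hnorm \<phi> * hnorm (?t m)) \<longlonglongrightarrow> 0" by (rule tendsto_mult_right_zero)
  have "(\<lambda>m. ip \<phi> (?t m)) \<longlonglongrightarrow> 0"
    by (rule Lim_null_comparison[OF always_eventually[OF allI] lim], rule Cauchy_Schwarz_ip)
      (intro hilb_sq_int assms t)+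
  moreover have "ip \<phi> (?t m) = ip \<phi> \<psi> - (\<Sum>k<m. ip \<phi> (b k) * ip (b k) \<psi>)" for m
    by (subst ip_diff) (use assms s in \<open>simp_all add: hilb_sq_int ip_sum onb_hilb[OF b] mult.commute[of "ip \<phi> _"]\<close>)
  ultimately have "(\<lambda>m. ip \<phi> \<psi> - (\<Sum>k<m. ip \<phi> (b k) * ip (b k) \<psi>)) \<longlonglongrightarrow> 0" by simp
  from tendsto_diff[OF tendsto_const[of "ip \<phi> \<psi>"] this] show ?thesis
    by (simp add: sums_def)
qed

lemma onb_norm_has_sum:
  assumes "onb b" "\<psi> \<in> hilb"
  shows "((\<lambda>k. (cmod (ip (b k) \<psi>))\<^sup>2) has_sum Re (ip \<psi> \<psi>)) UNIV"
proof (rule sums_nonneg_imp_has_sum)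
  have "ip \<psi> (b k) * ip (b k) \<psi> = of_real ((cmod (ip (b k) \<psi>))\<^sup>2)" for k
    by (subst ip_cnj[symmetric], rule cnj_mult_self)
  then show "(\<lambda>k. (cmod (ip (b k) \<psi>))\<^sup>2) sums Re (ip \<psi> \<psi>)"
    using sums_Re[OF onb_parseval_sums[OF assms(1) assms(2) assms(2)]] by simp
qed simp

text \<open>Traces are unordered sums. The bound |x y| \<le> x^2 + y^2 on the coefficients gives
  absolute convergence, which removes the order.\<close>

lemma onb_parseval:
  assumes b: "onb b" and "\<phi> \<in> hilb" "\<psi> \<in> hilb"
  shows "((\<lambda>k. ip \<phi> (b k) * ip (b k) \<psi>) has_sum ip \<phi> \<psi>) UNIV"
proof (rule norm_summable_imp_has_sum)
  show "(\<lambda>k. ip \<phi> (b k) * ip (b k) \<psi>) sums ip \<phi> \<psi>"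
    using assms by (rule onb_parseval_sums)
  have "summable (\<lambda>k. (cmod (ip (b k) \<phi>))\<^sup>2 + (cmod (ip (b k) \<psi>))\<^sup>2)"
    using onb_norm_has_sum[OF b] assms by (intro summable_add) (auto dest: has_sum_imp_sums sums_summable)
  then show "summable (\<lambda>k. norm (ip \<phi> (b k) * ip (b k) \<psi>))"
  proof (rule summable_comparison_test'[where N=0])
    fix k
    have "cmod (ip \<phi> (b k)) = cmod (ip (b k) \<phi>)" by (metis ip_cnj complex_mod_cnj)
    then show "norm (norm (ip \<phi> (b k) * ip (b k) \<psi>)) \<le> (cmod (ip (b k) \<phi>))\<^sup>2 + (cmod (ip (b k) \<psi>))\<^sup>2"
      using norm_mult_le_sum_squares[of "cmod (ip (b k) \<phi>)" "cmod (ip (b k) \<psi>)"] by (simp add: norm_mult)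
  qed
qed

text \<open>Throughout the development, equality of vectors is established through this comparison
  of coefficients.\<close>

lemma onb_eqI:
  assumes b: "onb b" and "\<phi> \<in> hilb" "\<psi> \<in> hilb" "\<And>k. ip (b k) \<phi> = ip (b k) \<psi>"
  shows "wf_eq \<phi> \<psi>"
proof -
  have d: "(\<lambda>z. \<phi> z - \<psi> z) \<in> hilb" by (rule hilb_diff[OF assms(2,3)])
  have "ip (b k) (\<lambda>z. \<phi> z - \<psi> z) = 0" for k
    by (subst ip_diff) (use assms in \<open>auto simp: hilb_sq_int onb_sq_int[OF b]\<close>)
  then have "ip (\<lambda>z. \<phi> z - \<psi> z) (\<lambda>z. \<phi> z - \<psi> z) = 0"
    using onb_parseval[OF b d d] using has_sum_unique[OF _ has_sum_0] by (metis (no_types, lifting) mult_zero_right)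
  then show ?thesis using assms by (subst wf_eq_iff_diff) (auto simp: hilb_sq_int)
qed

section \<open>Bounded operators that are diagonal in a basis\<close>

lemma bounded_op_hilb: "bounded_op T \<Longrightarrow> \<psi> \<in> hilb \<Longrightarrow> T \<psi> \<in> hilb"
  by (simp add: bounded_op_def)

lemma bounded_op_lin:
  "bounded_op T \<Longrightarrow> \<phi> \<in> hilb \<Longrightarrow> \<psi> \<in> hilb \<Longrightarrow> wf_eq (T (\<lambda>z. a * \<phi> z + \<psi> z)) (\<lambda>z. a * T \<phi> z + T \<psi> z)"
  by (simp add: bounded_op_def)

text \<open>Linearity with the scalar -1 reads T 0 = - T 0 + T 0.\<close>

lemma bounded_op_zero:
  assumes "bounded_op T" shows "wf_eq (T (\<lambda>z. 0)) (\<lambda>z. 0)"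
  using bounded_op_lin[OF assms hilb_zero hilb_zero, of "-1"] by simp

lemma bounded_op_sum:
  assumes "bounded_op T" "finite J" "\<And>k. k \<in> J \<Longrightarrow> b k \<in> hilb"
  shows "wf_eq (T (\<lambda>z. \<Sum>k\<in>J. c k * b k z)) (\<lambda>z. \<Sum>k\<in>J. c k * T (b k) z)"
  using assms(2,3)
proof (induction J rule: finite_induct)
  case empty
  then show ?case using bounded_op_zero[OF assms(1)] by simp
next
  case (insert j J)
  have "wf_eq (T (\<lambda>z. c j * b j z + (\<Sum>k\<in>J. c k * b k z))) (\<lambda>z. c j * T (b j) z + T (\<lambda>z. \<Sum>k\<in>J. c k * b k z) z)"
    using insert by (intro bounded_op_lin assms(1) hilb_sum) auto
  also have "wf_eq \<dots> (\<lambda>z. c j * T (b j) z + (\<Sum>k\<in>J. c k * T (b k) z))"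
    using insert by (intro wf_eq_lin wf_eq_refl) auto
  finally show ?case using insert by simp
qed

text \<open>On a partial sum of the expansion of \<psi> the claim is linearity; the remainder tends
  to 0 in norm, and the boundedness of \<open>T\<close> carries this over to its image. No symmetry
  of \<open>T\<close> is involved, so the eigenvalues may be complex here.\<close>

lemma diagonal_coeff:
  assumes T: "bounded_op T" and b: "onb b"
    and diag: "\<And>k. wf_eq (T (b k)) (\<lambda>z. l k * b k z)" and psi: "\<psi> \<in> hilb"
  shows "ip (b k) (T \<psi>) = l k * ip (b k) \<psi>"
proof -
  let ?s = "\<lambda>m z. \<Sum>j<m. ip (b j) \<psi> * b j z"
  let ?t = "\<lambda>m z. \<psi> z - ?s m z"
  have s: "?s m \<in> hilb" for m by (intro hilb_sum) (auto simp: onb_hilb[OF b])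
  have t: "?t m \<in> hilb" for m by (intro hilb_diff psi s)
  obtain C where C: "\<And>\<phi>. \<phi> \<in> hilb \<Longrightarrow> hnorm (T \<phi>) \<le> C * hnorm \<phi>"
    using T unfolding bounded_op_def by blast
  have "(\<lambda>m. hnorm (?t m)) \<longlonglongrightarrow> 0" using psi b by (simp add: onb_def)
  then have lim: "(\<lambda>m. C * hnorm (?t m)) \<longlonglongrightarrow> 0" by (rule tendsto_mult_right_zero)
  have "(\<lambda>m. ip (b k) (T (?t m))) \<longlonglongrightarrow> 0"
  proof (rule Lim_null_comparison[OF _ lim], rule always_eventually, rule allI)
    fix m
    have "norm (ip (b k) (T (?t m))) \<le> hnorm (b k) * hnorm (T (?t m))"
      by (rule Cauchy_Schwarz_ip[OF onb_sq_int[OF b] hilb_sq_int[OF bounded_op_hilb[OF T t]]])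
    also have "hnorm (b k) = 1" using b by (simp add: hnorm_def onb_ip)
    finally show "norm (ip (b k) (T (?t m))) \<le> C * hnorm (?t m)" using C[OF t, of m] by simp
  qed
  \<comment> \<open>As soon as \<open>m > k\<close>, the k-th term belongs to the partial sum, so
    the left side no longer depends on \<open>m\<close> and must equal the limit 0.\<close>
  moreover have "ip (b k) (T \<psi>) - l k * ip (b k) \<psi> = ip (b k) (T (?t m))" if "m > k" for m
  proof -
    note TH = bounded_op_hilb[OF T]
    note TS = hilb_sq_int[OF TH]
    note bh = onb_hilb[OF b] and bs = onb_sq_int[OF b]
    have "wf_eq (T (\<lambda>z. 1 * ?t m z + ?s m z)) (\<lambda>z. 1 * T (?t m) z + T (?s m) z)"
      by (rule bounded_op_lin[OF T t s])
    then have "wf_eq (T \<psi>) (\<lambda>z. 1 * T (?t m) z + T (?s m) z)" by simp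
    from ip_cong[OF this bs TS[OF psi] sq_int_lin[OF TS[OF t] TS[OF s]]]
    have "ip (b k) (T \<psi>) = ip (b k) (\<lambda>z. 1 * T (?t m) z + T (?s m) z)" .
    also have "\<dots> = ip (b k) (T (?t m)) + ip (b k) (T (?s m))"
      by (subst ip_lin[OF bs TS[OF t] TS[OF s]]) simp
    also have "ip (b k) (T (?s m)) = ip (b k) (\<lambda>z. \<Sum>j<m. ip (b j) \<psi> * T (b j) z)"
      by (rule ip_cong[OF bounded_op_sum[OF T finite_lessThan bh] bs TS[OF s] hilb_sq_int[OF hilb_sum[OF finite_lessThan TH[OF bh]]]])
    also have "\<dots> = (\<Sum>j<m. ip (b j) \<psi> * ip (b k) (T (b j)))"
      by (rule ip_sum[OF finite_lessThan bh TH[OF bh]])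
    also have "\<dots> = (\<Sum>j<m. if j = k then l k * ip (b k) \<psi> else 0)"
    proof (intro sum.cong refl)
      fix j
      have "ip (b k) (T (b j)) = ip (b k) (\<lambda>z. l j * b j z)"
        by (rule ip_cong[OF diag bs TS[OF bh] sq_int_scale[OF bs]])
      then show "ip (b j) \<psi> * ip (b k) (T (b j)) = (if j = k then l k * ip (b k) \<psi> else 0)"
        by (simp add: ip_scale onb_ip[OF b])
    qed
    finally show ?thesis using that by simp
  qed
  ultimately have "(\<lambda>m::nat. ip (b k) (T \<psi>) - l k * ip (b k) \<psi>) \<longlonglongrightarrow> 0"
    using tendsto_cong[OF eventually_mono[OF eventually_gt_at_top[of k]], of "\<lambda>m. ip (b k) (T \<psi>) - l k * ip (b k) \<psi>" "\<lambda>m. ip (b k) (T (?t m))" 0]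
    by blast
  then have "ip (b k) (T \<psi>) - l k * ip (b k) \<psi> = 0" by (simp only: LIMSEQ_const_iff)
  then show ?thesis by (simp only: right_minus_eq)
qed

lemma diagonal_quadratic:
  assumes T: "bounded_op T" and b: "onb b"
    and diag: "\<And>k. wf_eq (T (b k)) (\<lambda>z. of_real (l k) * b k z)" and psi: "\<psi> \<in> hilb"
  shows "((\<lambda>k. of_real (l k * (cmod (ip (b k) \<psi>))\<^sup>2)) has_sum ip \<psi> (T \<psi>)) UNIV"
proof -
  have "ip \<psi> (b k) * ip (b k) (T \<psi>) = of_real (l k * (cmod (ip (b k) \<psi>))\<^sup>2)" for k
  proof -
    have "ip \<psi> (b k) * ip (b k) (T \<psi>) = of_real (l k) * (cnj (ip (b k) \<psi>) * ip (b k) \<psi>)"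
      by (subst diagonal_coeff[OF T b diag psi], subst ip_cnj) (rule mult.left_commute)
    then show ?thesis by (simp only: cnj_mult_self of_real_mult)
  qed
  then show ?thesis
    using onb_parseval[OF b psi bounded_op_hilb[OF T psi]] by simp
qed

lemma diagonal_eigenvector:
  assumes T: "bounded_op T" and b: "onb b"
    and diag: "\<And>k. wf_eq (T (b k)) (\<lambda>z. l k * b k z)" and psi: "\<psi> \<in> hilb"
    and ev: "wf_eq (T \<psi>) (\<lambda>z. p * \<psi> z)" and "ip (b k) \<psi> \<noteq> 0"
  shows "l k = p"
proof -
  have "ip (b k) (T \<psi>) = ip (b k) (\<lambda>z. p * \<psi> z)"
    by (rule ip_cong[OF ev onb_sq_int[OF b] hilb_sq_int[OF bounded_op_hilb[OF T psi]] sq_int_scale[OF hilb_sq_int[OF psi]]])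
  then show ?thesis using diagonal_coeff[OF T b diag psi, of k] assms(6) by (simp add: ip_scale)
qed

text \<open>An eigenvector of \<open>T\<close> only has components along basis vectors with the same eigenvalue, so it is
  also an eigenvector of \<open>f(T)\<close>.\<close>

lemma diagonal_function_eigenvector:
  assumes T: "bounded_op T" and L: "bounded_op L" and b: "onb b"
    and dT: "\<And>k. wf_eq (T (b k)) (\<lambda>z. of_real (l k) * b k z)"
    and dL: "\<And>k. wf_eq (L (b k)) (\<lambda>z. of_real (f (l k)) * b k z)"
    and psi: "\<psi> \<in> hilb" and ev: "wf_eq (T \<psi>) (\<lambda>z. of_real p * \<psi> z)"
  shows "wf_eq (L \<psi>) (\<lambda>z. of_real (f p) * \<psi> z)"
proof (rule onb_eqI[OF b bounded_op_hilb[OF L psi] hilb_scale[OF psi]])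
  fix k
  show "ip (b k) (L \<psi>) = ip (b k) (\<lambda>z. of_real (f p) * \<psi> z)"
    using diagonal_eigenvector[OF T b dT psi ev, of k]
    by (cases "ip (b k) \<psi> = 0") (auto simp: diagonal_coeff[OF L b dL psi] ip_scale)
qed

section \<open>Trace and entropy in an eigenbasis\<close>

lemma eigensystem_graph:
  assumes "eigensystem (graph_of T) b p"
  shows eigensystem_onb: "onb b" and eigensystem_eq: "wf_eq (T (b k)) (\<lambda>z. of_real (p k) * b k z)"
  using assms by (auto simp: eigensystem_def graph_of_def intro: wf_eq_sym)

lemma eigensystem_trace:
  assumes "bounded_op T" "eigensystem (graph_of T) b p" "has_trace T t"
  shows "((\<lambda>k. of_real (p k)) has_sum t) UNIV"
proof -
  note b = eigensystem_onb[OF assms(2)]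
  have "ip (b k) (T (b k)) = of_real (p k)" for k
    using diagonal_coeff[OF assms(1) b eigensystem_eq[OF assms(2)] onb_hilb[OF b], of k k] by (simp add: onb_ip[OF b])
  moreover have "((\<lambda>k. ip (b k) (T (b k))) has_sum t) UNIV"
    using assms(3) b unfolding has_trace_def by blast
  ultimately show ?thesis by simp
qed

text \<open>\<open>has_entropy\<close> brings its own eigenbasis, which may differ from
  \<open>b\<close> when eigenvalues are degenerate. The operator \<open>L\<close> acts on both by
  the same function of the eigenvalue, so the entropy may be computed in whichever eigenbasis the
  energy constraint supplies.\<close>

lemma entropy_has_sum:
  assumes "bounded_op \<rho>" "has_entropy \<rho> s" "eigensystem (graph_of \<rho>) b p"
  shows "((\<lambda>k. p k * ln (p k)) has_sum (- s)) UNIV"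
proof -
  obtain L b' p' where L: "bounded_op L" "has_trace L (of_real (- s))"
    and b': "eigensystem (graph_of \<rho>) b' p'" "\<And>k. wf_eq (L (b' k)) (\<lambda>z. of_real (p' k * ln (p' k)) * b' k z)"
    using assms(2) unfolding has_entropy_def fun_of_op_def by blast
  note b = eigensystem_onb[OF assms(3)]
  have "wf_eq (L (b k)) (\<lambda>z. of_real (p k * ln (p k)) * b k z)" for k
    by (rule diagonal_function_eigenvector[where f = "\<lambda>p. p * ln p", OF assms(1) L(1) eigensystem_onb[OF b'(1)]
        eigensystem_eq[OF b'(1)] b'(2) onb_hilb[OF b] eigensystem_eq[OF assms(3)]])
  then have "eigensystem (graph_of L) b (\<lambda>k. p k * ln (p k))"
    using b by (auto simp: eigensystem_def graph_of_def onb_hilb hilb_scale intro: wf_eq_sym)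
  from has_sum_Re[OF eigensystem_trace[OF L(1) this L(2)]]
  show ?thesis by (simp only: Re_complex_of_real)
qed

lemma has_entropy_unique:
  assumes "bounded_op \<rho>" "has_entropy \<rho> s" "has_entropy \<rho> s'" shows "s = s'"
proof -
  obtain b p where "eigensystem (graph_of \<rho>) b p"
    using assms(2) unfolding has_entropy_def fun_of_op_def by blast
  from has_sum_unique[OF entropy_has_sum[OF assms(1,2) this] entropy_has_sum[OF assms(1,3) this]]
  show ?thesis by simp
qed

subsection \<open>Test functions\<close>

lemma test_functionD:
  assumes "test_function f f'"
  shows test_function_derivative: "(f has_derivative blinfun_apply (f' x)) (at x)"
    and test_function_continuous_derivative: "continuous_on UNIV f'"
    and test_function_bounded_support: "bounded {x. f x \<noteq> 0}"
  using assms by (auto simp: test_function_def)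

lemma test_function_continuous:
  assumes "test_function f f'" shows "continuous_on UNIV f"
  using test_function_derivative[OF assms] by (meson has_derivative_continuous continuous_at_imp_continuous_on)

lemma test_function_measurable:
  assumes "test_function f f'" shows "f \<in> borel_measurable borel"
  using test_function_continuous[OF assms] by (rule borel_measurable_continuous_onI)

lemma test_function_derivative_measurable:
  assumes "test_function f f'" shows "(\<lambda>x. blinfun_apply (f' x) h) \<in> borel_measurable borel"
  by (rule borel_measurable_continuous_onI)
    (intro continuous_intros test_function_continuous_derivative[OF assms])

text \<open>Closure under products makes the supports intersection stable and also yields the weak
  product rule for momenta.\<close>

lemma test_function_mult:
  assumes f: "test_function f f'" and g: "test_function g g'"
  shows "test_function (\<lambda>x. f x * g x) (\<lambda>x. f x *\<^sub>R g' x + g x *\<^sub>R f' x)"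
  unfolding test_function_def
proof (intro conjI allI)
  fix x
  have "blinfun_apply (f x *\<^sub>R g' x + g x *\<^sub>R f' x) = (\<lambda>h. f x * blinfun_apply (g' x) h + blinfun_apply (f' x) h * g x)"
    by (simp add: fun_eq_iff blinfun.add_left blinfun.scaleR_left)
  then show "((\<lambda>x. f x * g x) has_derivative blinfun_apply (f x *\<^sub>R g' x + g x *\<^sub>R f' x)) (at x)"
    using has_derivative_mult[OF test_function_derivative[OF f] test_function_derivative[OF g]] by simp
  show "continuous_on UNIV (\<lambda>x. f x *\<^sub>R g' x + g x *\<^sub>R f' x)"
    by (intro continuous_intros test_function_continuous_derivative[OF f] test_function_continuous_derivative[OF g]
        test_function_continuous[OF f] test_function_continuous[OF g])
  show "bounded {x. f x * g x \<noteq> 0}"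
    by (rule bounded_subset[OF test_function_bounded_support[OF f]]) auto
qed

lemma test_function_comp:
  assumes f: "test_function f f'" and d: "\<And>t. (\<phi> has_real_derivative \<phi>' t) (at t)"
    and c: "continuous_on UNIV \<phi>'" and "\<phi> 0 = 0"
  shows "test_function (\<lambda>x. \<phi> (f x)) (\<lambda>x. \<phi>' (f x) *\<^sub>R f' x)"
  unfolding test_function_def
proof (intro conjI allI)
  fix x
  have "blinfun_apply (\<phi>' (f x) *\<^sub>R f' x) = (\<lambda>h. blinfun_apply (f' x) h * \<phi>' (f x))"
    by (simp add: fun_eq_iff blinfun.scaleR_left mult.commute)
  then show "((\<lambda>x. \<phi> (f x)) has_derivative blinfun_apply (\<phi>' (f x) *\<^sub>R f' x)) (at x)"
    using DERIV_compose_FDERIV[OF d test_function_derivative[OF f]] by simp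
  show "continuous_on UNIV (\<lambda>x. \<phi>' (f x) *\<^sub>R f' x)"
    by (intro continuous_intros test_function_continuous_derivative[OF f]
        continuous_on_compose2[OF c test_function_continuous[OF f]]) auto
  show "bounded {x. \<phi> (f x) \<noteq> 0}"
    by (rule bounded_subset[OF test_function_bounded_support[OF f]]) (auto simp: assms(4))
qed

text \<open>Squaring smooths the kink at 0. The result is a C^1 cut-off profile, which is all that
  \<open>test_function\<close> demands.\<close>

lemma DERIV_max_0_square: "((\<lambda>t. (max 0 t)\<^sup>2) has_real_derivative 2 * max 0 t) (at t)"
proof -
  consider "t > 0" | "t < 0" | "t = 0" by linarith
  then show ?thesis
  proof cases
    case 1
    have "((\<lambda>t. t\<^sup>2) has_real_derivative 2 * max 0 t) (at t)"
      using 1 by (auto intro!: derivative_eq_intros)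
    then show ?thesis
      by (rule has_field_derivative_transform_within_open[where S = "{0<..}"]) (use 1 in auto)
  next
    case 2
    have "((\<lambda>t. 0) has_real_derivative 2 * max 0 t) (at t)"
      using 2 by (auto intro!: derivative_eq_intros)
    then show ?thesis
      by (rule has_field_derivative_transform_within_open[where S = "{..<0}"]) (use 2 in auto)
  next
    case 3
    have "((\<lambda>h::real. (max 0 h)\<^sup>2 / h) \<longlongrightarrow> 0) (at 0)"
    proof (rule Lim_null_comparison)
      show "\<forall>\<^sub>F h in at 0. norm ((max 0 h)\<^sup>2 / h) \<le> norm (h::real)"
        by (rule always_eventually) (auto simp: max_def power2_eq_square)
      show "((\<lambda>h::real. norm h) \<longlongrightarrow> 0) (at 0)"
        by (rule tendsto_eq_intros | simp)+
    qed
    then show ?thesis using 3 by (simp add: DERIV_def)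
  qed
qed

text \<open>The witness is the square of the positive part of r^2 - |x - x0|^2. Radii \<le> 0 are
  served by the zero function, so that every ball is a support.\<close>

lemma ball_test_function:
  fixes x0 :: "(real^3)^'n::finite"
  shows "\<exists>f f'. test_function f f' \<and> {x. f x \<noteq> 0} = ball x0 r"
proof (cases "r > 0")
  case False
  have "test_function (\<lambda>x::(real^3)^'n. 0) (\<lambda>x. 0)"
    unfolding test_function_def by (auto intro!: has_derivative_eq_rhs[OF has_derivative_const])
  moreover have "ball x0 r = {}" using False by simp
  ultimately show ?thesis by (intro exI[of _ "\<lambda>x. 0"] exI[of _ "\<lambda>x. 0"]) blast
next
  case True
  define g where "g = (\<lambda>x. r\<^sup>2 - (x - x0) \<bullet> (x - x0))"
  let ?f = "\<lambda>x. (max 0 (g x))\<^sup>2" and ?f' = "\<lambda>x. (2 * max 0 (g x)) *\<^sub>R blinfun_inner_left ((-2) *\<^sub>R (x - x0))"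
  have g: "(g has_derivative (\<lambda>h. h \<bullet> ((-2) *\<^sub>R (x - x0)))) (at x)" for x
    unfolding g_def by (rule derivative_eq_intros refl | simp add: fun_eq_iff inner_commute)+
  have "g x > 0 \<longleftrightarrow> x \<in> ball x0 r" for x
  proof -
    have "g x > 0 \<longleftrightarrow> (norm (x - x0))\<^sup>2 < r\<^sup>2" by (simp add: g_def power2_norm_eq_inner)
    also have "\<dots> \<longleftrightarrow> norm (x - x0) < r"
      using True by (metis norm_ge_zero less_eq_real_def power2_less_imp_less power_strict_mono zero_less_numeral pos2)
    finally show ?thesis by (simp add: dist_norm norm_minus_commute)
  qed
  moreover have "?f x \<noteq> 0 \<longleftrightarrow> g x > 0" for x
    by (cases "g x > 0") (auto simp: max_def not_less)
  ultimately have s: "{x. ?f x \<noteq> 0} = ball x0 r"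
    by (simp only: set_eq_iff mem_Collect_eq simp_thms)
  have "test_function ?f ?f'"
    unfolding test_function_def
  proof (intro conjI allI)
    fix x
    have "blinfun_apply (?f' x) = (\<lambda>h. h \<bullet> ((-2) *\<^sub>R (x - x0)) * (2 * max 0 (g x)))"
      by (simp add: fun_eq_iff blinfun.scaleR_left)
    then show "(?f has_derivative blinfun_apply (?f' x)) (at x)"
      using DERIV_compose_FDERIV[OF DERIV_max_0_square g] by simp
    show "continuous_on UNIV ?f'"
      unfolding g_def by (intro continuous_intros)
    show "bounded {x. ?f x \<noteq> 0}" by (rule bounded_subset[OF bounded_ball[of x0 r]]) (use s in blast)
  qed
  with s show ?thesis by (intro exI conjI)
qed

text \<open>On a closed ball containing the support, compactness bounds both functions. The
  complement of the ball is open and \<open>f\<close> vanishes there, hence so does the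
  derivative.\<close>

lemma test_function_bounds:
  assumes f: "test_function f f'"
  shows "\<exists>B R. \<forall>x h. \<bar>f x\<bar> \<le> B * indicator (cball 0 R) x \<and> \<bar>blinfun_apply (f' x) h\<bar> \<le> B * norm h * indicator (cball 0 R) x"
proof -
  obtain R where R: "\<And>x. f x \<noteq> 0 \<Longrightarrow> norm x \<le> R"
    using test_function_bounded_support[OF f] by (auto simp: bounded_iff)
  have out: "f x = 0" "f' x = 0" if "x \<notin> cball 0 R" for x
  proof -
    show "f x = 0" using R[of x] that by auto
    have "(f has_derivative (\<lambda>h. 0)) (at x)"
      by (rule has_derivative_transform_within_open[where f = "\<lambda>x. 0" and s = "- cball 0 R"])
        (use that R in \<open>auto intro!: derivative_eq_intros simp: open_Compl\<close>)
    then have "blinfun_apply (f' x) = (\<lambda>h. 0)"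
      using has_derivative_unique[OF test_function_derivative[OF f]] by blast
    then show "f' x = 0" by (intro blinfun_eqI) simp
  qed
  have "bounded (f ` cball 0 R)"
    by (intro compact_imp_bounded compact_continuous_image continuous_on_subset[OF test_function_continuous[OF f]]) auto
  then obtain B1 where B1: "\<And>x. x \<in> cball 0 R \<Longrightarrow> \<bar>f x\<bar> \<le> B1" by (force simp: bounded_iff)
  have "bounded (f' ` cball 0 R)"
    by (intro compact_imp_bounded compact_continuous_image continuous_on_subset[OF test_function_continuous_derivative[OF f]]) auto
  then obtain B2 where B2: "\<And>x. x \<in> cball 0 R \<Longrightarrow> norm (f' x) \<le> B2" by (force simp: bounded_iff)
  have "\<bar>f x\<bar> \<le> max B1 B2 * indicator (cball 0 R) x \<and> \<bar>blinfun_apply (f' x) h\<bar> \<le> max B1 B2 * norm h * indicator (cball 0 R) x" for x h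
  proof (cases "x \<in> cball 0 R")
    case True
    have "\<bar>blinfun_apply (f' x) h\<bar> \<le> norm (f' x) * norm h"
      using norm_blinfun[of "f' x" h] by simp
    also have "\<dots> \<le> max B1 B2 * norm h" using B2[OF True] by (intro mult_right_mono) auto
    finally show ?thesis using B1[OF True] True by auto
  qed (use out in auto)
  then show ?thesis by blast
qed

text \<open>A spin component of \<psi> is square integrable and the other factor is bounded with
  bounded support, so the product is dominated by |\<psi>|^2 plus a multiple of the indicator of a
  ball.\<close>

lemma test_function_integrable_product:
  fixes \<psi> :: "'n::finite wf"
  assumes f: "test_function f f'" and psi: "\<psi> \<in> sq_int"
  shows "integrable lborel (\<lambda>x. \<psi> (x, s) * of_real (f x))"
    and "integrable lborel (\<lambda>x. \<psi> (x, s) * of_real (blinfun_apply (f' x) h))"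
proof -
  obtain B R where B: "\<And>x. \<bar>f x\<bar> \<le> B * indicator (cball 0 R) x"
    "\<And>x h. \<bar>blinfun_apply (f' x) h\<bar> \<le> B * norm h * indicator (cball 0 R) x"
    using test_function_bounds[OF f] by metis
  have *: "integrable lborel (\<lambda>x. \<psi> (x, s) * of_real (g x))"
    if g: "g \<in> borel_measurable borel" and C: "\<And>x. \<bar>g x\<bar> \<le> C * indicator (cball 0 R) x" for g C
  proof (rule Bochner_Integration.integrable_bound)
    have "integrable lborel (\<lambda>x. (cmod (\<psi> (x, s)))\<^sup>2)"
      using integrable_conf_slice[OF sq_int_integrable[OF psi]] .
    moreover have "integrable lborel (indicator (cball (0::(real^3)^'n) R) :: _ \<Rightarrow> real)"
      by (rule integrable_real_indicator) (use emeasure_lborel_cball_finite[of 0 R] in auto)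
    ultimately show "integrable lborel (\<lambda>x. (cmod (\<psi> (x, s)))\<^sup>2 + C\<^sup>2 * indicator (cball 0 R) x)"
      by (intro Bochner_Integration.integrable_add integrable_mult_right)
    show "(\<lambda>x. \<psi> (x, s) * of_real (g x)) \<in> borel_measurable lborel"
      using slice_measurable[OF sq_int_measurable[OF psi]] g by measurable
    have "norm (\<psi> (x, s) * of_real (g x)) \<le> (cmod (\<psi> (x, s)))\<^sup>2 + C\<^sup>2 * indicator (cball 0 R) x" for x
    proof -
      have "norm (\<psi> (x, s) * of_real (g x)) \<le> (cmod (\<psi> (x, s)))\<^sup>2 + (g x)\<^sup>2"
        using norm_mult_le_sum_squares[of "cmod (\<psi> (x, s))" "g x"] by (simp add: norm_mult)
      moreover have "(g x)\<^sup>2 \<le> C\<^sup>2 * indicator (cball 0 R) x"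
        using C[of x] abs_le_square_iff[of "g x" C] by (cases "x \<in> cball 0 R") auto
      ultimately show ?thesis by linarith
    qed
    then show "AE x in lborel. norm (\<psi> (x, s) * of_real (g x)) \<le> norm ((cmod (\<psi> (x, s)))\<^sup>2 + C\<^sup>2 * indicator (cball 0 R) x)"
      by (intro always_eventually allI) (simp add: abs_of_nonneg)
  qed
  show "integrable lborel (\<lambda>x. \<psi> (x, s) * of_real (f x))"
    by (rule *[OF test_function_measurable[OF f] B(1)])
  show "integrable lborel (\<lambda>x. \<psi> (x, s) * of_real (blinfun_apply (f' x) h))"
    by (rule *[OF test_function_derivative_measurable[OF f] B(2)])
qed

text \<open>The sets where some test function does not vanish are an intersection stable generator of the
  Borel sets, and their indicators are the limits of the test functions \<open>1 - exp (- k f\<^sup>2)\<close>.\<close>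

lemma sigma_sets_test_function_supports:
  "sigma_sets UNIV {{x. f x \<noteq> 0} | f f'. test_function f f'} = sets (borel :: ((real^3)^'n::finite) measure)"
proof -
  let ?E = "{{x. f x \<noteq> 0} | f f'. test_function f f'} :: ((real^3)^'n) set set"
  have "sigma_sets UNIV {S :: ((real^3)^'n) set. open S} = sigma_sets UNIV ?E"
  proof (rule sigma_sets_eqI)
    fix S :: "((real^3)^'n) set" assume "S \<in> {S. open S}"
    then have S: "open S" by simp
    \<comment> \<open>An open set is the union of all balls inside it; Lindelof's theorem extracts a
      countable subfamily, as a sigma-algebra requires.\<close>
    let ?F = "{ball x r |x r. ball x r \<subseteq> S}"
    obtain F' where F': "F' \<subseteq> ?F" "countable F'" "\<Union>F' = \<Union>?F"
      by (rule Lindelof[of ?F]) auto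
    have "\<Union>?F = S"
    proof (intro equalityI subsetI)
      fix x assume "x \<in> S"
      with S obtain e where "e > 0" "ball x e \<subseteq> S" by (rule openE)
      then have "ball x e \<in> ?F" "x \<in> ball x e" by auto
      then show "x \<in> \<Union>?F" by (rule UnionI)
    qed auto
    moreover have "\<Union>F' \<in> sigma_sets UNIV ?E"
    proof (rule sigma_sets_UNION[OF F'(2)])
      fix B assume "B \<in> F'"
      then obtain x r where "B = ball x r" using F'(1) by auto
      moreover obtain f f' where "test_function f f'" "{x. f x \<noteq> 0} = ball x r"
        using ball_test_function[of x r] by blast
      ultimately show "B \<in> sigma_sets UNIV ?E" by (intro sigma_sets.Basic) auto
    qed
    ultimately show "S \<in> sigma_sets UNIV ?E" using F'(3) by simp
  next
    fix B assume "B \<in> ?E"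
    then obtain f f' where f: "test_function f f'" "B = {x. f x \<noteq> 0}" by auto
    have "open B" unfolding f(2)
      by (intro open_Collect_neq test_function_continuous[OF f(1)] continuous_on_const)
    then show "B \<in> sigma_sets UNIV {S. open S}" by (intro sigma_sets.Basic) simp
  qed
  then show ?thesis by (simp add: borel_def)
qed

lemma set_integral_test_functions_zero:
  fixes T :: "'z \<Rightarrow> (real^3)^'n::finite" and h :: "'z \<Rightarrow> complex"
  assumes T [measurable]: "T \<in> borel_measurable M" and h: "integrable M h"
    and zero: "\<And>f f'. test_function f f' \<Longrightarrow> (LINT z|M. h z * of_real (f (T z))) = 0"
    and B: "B \<in> sets borel"
  shows "(LINT z:(T -` B \<inter> space M)|M. h z) = 0"
proof -
  let ?E = "{{x. f x \<noteq> 0} | f f'. test_function f f'} :: ((real^3)^'n) set set"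
  have h_meas [measurable]: "h \<in> borel_measurable M" using h by simp
  have setM: "T -` A \<inter> space M \<in> sets M" if "A \<in> sets borel" for A
    using measurable_sets[OF T that] .
  have Edef: "sigma_sets UNIV ?E = sets borel" by (rule sigma_sets_test_function_supports)
  have basic: "(LINT z:(T -` A \<inter> space M)|M. h z) = 0" if "A \<in> ?E" for A
  proof -
    obtain f f' where f: "test_function f f'" and A: "A = {x. f x \<noteq> 0}" using \<open>A \<in> ?E\<close> by auto
    have [measurable]: "f \<in> borel_measurable borel" by (rule test_function_measurable[OF f])
    have [measurable]: "A \<in> sets borel" unfolding A by measurable
    define \<phi> where "\<phi> k t = 1 - exp (- (real k * t\<^sup>2))" for k t
    have tf: "test_function (\<lambda>x. \<phi> k (f x)) (\<lambda>x. (exp (- (real k * (f x)\<^sup>2)) * (2 * real k * f x)) *\<^sub>R f' x)" for k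
      by (rule test_function_comp[OF f]) (auto simp: \<phi>_def intro!: derivative_eq_intros continuous_intros)
    have "(\<lambda>k. LINT z|M. h z * of_real (\<phi> k (f (T z)))) \<longlonglongrightarrow> (LINT z|M. indicator (T -` A \<inter> space M) z *\<^sub>R h z)"
    proof (rule integral_dominated_convergence)
      show "integrable M (\<lambda>z. cmod (h z))" using h by (rule integrable_norm)
      show "(\<lambda>z. indicator (T -` A \<inter> space M) z *\<^sub>R h z) \<in> borel_measurable M"
        using setM[of A] by measurable
      show "(\<lambda>z. h z * of_real (\<phi> k (f (T z)))) \<in> borel_measurable M" for k
        unfolding \<phi>_def by measurable
      have "norm (h z * of_real (\<phi> k (f (T z)))) \<le> cmod (h z)" for z k
      proof -
        have "\<bar>\<phi> k (f (T z))\<bar> \<le> 1" by (simp add: \<phi>_def)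
        then show ?thesis by (simp add: norm_mult mult_left_le)
      qed
      then show "AE z in M. norm (h z * of_real (\<phi> k (f (T z)))) \<le> cmod (h z)" for k by simp
      have lim: "(\<lambda>k. \<phi> k t) \<longlonglongrightarrow> (if t = 0 then 0 else 1)" for t
      proof (cases "t = 0")
        case False
        have "(\<lambda>k. (exp (- t\<^sup>2)) ^ k) \<longlonglongrightarrow> 0" using False by (intro LIMSEQ_realpow_zero) auto
        moreover have e: "exp (- (real k * t\<^sup>2)) = exp (- t\<^sup>2) ^ k" for k
          using exp_of_nat_mult[of k "- t\<^sup>2"] by simp
        ultimately have "(\<lambda>k. exp (- (real k * t\<^sup>2))) \<longlonglongrightarrow> 0" by (simp only: e)
        from tendsto_diff[OF tendsto_const[of 1] this] show ?thesis using False by (simp add: \<phi>_def)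
      qed (simp add: \<phi>_def)
      show "AE z in M. (\<lambda>k. h z * of_real (\<phi> k (f (T z)))) \<longlonglongrightarrow> indicator (T -` A \<inter> space M) z *\<^sub>R h z"
      proof (rule AE_I2)
        fix z assume z: "z \<in> space M"
        have "(\<lambda>k. h z * of_real (\<phi> k (f (T z)))) \<longlonglongrightarrow> h z * of_real (if f (T z) = 0 then 0 else 1)"
          by (intro tendsto_mult tendsto_const tendsto_of_real lim)
        then show "(\<lambda>k. h z * of_real (\<phi> k (f (T z)))) \<longlonglongrightarrow> indicator (T -` A \<inter> space M) z *\<^sub>R h z"
          using z by (cases "f (T z) = 0") (auto simp: A)
      qed
    qed
    moreover have "(LINT z|M. h z * of_real (\<phi> k (f (T z)))) = 0" for k by (rule zero[OF tf])
    ultimately show ?thesis by (simp add: set_lebesgue_integral_def LIMSEQ_const_iff)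
  qed
  \<comment> \<open>Complements in the induction need the integral over the whole space. The whole
    space need not be the support of a test function, but it is exhausted by the balls of integer
    radius, which are.\<close>
  have whole: "(LINT z|M. h z) = 0"
  proof -
    have "(\<lambda>m. LINT z|M. indicator (T -` ball 0 (real m) \<inter> space M) z *\<^sub>R h z) \<longlonglongrightarrow> (LINT z|M. h z)"
    proof (rule integral_dominated_convergence)
      show "integrable M (\<lambda>z. cmod (h z))" using h by (rule integrable_norm)
      show "(\<lambda>z. indicator (T -` ball 0 (real m) \<inter> space M) z *\<^sub>R h z) \<in> borel_measurable M" for m
        using setM[of "ball 0 (real m)"] by measurable auto
      show "AE z in M. norm (indicator (T -` ball 0 (real m) \<inter> space M) z *\<^sub>R h z) \<le> cmod (h z)" for m
        by (intro always_eventually allI) (auto simp: indicator_def)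
      show "AE z in M. (\<lambda>m. indicator (T -` ball 0 (real m) \<inter> space M) z *\<^sub>R h z) \<longlonglongrightarrow> h z"
      proof (rule AE_I2)
        fix z assume z: "z \<in> space M"
        obtain m0 :: nat where "norm (T z) < real m0" using reals_Archimedean2 by blast
        then have "\<forall>\<^sub>F m in sequentially. indicator (T -` ball 0 (real m) \<inter> space M) z *\<^sub>R h z = h z"
          using z by (intro eventually_sequentiallyI[of m0]) (auto simp: indicator_def)
        then show "(\<lambda>m. indicator (T -` ball 0 (real m) \<inter> space M) z *\<^sub>R h z) \<longlonglongrightarrow> h z"
          by (rule tendsto_eventually)
      qed
    qed (use h in simp)
    moreover have "(LINT z|M. indicator (T -` ball 0 (real m) \<inter> space M) z *\<^sub>R h z) = 0" for m
    proof -
      obtain f f' where "test_function f f'" "{x. f x \<noteq> 0} = ball (0 :: (real^3)^'n) (real m)"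
        using ball_test_function[of 0 "real m"] by (elim exE conjE)
      then have "ball 0 (real m) \<in> ?E" by (intro CollectI exI conjI) (rule sym)
      from basic[OF this] show ?thesis by (simp add: set_lebesgue_integral_def)
    qed
    ultimately show ?thesis by (simp add: LIMSEQ_const_iff)
  qed
  have "Int_stable ?E"
  proof (rule Int_stableI)
    fix A B assume "A \<in> ?E" "B \<in> ?E"
    then obtain f f' g g' where fg: "test_function f f'" "test_function g g'" and "A = {x. f x \<noteq> 0}" "B = {x. g x \<noteq> 0}" by auto
    then have "A \<inter> B = {x. f x * g x \<noteq> 0}" by auto
    then show "A \<inter> B \<in> ?E" using test_function_mult[OF fg] by (intro CollectI exI conjI)
  qed
  moreover have "?E \<subseteq> Pow UNIV" by simp
  moreover have "B \<in> sigma_sets UNIV ?E" using B Edef by simp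
  ultimately show ?thesis
  proof (induction rule: sigma_sets_induct_disjoint)
    case (basic A)
    then show ?case by (rule \<open>\<And>A. A \<in> ?E \<Longrightarrow> (LINT z:(T -` A \<inter> space M)|M. h z) = 0\<close>)
  next
    case empty
    then show ?case by (simp add: set_lebesgue_integral_def)
  next
    case (compl A)
    then have A: "T -` A \<inter> space M \<in> sets M" using Edef setM by blast
    have "(LINT z:(T -` (UNIV - A) \<inter> space M)|M. h z) = (LINT z|M. h z - indicator (T -` A \<inter> space M) z *\<^sub>R h z)"
      unfolding set_lebesgue_integral_def by (intro Bochner_Integration.integral_cong) (auto simp: indicator_def)
    also have "\<dots> = (LINT z|M. h z) - (LINT z:(T -` A \<inter> space M)|M. h z)"
      unfolding set_lebesgue_integral_def
      by (intro Bochner_Integration.integral_diff h integrable_mult_indicator A)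
    finally show ?case using whole compl by simp
  next
    case (union A)
    let ?A = "\<lambda>i. T -` A i \<inter> space M"
    have A: "?A i \<in> sets M" for i using union Edef setM by blast
    have UA: "(\<Union>i. ?A i) \<in> sets M" by (rule sets.countable_nat_UN) (use A in blast)
    have eq1: "T -` (\<Union>i. A i) \<inter> space M = (\<Union>i. ?A i)" by blast
    have eq2: "(LINT z:(\<Union>i. ?A i)|M. h z) = (\<Sum>i. (LINT z:?A i|M. h z))"
    proof (rule lebesgue_integral_countable_add[OF A])
      show "?A i \<inter> ?A j = {}" if "i \<noteq> j" for i j
        using union(1) that by (auto simp: disjoint_family_on_def)
      show "set_integrable M (\<Union>i. ?A i) h"
        unfolding set_integrable_def by (rule integrable_mult_indicator[OF UA h])
    qed
    show ?case unfolding eq1 eq2 union(3) by (rule suminf_zero)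
  qed
qed

text \<open>\<open>h\<close> itself need not be integrable. Each \<open>h * f\<close> is, and
  further test functions may be absorbed into \<open>f\<close>, so \<open>h * f\<close> vanishes
  almost everywhere; countably many supports then exhaust the space.\<close>

lemma AE_zero_test_functions:
  fixes h :: "(real^3)^'n::finite \<Rightarrow> complex"
  assumes h: "h \<in> borel_measurable borel" and int: "\<And>f f'. test_function f f' \<Longrightarrow> integrable lborel (\<lambda>x. h x * of_real (f x))"
    and zero: "\<And>f f'. test_function f f' \<Longrightarrow> (LINT x|lborel. h x * of_real (f x)) = 0"
  shows "AE x in lborel. h x = 0"
proof -
  have *: "AE x in lborel. h x * of_real (f x) = 0" if f: "test_function f f'" for f f'
  proof (rule sigma_finite_measure.density_zero[OF lborel.sigma_finite_measure_axioms int[OF f]])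
    fix A assume A: "A \<in> sets (lborel :: ((real^3)^'n) measure)"
    have "(LINT x:((\<lambda>x. x) -` A \<inter> space lborel)|lborel. h x * of_real (f x)) = 0"
    proof (rule set_integral_test_functions_zero[where T = "\<lambda>x. x" and M = lborel and h = "\<lambda>x. h x * of_real (f x)" and B = A])
      show "integrable lborel (\<lambda>x. h x * of_real (f x))" by (rule int[OF f])
    next
      fix g :: "(real^3)^'n \<Rightarrow> real" and g' assume g: "test_function g g'"
      have "(LINT x|lborel. h x * of_real (f x) * of_real (g x)) = (LINT x|lborel. h x * of_real (f x * g x))"
        by (simp add: mult.assoc)
      then show "(LINT x|lborel. h x * of_real (f x) * of_real (g x)) = 0"
        using zero[OF test_function_mult[OF f g]] by (simp only:)
    next
      show "(\<lambda>x. x) \<in> borel_measurable lborel" by simp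
      show "A \<in> sets borel" using A by simp
    qed
    then show "(LINT x:A|lborel. h x * of_real (f x)) = 0" by simp
  qed
  have "\<forall>m::nat. \<exists>f f'. test_function f f' \<and> {x. f x \<noteq> 0} = ball (0::(real^3)^'n) (real m)"
    by (intro allI ball_test_function)
  then obtain F F' where F: "\<And>m::nat. test_function (F m) (F' m)" "\<And>m. {x. F m x \<noteq> 0} = ball (0::(real^3)^'n) (real m)" by metis
  have "AE x in lborel. \<forall>m. h x * of_real (F m x) = 0" unfolding AE_all_countable by (intro allI *[OF F(1)])
  then show ?thesis
  proof eventually_elim
    fix x assume x: "\<forall>m. h x * of_real (F m x) = 0"
    obtain m :: nat where "norm x < real m" using reals_Archimedean2 by blast
    then have "x \<in> {x. F m x \<noteq> 0}" unfolding F(2) by simp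
    then have "F m x \<noteq> 0" by simp
    moreover have "h x * of_real (F m x) = 0" using x by (rule spec)
    ultimately show "h x = 0" by simp
  qed
qed

subsection \<open>Momentum and the kinetic form\<close>

lemma has_momentum_sq_int: "has_momentum i a \<psi> \<eta> \<Longrightarrow> \<eta> \<in> sq_int"
  by (simp add: has_momentum_def)

lemma has_momentumD:
  "has_momentum i a \<psi> \<eta> \<Longrightarrow> test_function f f' \<Longrightarrow> (LINT x|lborel. \<eta> (x, s) * of_real (f x)) =
     \<i> * (LINT x|lborel. \<psi> (x, s) * of_real (blinfun_apply (f' x) (axis i (axis a 1))))"
  unfolding has_momentum_def by blast

text \<open>\<open>momentum\<close> makes a choice for every function, not for every class modulo
  null sets. Allowing \<psi>1 and \<psi>2 to differ on a null set is what makes the kinetic form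
  vanish on null functions.\<close>

lemma has_momentum_unique:
  fixes \<psi>1 :: "'n::finite wf"
  assumes m: "has_momentum i a \<psi>1 \<eta>1" "has_momentum i a \<psi>2 \<eta>2"
    and eq: "wf_eq \<psi>1 \<psi>2" and sq: "\<psi>1 \<in> sq_int" "\<psi>2 \<in> sq_int"
  shows "wf_eq \<eta>1 \<eta>2"
proof -
  note eta = m[THEN has_momentum_sq_int]
  note [measurable] = eta[THEN sq_int_measurable] sq[THEN sq_int_measurable]
  have "AE x in lborel. \<eta>1 (x, s) = \<eta>2 (x, s)" for s
  proof -
    have "AE x in lborel. \<eta>1 (x, s) - \<eta>2 (x, s) = 0"
    proof (rule AE_zero_test_functions)
      show "(\<lambda>x. \<eta>1 (x, s) - \<eta>2 (x, s)) \<in> borel_measurable borel"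
        by (intro borel_measurable_diff slice_measurable sq_int_measurable eta)
      fix f :: "(real^3)^'n \<Rightarrow> real" and f' assume f: "test_function f f'"
      let ?d = "\<lambda>x. blinfun_apply (f' x) (axis i (axis a 1))"
      note int1 = test_function_integrable_product(1)[OF f eta(1), of s]
        and int2 = test_function_integrable_product(1)[OF f eta(2), of s]
      have split: "(\<lambda>x. (\<eta>1 (x, s) - \<eta>2 (x, s)) * of_real (f x))
          = (\<lambda>x. \<eta>1 (x, s) * of_real (f x) - \<eta>2 (x, s) * of_real (f x))"
        by (simp add: algebra_simps)
      show "integrable lborel (\<lambda>x. (\<eta>1 (x, s) - \<eta>2 (x, s)) * of_real (f x))"
        unfolding split by (rule Bochner_Integration.integrable_diff[OF int1 int2])
      have "(LINT x|lborel. \<psi>1 (x, s) * of_real (?d x)) = (LINT x|lborel. \<psi>2 (x, s) * of_real (?d x))"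
      proof (rule integral_cong_AE)
        show "(\<lambda>x. \<psi>1 (x, s) * of_real (?d x)) \<in> borel_measurable lborel"
          by (rule borel_measurable_integrable[OF test_function_integrable_product(2)[OF f sq(1)]])
        show "(\<lambda>x. \<psi>2 (x, s) * of_real (?d x)) \<in> borel_measurable lborel"
          by (rule borel_measurable_integrable[OF test_function_integrable_product(2)[OF f sq(2)]])
        show "AE x in lborel. \<psi>1 (x, s) * of_real (?d x) = \<psi>2 (x, s) * of_real (?d x)"
          using AE_conf_slice[OF eq[unfolded wf_eq_def], of s] by eventually_elim simp
      qed
      then show "(LINT x|lborel. (\<eta>1 (x, s) - \<eta>2 (x, s)) * of_real (f x)) = 0"
        unfolding split Bochner_Integration.integral_diff[OF int1 int2]
          has_momentumD[OF m(1) f] has_momentumD[OF m(2) f] by simp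
    qed
    then show ?thesis by eventually_elim simp
  qed
  then show ?thesis
    unfolding wf_eq_def by (intro AE_confI) measurable
qed

lemma has_momentum_lin:
  fixes \<phi> :: "'n::finite wf"
  assumes m: "has_momentum i a \<phi> \<eta>" "has_momentum i a \<psi> \<theta>" and sq: "\<phi> \<in> sq_int" "\<psi> \<in> sq_int"
  shows "has_momentum i a (\<lambda>z. c * \<phi> z + \<psi> z) (\<lambda>z. c * \<eta> z + \<theta> z)"
  unfolding has_momentum_def
proof (intro conjI allI impI)
  note eta = m[THEN has_momentum_sq_int]
  show "(\<lambda>z. c * \<eta> z + \<theta> z) \<in> sq_int" by (rule sq_int_lin[OF eta])
  fix f :: "(real^3)^'n \<Rightarrow> real" and f' s assume f: "test_function f f'"
  have lin: "(LINT x|lborel. (c * \<alpha> (x, s) + \<gamma> (x, s)) * of_real (g x)) =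
      c * (LINT x|lborel. \<alpha> (x, s) * of_real (g x)) + (LINT x|lborel. \<gamma> (x, s) * of_real (g x))"
    if "integrable lborel (\<lambda>x. \<alpha> (x, s) * of_real (g x))" "integrable lborel (\<lambda>x. \<gamma> (x, s) * of_real (g x))"
    for \<alpha> \<gamma> :: "'n wf" and g :: "(real^3)^'n \<Rightarrow> real"
  proof -
    have "(\<lambda>x. (c * \<alpha> (x, s) + \<gamma> (x, s)) * of_real (g x)) = (\<lambda>x. c * (\<alpha> (x, s) * of_real (g x)) + \<gamma> (x, s) * of_real (g x))"
      by (simp add: algebra_simps)
    then show ?thesis
      using Bochner_Integration.integral_add[OF integrable_mult_right[OF that(1), of c] that(2)] by simp
  qed
  show "(LINT x|lborel. (c * \<eta> (x, s) + \<theta> (x, s)) * of_real (f x)) =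
     \<i> * (LINT x|lborel. (c * \<phi> (x, s) + \<psi> (x, s)) * of_real (blinfun_apply (f' x) (axis i (axis a 1))))"
    unfolding lin[OF test_function_integrable_product(1)[OF f eta(1)] test_function_integrable_product(1)[OF f eta(2)]]
      lin[OF test_function_integrable_product(2)[OF f sq(1)] test_function_integrable_product(2)[OF f sq(2)]]
      has_momentumD[OF m(1) f] has_momentumD[OF m(2) f]
    by (simp add: algebra_simps)
qed

lemma has_momentum_zero: "has_momentum i a (\<lambda>z. 0) (\<lambda>z. 0)"
  by (simp add: has_momentum_def sq_int_zero)

lemma kinetic_dom_hilb: "\<psi> \<in> kinetic_dom \<Longrightarrow> \<psi> \<in> hilb"
  by (simp add: kinetic_dom_def)

lemma momentum_works:
  assumes "\<psi> \<in> kinetic_dom" shows "has_momentum i a \<psi> (momentum i a \<psi>)"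
proof -
  have "\<exists>\<eta>. has_momentum i a \<psi> \<eta>" using assms unfolding kinetic_dom_def by simp
  then show ?thesis unfolding momentum_def by (rule someI_ex)
qed

lemmas momentum_sq_int = has_momentum_sq_int[OF momentum_works]

lemma kinetic_dom_lin:
  assumes "\<phi> \<in> kinetic_dom" "\<psi> \<in> kinetic_dom" shows "(\<lambda>z. c * \<phi> z + \<psi> z) \<in> kinetic_dom"
proof -
  have "\<exists>\<eta>. has_momentum i a (\<lambda>z. c * \<phi> z + \<psi> z) \<eta>" for i a
    by (rule exI, rule has_momentum_lin[OF momentum_works[OF assms(1)] momentum_works[OF assms(2)]
        assms[THEN kinetic_dom_hilb, THEN hilb_sq_int]])
  then show ?thesis
    using hilb_lin[OF assms[THEN kinetic_dom_hilb]] unfolding kinetic_dom_def by simp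
qed

lemma momentum_eqI:
  assumes "has_momentum i a \<psi> \<eta>" "\<psi> \<in> kinetic_dom"
  shows "wf_eq (momentum i a \<psi>) \<eta>"
  using assms(2) by (intro has_momentum_unique[OF momentum_works assms(1)] wf_eq_refl hilb_sq_int kinetic_dom_hilb)

lemma momentum_lin:
  assumes "\<phi> \<in> kinetic_dom" "\<psi> \<in> kinetic_dom"
  shows "wf_eq (momentum i a (\<lambda>z. c * \<phi> z + \<psi> z)) (\<lambda>z. c * momentum i a \<phi> z + momentum i a \<psi> z)"
  by (rule momentum_eqI[OF has_momentum_lin[OF momentum_works[OF assms(1)] momentum_works[OF assms(2)]
        assms[THEN kinetic_dom_hilb, THEN hilb_sq_int]] kinetic_dom_lin[OF assms]])

lemma momentum_null:
  assumes "\<psi> \<in> kinetic_dom" "wf_eq \<psi> (\<lambda>z. 0)"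
  shows "wf_eq (momentum i a \<psi>) (\<lambda>z. 0)"
  by (rule has_momentum_unique[OF momentum_works[OF assms(1)] has_momentum_zero assms(2)
        hilb_sq_int[OF kinetic_dom_hilb[OF assms(1)]] sq_int_zero])

lemma kinetic_form_lin:
  assumes "\<zeta> \<in> kinetic_dom" "\<phi> \<in> kinetic_dom" "\<psi> \<in> kinetic_dom"
  shows "kinetic_form \<zeta> (\<lambda>z. c * \<phi> z + \<psi> z) = c * kinetic_form \<zeta> \<phi> + kinetic_form \<zeta> \<psi>"
proof -
  have "ip (momentum i a \<zeta>) (momentum i a (\<lambda>z. c * \<phi> z + \<psi> z)) =
      c * ip (momentum i a \<zeta>) (momentum i a \<phi>) + ip (momentum i a \<zeta>) (momentum i a \<psi>)" for i a
    by (rule trans[OF ip_cong[OF momentum_lin[OF assms(2,3)] momentum_sq_int[OF assms(1)]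
        momentum_sq_int[OF kinetic_dom_lin[OF assms(2,3)]]
        sq_int_lin[OF momentum_sq_int[OF assms(2)] momentum_sq_int[OF assms(3)]]]
      ip_lin[OF momentum_sq_int[OF assms(1)] momentum_sq_int[OF assms(2)] momentum_sq_int[OF assms(3)]]])
  then show ?thesis
    by (simp add: kinetic_form_def sum.distrib sum_distrib_left)
qed

lemma kinetic_form_cnj: "cnj (kinetic_form \<phi> \<psi>) = kinetic_form \<psi> \<phi>"
  by (simp add: kinetic_form_def ip_cnj)

lemma kinetic_form_null:
  assumes "\<phi> \<in> kinetic_dom" "\<psi> \<in> kinetic_dom" "wf_eq \<psi> (\<lambda>z. 0)"
  shows "kinetic_form \<phi> \<psi> = 0"
proof -
  have "ip (momentum i a \<phi>) (momentum i a \<psi>) = 0" for i a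
    using ip_cong[OF momentum_null[OF assms(2,3), of i a] momentum_sq_int[OF assms(1)] momentum_sq_int[OF assms(2)] sq_int_zero, of i a]
    by simp
  then show ?thesis by (simp add: kinetic_form_def)
qed

subsection \<open>Multiplication operators\<close>

lemma vec_nth_measurable: "(\<lambda>x::(real^3)^'n::finite. x $ i) \<in> borel_measurable borel"
  by (intro borel_measurable_continuous_onI continuous_intros)

lemma coulomb_measurable: "coulomb \<in> borel_measurable borel"
proof -
  note [measurable] = vec_nth_measurable
  show ?thesis unfolding coulomb_def[abs_def] by measurable
qed

lemma one_body_measurable:
  assumes [measurable]: "g \<in> borel_measurable borel" shows "one_body g \<in> borel_measurable borel"
proof -
  note [measurable] = vec_nth_measurable
  show ?thesis unfolding one_body_def[abs_def] by measurable
qed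

lemma mult_dom_hilb: "\<psi> \<in> mult_dom w \<Longrightarrow> \<psi> \<in> hilb"
  by (simp add: mult_dom_def)

lemma mult_measurable:
  assumes "w \<in> borel_measurable borel" "\<psi> \<in> sq_int" shows "mult w \<psi> \<in> borel_measurable conf"
proof -
  note [measurable] = fst_conf_measurable[OF assms(1)] sq_int_measurable[OF assms(2)]
  show ?thesis unfolding mult_def by measurable
qed

text \<open>\<open>mult w \<psi>\<close> need not be square integrable, so
  \<open>ip_integrable\<close> does not apply. Membership in \<open>mult_dom\<close> gives square
  integrability with the weight |w|, and the weight is shared between the two factors.\<close>

lemma mult_dom_integrable:
  assumes w: "w \<in> borel_measurable borel" and "\<phi> \<in> mult_dom w" "\<psi> \<in> mult_dom w"
  shows "integrable conf (\<lambda>z. cnj (\<phi> z) * mult w \<psi> z)"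
proof (rule Bochner_Integration.integrable_bound)
  show "integrable conf (\<lambda>z. \<bar>w (fst z)\<bar> * (cmod (\<phi> z))\<^sup>2 + \<bar>w (fst z)\<bar> * (cmod (\<psi> z))\<^sup>2)"
    using assms(2,3) unfolding mult_dom_def by (intro Bochner_Integration.integrable_add) auto
  note [measurable] = mult_measurable[OF w hilb_sq_int[OF mult_dom_hilb[OF assms(3)]]]
    sq_int_measurable[OF hilb_sq_int[OF mult_dom_hilb[OF assms(2)]]]
  show "(\<lambda>z. cnj (\<phi> z) * mult w \<psi> z) \<in> borel_measurable conf" by measurable
  have bnd: "norm (cnj (\<phi> z) * mult w \<psi> z) \<le> \<bar>w (fst z)\<bar> * (cmod (\<phi> z))\<^sup>2 + \<bar>w (fst z)\<bar> * (cmod (\<psi> z))\<^sup>2" for z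
  proof -
    have "norm (cnj (\<phi> z) * mult w \<psi> z) = \<bar>w (fst z)\<bar> * (cmod (\<phi> z) * cmod (\<psi> z))"
      by (simp add: mult_def norm_mult)
    also have "\<dots> \<le> \<bar>w (fst z)\<bar> * ((cmod (\<phi> z))\<^sup>2 + (cmod (\<psi> z))\<^sup>2)"
      using norm_mult_le_sum_squares[of "cmod (\<phi> z)" "cmod (\<psi> z)"] by (intro mult_left_mono) auto
    finally show ?thesis by (simp add: distrib_left)
  qed
  show "AE z in conf. norm (cnj (\<phi> z) * mult w \<psi> z) \<le> norm (\<bar>w (fst z)\<bar> * (cmod (\<phi> z))\<^sup>2 + \<bar>w (fst z)\<bar> * (cmod (\<psi> z))\<^sup>2)"
    by (intro always_eventually allI order_trans[OF bnd]) (simp only: real_norm_def abs_ge_self)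
qed

lemma mult_dom_lin:
  assumes w: "w \<in> borel_measurable borel" and phi: "\<phi> \<in> mult_dom w" and psi: "\<psi> \<in> mult_dom w"
  shows "(\<lambda>z. c * \<phi> z + \<psi> z) \<in> mult_dom w"
proof -
  have h: "(\<lambda>z. c * \<phi> z + \<psi> z) \<in> hilb"
    by (rule hilb_lin[OF phi[THEN mult_dom_hilb] psi[THEN mult_dom_hilb]])
  have "integrable conf (\<lambda>z. \<bar>w (fst z)\<bar> * (cmod (c * \<phi> z + \<psi> z))\<^sup>2)"
  proof (rule Bochner_Integration.integrable_bound)
    show "integrable conf (\<lambda>z. 2 * (cmod c)\<^sup>2 * (\<bar>w (fst z)\<bar> * (cmod (\<phi> z))\<^sup>2) + 2 * (\<bar>w (fst z)\<bar> * (cmod (\<psi> z))\<^sup>2))"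
      using phi psi unfolding mult_dom_def
      by (intro Bochner_Integration.integrable_add integrable_mult_right) auto
    note [measurable] = sq_int_measurable[OF hilb_sq_int[OF h]] fst_conf_measurable[OF w]
    show "(\<lambda>z. \<bar>w (fst z)\<bar> * (cmod (c * \<phi> z + \<psi> z))\<^sup>2) \<in> borel_measurable conf" by measurable
    have "\<bar>w (fst z)\<bar> * (cmod (c * \<phi> z + \<psi> z))\<^sup>2
        \<le> 2 * (cmod c)\<^sup>2 * (\<bar>w (fst z)\<bar> * (cmod (\<phi> z))\<^sup>2) + 2 * (\<bar>w (fst z)\<bar> * (cmod (\<psi> z))\<^sup>2)" for z
    proof -
      have "(cmod (c * \<phi> z + \<psi> z))\<^sup>2 \<le> (cmod (c * \<phi> z) + cmod (\<psi> z))\<^sup>2"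
        by (intro power_mono norm_triangle_ineq) auto
      also have "\<dots> \<le> 2 * (cmod c)\<^sup>2 * (cmod (\<phi> z))\<^sup>2 + 2 * (cmod (\<psi> z))\<^sup>2"
        using sum_squares_bound[of "cmod (c * \<phi> z)" "cmod (\<psi> z)"]
        by (simp add: power2_sum norm_mult power_mult_distrib)
      finally have "\<bar>w (fst z)\<bar> * (cmod (c * \<phi> z + \<psi> z))\<^sup>2 \<le> \<bar>w (fst z)\<bar> * (2 * (cmod c)\<^sup>2 * (cmod (\<phi> z))\<^sup>2 + 2 * (cmod (\<psi> z))\<^sup>2)"
        by (rule mult_left_mono) simp
      then show ?thesis by (simp add: algebra_simps)
    qed
    then show "AE z in conf. norm (\<bar>w (fst z)\<bar> * (cmod (c * \<phi> z + \<psi> z))\<^sup>2)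
        \<le> norm (2 * (cmod c)\<^sup>2 * (\<bar>w (fst z)\<bar> * (cmod (\<phi> z))\<^sup>2) + 2 * (\<bar>w (fst z)\<bar> * (cmod (\<psi> z))\<^sup>2))"
      by (intro always_eventually allI) (simp add: abs_mult)
  qed
  with h show ?thesis by (simp add: mult_dom_def)
qed

lemma mult_form_lin:
  assumes w: "w \<in> borel_measurable borel" and "\<zeta> \<in> mult_dom w" "\<phi> \<in> mult_dom w" "\<psi> \<in> mult_dom w"
  shows "ip \<zeta> (mult w (\<lambda>z. c * \<phi> z + \<psi> z)) = c * ip \<zeta> (mult w \<phi>) + ip \<zeta> (mult w \<psi>)"
proof -
  have "(\<lambda>z. cnj (\<zeta> z) * mult w (\<lambda>z. c * \<phi> z + \<psi> z) z) = (\<lambda>z. c * (cnj (\<zeta> z) * mult w \<phi> z) + cnj (\<zeta> z) * mult w \<psi> z)"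
    by (simp add: mult_def algebra_simps)
  then show ?thesis
    unfolding ip_def
    using Bochner_Integration.integral_add[OF integrable_mult_right[OF mult_dom_integrable[OF w assms(2,3)], of c] mult_dom_integrable[OF w assms(2,4)]]
    by simp
qed

lemma mult_form_cnj: "cnj (ip \<phi> (mult w \<psi>)) = ip \<psi> (mult w \<phi>)"
proof -
  have "cnj (ip \<phi> (mult w \<psi>)) = (LINT z|conf. cnj (cnj (\<phi> z) * mult w \<psi> z))"
    unfolding ip_def by (rule Bochner_Integration.integral_cnj[symmetric])
  then show ?thesis by (simp add: ip_def mult_def mult_ac)
qed

lemma mult_form_null:
  assumes "wf_eq \<psi> (\<lambda>z. 0)" shows "ip \<phi> (mult w \<psi>) = 0"
  unfolding ip_def
proof (rule integral_eq_zero_AE)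
  show "AE z in conf. cnj (\<phi> z) * mult w \<psi> z = 0"
    using assms unfolding wf_eq_def by eventually_elim (simp add: mult_def)
qed

subsection \<open>Hermitian forms\<close>

text \<open>Vectors are functions here, so the last clause is what allows a form to be transferred
  between almost everywhere equal representatives.\<close>

definition hermitian_form :: "'n::finite wf set \<Rightarrow> ('n wf \<Rightarrow> 'n wf \<Rightarrow> complex) \<Rightarrow> bool" where
  "hermitian_form Q q \<longleftrightarrow> Q \<subseteq> hilb \<and> (\<lambda>z. 0) \<in> Q \<and>
     (\<forall>a. \<forall>\<phi>\<in>Q. \<forall>\<psi>\<in>Q. (\<lambda>z. a * \<phi> z + \<psi> z) \<in> Q) \<and>
     (\<forall>a. \<forall>\<zeta>\<in>Q. \<forall>\<phi>\<in>Q. \<forall>\<psi>\<in>Q. q \<zeta> (\<lambda>z. a * \<phi> z + \<psi> z) = a * q \<zeta> \<phi> + q \<zeta> \<psi>) \<and>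
     (\<forall>\<phi>\<in>Q. \<forall>\<psi>\<in>Q. cnj (q \<phi> \<psi>) = q \<psi> \<phi>) \<and>
     (\<forall>\<phi>\<in>Q. \<forall>\<psi>\<in>Q. wf_eq \<psi> (\<lambda>z. 0) \<longrightarrow> q \<phi> \<psi> = 0)"

text \<open>Together with \<open>trial_form\<close> this names the form that occurs in
  \<open>trial\<close>. The multiplier 0 recovers the canonical case, so that one theory of Gibbs
  states serves both.\<close>

definition trial_dom :: "(real^3 \<Rightarrow> real) \<Rightarrow> (real^3 \<Rightarrow> real) \<Rightarrow> 'n::finite wf set" where
  "trial_dom v \<alpha> = ham_dom v \<inter> mult_dom (one_body \<alpha>)"

definition trial_form :: "(real^3 \<Rightarrow> real) \<Rightarrow> real \<Rightarrow> (real^3 \<Rightarrow> real) \<Rightarrow> 'n::finite wf \<Rightarrow> 'n wf \<Rightarrow> complex" where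
  "trial_form v \<beta> \<alpha> \<phi> \<psi> = of_real \<beta> * ham_form v \<phi> \<psi> + ip \<phi> (mult (one_body \<alpha>) \<psi>)"

lemma ham_domD:
  assumes "\<psi> \<in> ham_dom v"
  shows "\<psi> \<in> kinetic_dom" "\<psi> \<in> mult_dom coulomb" "\<psi> \<in> mult_dom (one_body v)"
  using assms by (simp_all add: ham_dom_def)

lemma ham_dom_lin:
  assumes v: "v \<in> borel_measurable borel" and "\<phi> \<in> ham_dom v" "\<psi> \<in> ham_dom v"
  shows "(\<lambda>z. c * \<phi> z + \<psi> z) \<in> ham_dom v"
  unfolding ham_dom_def
  by (intro IntI kinetic_dom_lin mult_dom_lin coulomb_measurable one_body_measurable v
      ham_domD[OF assms(2)] ham_domD[OF assms(3)])

lemma ham_form_lin: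
  assumes v: "v \<in> borel_measurable borel" and "\<zeta> \<in> ham_dom v" "\<phi> \<in> ham_dom v" "\<psi> \<in> ham_dom v"
  shows "ham_form v \<zeta> (\<lambda>z. c * \<phi> z + \<psi> z) = c * ham_form v \<zeta> \<phi> + ham_form v \<zeta> \<psi>"
  unfolding ham_form_def
    kinetic_form_lin[OF ham_domD(1)[OF assms(2)] ham_domD(1)[OF assms(3)] ham_domD(1)[OF assms(4)]]
    mult_form_lin[OF coulomb_measurable ham_domD(2)[OF assms(2)] ham_domD(2)[OF assms(3)] ham_domD(2)[OF assms(4)]]
    mult_form_lin[OF one_body_measurable[OF v] ham_domD(3)[OF assms(2)] ham_domD(3)[OF assms(3)] ham_domD(3)[OF assms(4)]]
  by (simp add: algebra_simps)

lemma ham_form_cnj: "cnj (ham_form v \<phi> \<psi>) = ham_form v \<psi> \<phi>"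
  by (simp add: ham_form_def kinetic_form_cnj mult_form_cnj)

lemma zero_in_ham_dom: "(\<lambda>z. 0) \<in> ham_dom v"
proof -
  have "(\<lambda>z. 0) \<in> kinetic_dom"
    unfolding kinetic_dom_def using hilb_zero has_momentum_zero by fast
  then show ?thesis by (simp add: ham_dom_def mult_dom_def hilb_zero)
qed

lemma hermitian_trial_form:
  assumes v: "v \<in> borel_measurable borel" and a: "\<alpha> \<in> borel_measurable borel"
  shows "hermitian_form (trial_dom v \<alpha>) (trial_form v \<beta> \<alpha>)"
  unfolding hermitian_form_def
proof (intro conjI ballI allI impI)
  show "trial_dom v \<alpha> \<subseteq> hilb" by (auto simp: trial_dom_def mult_dom_def)
  show "(\<lambda>z. 0) \<in> trial_dom v \<alpha>"
    by (simp add: trial_dom_def zero_in_ham_dom) (simp add: mult_dom_def hilb_zero)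
  fix \<phi> \<psi> :: "'a wf" assume "\<phi> \<in> trial_dom v \<alpha>" "\<psi> \<in> trial_dom v \<alpha>"
  then have D: "\<phi> \<in> ham_dom v" "\<phi> \<in> mult_dom (one_body \<alpha>)" "\<psi> \<in> ham_dom v" "\<psi> \<in> mult_dom (one_body \<alpha>)"
    by (simp_all add: trial_dom_def)
  show "(\<lambda>z. c * \<phi> z + \<psi> z) \<in> trial_dom v \<alpha>" for c
    unfolding trial_dom_def by (rule IntI[OF ham_dom_lin[OF v D(1,3)] mult_dom_lin[OF one_body_measurable[OF a] D(2,4)]])
  show "trial_form v \<beta> \<alpha> \<zeta> (\<lambda>z. c * \<phi> z + \<psi> z) = c * trial_form v \<beta> \<alpha> \<zeta> \<phi> + trial_form v \<beta> \<alpha> \<zeta> \<psi>"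
    if "\<zeta> \<in> trial_dom v \<alpha>" for c \<zeta>
  proof -
    have "\<zeta> \<in> ham_dom v" "\<zeta> \<in> mult_dom (one_body \<alpha>)" using that by (simp_all add: trial_dom_def)
    then show ?thesis
      unfolding trial_form_def
      using ham_form_lin[OF v _ D(1,3)] mult_form_lin[OF one_body_measurable[OF a] _ D(2,4)]
      by (simp add: algebra_simps)
  qed
  show "cnj (trial_form v \<beta> \<alpha> \<phi> \<psi>) = trial_form v \<beta> \<alpha> \<psi> \<phi>"
    by (simp add: trial_form_def ham_form_cnj mult_form_cnj)
  assume z: "wf_eq \<psi> (\<lambda>z. 0)"
  show "trial_form v \<beta> \<alpha> \<phi> \<psi> = 0"
    using kinetic_form_null[OF ham_domD(1)[OF D(1)] ham_domD(1)[OF D(3)] z]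
    by (simp add: trial_form_def ham_form_def mult_form_null[OF z])
qed

lemma hermitian_formD:
  assumes "hermitian_form Q q"
  shows form_hilb: "\<psi> \<in> Q \<Longrightarrow> \<psi> \<in> hilb"
    and form_zero: "(\<lambda>z. 0) \<in> Q"
    and form_dom_lin: "\<phi> \<in> Q \<Longrightarrow> \<psi> \<in> Q \<Longrightarrow> (\<lambda>z. a * \<phi> z + \<psi> z) \<in> Q"
    and form_lin: "\<zeta> \<in> Q \<Longrightarrow> \<phi> \<in> Q \<Longrightarrow> \<psi> \<in> Q \<Longrightarrow> q \<zeta> (\<lambda>z. a * \<phi> z + \<psi> z) = a * q \<zeta> \<phi> + q \<zeta> \<psi>"
    and form_cnj: "\<phi> \<in> Q \<Longrightarrow> \<psi> \<in> Q \<Longrightarrow> cnj (q \<phi> \<psi>) = q \<psi> \<phi>"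
    and form_null: "\<phi> \<in> Q \<Longrightarrow> \<psi> \<in> Q \<Longrightarrow> wf_eq \<psi> (\<lambda>z. 0) \<Longrightarrow> q \<phi> \<psi> = 0"
  using assms unfolding hermitian_form_def by (blast+)

lemma form_zero_right:
  assumes "hermitian_form Q q" "\<phi> \<in> Q" shows "q \<phi> (\<lambda>z. 0) = 0"
  by (rule form_null[OF assms form_zero[OF assms(1)] wf_eq_refl])

lemma form_dom_sum:
  assumes f: "hermitian_form Q q" and "finite J" "\<And>k. k \<in> J \<Longrightarrow> b k \<in> Q"
  shows "(\<lambda>z. \<Sum>k\<in>J. c k * b k z) \<in> Q"
  using assms(2,3)
proof (induction J rule: finite_induct)
  case empty
  then show ?case using form_zero[OF f] by simp
next
  case (insert j J)
  then show ?case using form_dom_lin[OF f, of "b j" "\<lambda>z. \<Sum>k\<in>J. c k * b k z" "c j"] by simp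
qed

lemma form_sum:
  assumes f: "hermitian_form Q q" and phi: "\<phi> \<in> Q" and "finite J" "\<And>k. k \<in> J \<Longrightarrow> b k \<in> Q"
  shows "q \<phi> (\<lambda>z. \<Sum>k\<in>J. c k * b k z) = (\<Sum>k\<in>J. c k * q \<phi> (b k))"
  using assms(3,4)
proof (induction J rule: finite_induct)
  case empty
  then show ?case using form_zero_right[OF f phi] by simp
next
  case (insert j J)
  have "(\<lambda>z. \<Sum>k\<in>J. c k * b k z) \<in> Q" using insert by (intro form_dom_sum[OF f]) auto
  then show ?case using insert form_lin[OF f phi, of "b j" "\<lambda>z. \<Sum>k\<in>J. c k * b k z" "c j"] by simp
qed

section \<open>Eigenvector expansions of Hermitian forms\<close>

lemma form_opD:
  assumes "eigensystem (form_op Q q) b \<mu>"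
  shows form_op_onb: "onb b" and form_op_dom: "b k \<in> Q"
    and form_op_eigen: "\<phi> \<in> Q \<Longrightarrow> q \<phi> (b k) = of_real (\<mu> k) * ip \<phi> (b k)"
  using assms by (auto simp: eigensystem_def form_op_def ip_scale)

text \<open>Pythagoras for a form: the eigenvalue equations make the remainder \<open>t m\<close>
  q-orthogonal to the partial sum. The equations are assumed directly, without reference to
  \<open>form_op\<close>, because the result is also applied to the inner product itself, with all
  eigenvalues 1.\<close>

lemma form_residual:
  assumes f: "hermitian_form Q q" and b: "onb b" and bQ: "\<And>k. b k \<in> Q"
    and ev: "\<And>k \<phi>. \<phi> \<in> Q \<Longrightarrow> q \<phi> (b k) = of_real (\<mu> k) * ip \<phi> (b k)" and psi: "\<psi> \<in> Q"
  defines "t \<equiv> \<lambda>m z. (-1) * (\<Sum>k<m. ip (b k) \<psi> * b k z) + \<psi> z"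
  shows "t m \<in> Q" "Re (q (t m) (t m)) = Re (q \<psi> \<psi>) - (\<Sum>k<m. \<mu> k * (cmod (ip (b k) \<psi>))\<^sup>2)"
proof -
  let ?c = "\<lambda>k. ip (b k) \<psi>" and ?s = "\<lambda>z. \<Sum>k<m. ip (b k) \<psi> * b k z"
  let ?S = "\<Sum>k<m. \<mu> k * (cmod (ip (b k) \<psi>))\<^sup>2"
  have s: "?s \<in> Q" by (intro form_dom_sum[OF f] bQ finite_lessThan)
  have qs: "q \<phi> ?s = (\<Sum>k<m. ?c k * of_real (\<mu> k) * ip \<phi> (b k))" if "\<phi> \<in> Q" for \<phi>
    by (simp add: form_sum[OF f that finite_lessThan bQ] ev[OF that] mult.assoc)
  have smd: "?c k * of_real (\<mu> k) * cnj (?c k) = of_real (\<mu> k * (cmod (?c k))\<^sup>2)" for k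
    by (simp only: of_real_mult cnj_mult_self[symmetric] mult_ac)
  have "q \<psi> ?s = (\<Sum>k<m. ?c k * of_real (\<mu> k) * cnj (?c k))"
    unfolding qs[OF psi] by (simp only: ip_cnj)
  then have 1: "q \<psi> ?s = of_real ?S" unfolding smd by simp
  have 2: "q ?s \<psi> = of_real ?S" using form_cnj[OF f psi s] unfolding 1 by simp
  have "ip ?s (b k) = cnj (?c k)" if "k < m" for k
  proof -
    have "ip (b k) ?s = (\<Sum>j<m. ?c j * ip (b k) (b j))"
      by (rule ip_sum[OF finite_lessThan onb_hilb[OF b] onb_hilb[OF b]])
    also have "\<dots> = ?c k" using that by (simp add: onb_ip[OF b] if_distrib cong: if_cong)
    finally show ?thesis unfolding ip_cnj[of "b k" ?s, symmetric] by simp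
  qed
  then have "q ?s ?s = (\<Sum>k<m. ?c k * of_real (\<mu> k) * cnj (?c k))"
    unfolding qs[OF s] by (intro sum.cong refl) (simp only: lessThan_iff)
  then have 3: "q ?s ?s = of_real ?S" unfolding smd by simp
  show t: "t m \<in> Q" unfolding t_def by (rule form_dom_lin[OF f s psi])
  have 4: "q \<phi> (t m) = - q \<phi> ?s + q \<phi> \<psi>" if "\<phi> \<in> Q" for \<phi>
    unfolding t_def using form_lin[OF f that s psi, of "-1"] by simp
  have "q ?s (t m) = 0" using 4[OF s] 2 3 by simp
  moreover have "q \<psi> (t m) = - of_real ?S + q \<psi> \<psi>" using 4[OF psi] 1 by simp
  ultimately have "q (t m) ?s = 0" "q (t m) \<psi> = - of_real ?S + cnj (q \<psi> \<psi>)"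
    unfolding form_cnj[OF f s t, symmetric] form_cnj[OF f psi t, symmetric] by simp_all
  then have "q (t m) (t m) = - of_real ?S + cnj (q \<psi> \<psi>)" using 4[OF t] by simp
  then show "Re (q (t m) (t m)) = Re (q \<psi> \<psi>) - ?S" by simp
qed

lemma hermitian_form_ip: "hermitian_form hilb ip"
  unfolding hermitian_form_def
proof (intro conjI ballI allI impI)
  fix \<phi> \<psi> :: "'a wf" assume D: "\<phi> \<in> hilb" "\<psi> \<in> hilb"
  show "(\<lambda>z. c * \<phi> z + \<psi> z) \<in> hilb" for c by (rule hilb_lin[OF D])
  show "ip \<zeta> (\<lambda>z. c * \<phi> z + \<psi> z) = c * ip \<zeta> \<phi> + ip \<zeta> \<psi>" if "\<zeta> \<in> hilb" for c \<zeta>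
    by (rule ip_lin[OF that[THEN hilb_sq_int] D[THEN hilb_sq_int]])
  show "cnj (ip \<phi> \<psi>) = ip \<psi> \<phi>" by (rule ip_cnj)
  assume "wf_eq \<psi> (\<lambda>z. 0)"
  from ip_cong[OF this D[THEN hilb_sq_int] sq_int_zero] show "ip \<phi> \<psi> = 0" by simp
qed (auto simp: hilb_zero)

text \<open>The lower bound \<open>C\<close> is applied to the remainder of the expansion. Only an
  inequality results: the remainder tends to 0 in norm, but its form value need not.\<close>

lemma form_bessel:
  assumes f: "hermitian_form Q q" and sys: "eigensystem (form_op Q q) b \<mu>"
    and C: "\<And>\<psi>. \<psi> \<in> Q \<Longrightarrow> C * Re (ip \<psi> \<psi>) \<le> Re (q \<psi> \<psi>)" and psi: "\<psi> \<in> Q"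
  shows "(\<Sum>k<m. (\<mu> k - C) * (cmod (ip (b k) \<psi>))\<^sup>2) \<le> Re (q \<psi> \<psi>) - C * Re (ip \<psi> \<psi>)"
proof -
  note b = form_op_onb[OF sys] and bQ = form_op_dom[OF sys]
  let ?t = "\<lambda>z. (-1) * (\<Sum>k<m. ip (b k) \<psi> * b k z) + \<psi> z"
  note r = form_residual[OF f b bQ form_op_eigen[OF sys] psi, where m = m]
  have "Re (ip ?t ?t) = Re (ip \<psi> \<psi>) - (\<Sum>k<m. 1 * (cmod (ip (b k) \<psi>))\<^sup>2)"
    by (rule form_residual(2)[OF hermitian_form_ip b onb_hilb[OF b] _ form_hilb[OF f psi]]) simp
  with C[OF r(1)] r(2) show ?thesis
    by (simp add: sum_subtractf left_diff_distrib right_diff_distrib sum_distrib_left)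
qed

lemma form_eigenvalue_ge:
  assumes sys: "eigensystem (form_op Q q) b \<mu>"
    and C: "\<And>\<psi>. \<psi> \<in> Q \<Longrightarrow> C * Re (ip \<psi> \<psi>) \<le> Re (q \<psi> \<psi>)"
  shows "C \<le> \<mu> k"
  using C[OF form_op_dom[OF sys, of k]] form_op_eigen[OF sys form_op_dom[OF sys, of k], of k]
  by (simp add: onb_ip[OF form_op_onb[OF sys]])

subsection \<open>Gibbs states\<close>

definition gibbs_state ::
  "'n::finite wf set \<Rightarrow> ('n wf \<Rightarrow> 'n wf \<Rightarrow> complex) \<Rightarrow> ('n wf \<Rightarrow> 'n wf) \<Rightarrow> (nat \<Rightarrow> 'n wf) \<Rightarrow> (nat \<Rightarrow> real) \<Rightarrow> real \<Rightarrow> bool" where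
  "gibbs_state Q q \<rho> b \<mu> Z \<longleftrightarrow> bounded_op \<rho> \<and> eigensystem (form_op Q q) b \<mu> \<and>
     (\<forall>k. wf_eq (\<rho> (b k)) (\<lambda>z. of_real (exp (- \<mu> k) / Z) * b k z)) \<and> 0 < Z \<and> has_trace \<rho> 1 \<and>
     (\<exists>C. \<forall>\<psi>\<in>Q. C * Re (ip \<psi> \<psi>) \<le> Re (q \<psi> \<psi>))"

text \<open>\<open>normalized_exp\<close> says nothing about the sign of the normalization.
  Evaluating the trace in the eigenbasis shows \<open>Z\<close> to be a convergent sum of
  exponentials, hence positive.\<close>

lemma normalized_exp_gibbs:
  fixes \<rho> :: "'n::finite wf \<Rightarrow> 'n wf"
  assumes "normalized_exp Q q \<rho>"
  shows "\<exists>b \<mu> Z. gibbs_state Q q \<rho> b \<mu> Z"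
proof -
  obtain G Z where rho: "bounded_op \<rho>" and sb: "semibounded Q q"
    and G: "fun_of_op (\<lambda>a. exp (- a)) (form_op Q q) G" and tr: "has_trace G (of_real Z)"
    and eq: "op_eq \<rho> (\<lambda>\<psi> z. G \<psi> z / of_real Z)"
    using assms unfolding normalized_exp_def by (elim conjE exE)
  obtain b \<mu> where Gb: "bounded_op G" and sys: "eigensystem (form_op Q q) b \<mu>"
    and diag: "\<And>k. wf_eq (G (b k)) (\<lambda>z. of_real (exp (- \<mu> k)) * b k z)"
    using G unfolding fun_of_op_def by (elim conjE exE) simp
  note b = form_op_onb[OF sys]
  have "eigensystem (graph_of G) b (\<lambda>k. exp (- \<mu> k))"
    using diag b by (auto simp: eigensystem_def graph_of_def onb_hilb[OF b] hilb_scale intro: wf_eq_sym)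
  from has_sum_Re[OF eigensystem_trace[OF Gb this tr]]
  have "((\<lambda>k. exp (- \<mu> k)) has_sum Z) UNIV" by simp
  from has_sum_imp_sums[OF this] have "(\<lambda>k. exp (- \<mu> k)) sums Z" .
  then have Z: "0 < Z" using suminf_pos[of "\<lambda>k. exp (- \<mu> k)"] by (simp add: sums_iff)
  have rd: "wf_eq (\<rho> \<psi>) (\<lambda>z. (1 / of_real Z) * G \<psi> z)" if "\<psi> \<in> hilb" for \<psi>
    using eq that unfolding op_eq_def by simp
  have "wf_eq (\<rho> (b k)) (\<lambda>z. of_real (exp (- \<mu> k) / Z) * b k z)" for k
    using rd[OF onb_hilb[OF b, of k]] diag[of k] unfolding wf_eq_def
    by eventually_elim simp
  moreover have "has_trace \<rho> 1"
    unfolding has_trace_def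
  proof (intro allI impI)
    fix b' :: "nat \<Rightarrow> 'n wf" assume b': "onb b'"
    have "ip (b' k) (\<rho> (b' k)) = (1 / of_real Z) * ip (b' k) (G (b' k))" for k
    proof -
      note h = onb_hilb[OF b', of k]
      show ?thesis
        using ip_cong[OF rd[OF h] hilb_sq_int[OF h] hilb_sq_int[OF bounded_op_hilb[OF rho h]]
            sq_int_scale[OF hilb_sq_int[OF bounded_op_hilb[OF Gb h]]]] by (simp only: ip_scale)
    qed
    moreover have "((\<lambda>k. (1 / of_real Z) * ip (b' k) (G (b' k))) has_sum (1 / of_real Z) * of_real Z) UNIV"
      using tr b' unfolding has_trace_def by (intro has_sum_cmult_right) simp
    ultimately show "((\<lambda>k. ip (b' k) (\<rho> (b' k))) has_sum 1) UNIV" using Z by simp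
  qed
  moreover have "\<exists>C. \<forall>\<psi>\<in>Q. C * Re (ip \<psi> \<psi>) \<le> Re (q \<psi> \<psi>)" using sb unfolding semibounded_def .
  ultimately have "gibbs_state Q q \<rho> b \<mu> Z"
    using rho sys Z unfolding gibbs_state_def by (intro conjI allI)
  then show ?thesis by (intro exI)
qed

lemma gibbs_stateD:
  assumes "gibbs_state Q q \<rho> b \<mu> Z"
  shows gibbs_bounded: "bounded_op \<rho>" and gibbs_sys: "eigensystem (form_op Q q) b \<mu>"
    and gibbs_diag: "wf_eq (\<rho> (b k)) (\<lambda>z. of_real (exp (- \<mu> k) / Z) * b k z)"
    and gibbs_pos: "0 < Z" and gibbs_trace: "has_trace \<rho> 1" and gibbs_onb: "onb b"
    and gibbs_semibounded: "\<exists>C. \<forall>\<psi>\<in>Q. C * Re (ip \<psi> \<psi>) \<le> Re (q \<psi> \<psi>)"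
  using assms form_op_onb unfolding gibbs_state_def by (blast+)

lemma gibbs_graph:
  assumes g: "gibbs_state Q q \<rho> b \<mu> Z"
  shows "eigensystem (graph_of \<rho>) b (\<lambda>k. exp (- \<mu> k) / Z)"
  unfolding eigensystem_def graph_of_def mem_Collect_eq case_prod_conv
  by (intro conjI allI gibbs_onb[OF g] onb_hilb[OF gibbs_onb[OF g]] hilb_scale[OF onb_hilb[OF gibbs_onb[OF g]]]
      wf_eq_sym[OF gibbs_diag[OF g]])

lemma gibbs_weights_has_sum:
  assumes g: "gibbs_state Q q \<rho> b \<mu> Z"
  shows "((\<lambda>k. exp (- \<mu> k) / Z) has_sum 1) UNIV"
  using has_sum_Re[OF eigensystem_trace[OF gibbs_bounded[OF g] gibbs_graph[OF g] gibbs_trace[OF g]]] by simp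

lemma gibbs_quadratic:
  assumes g: "gibbs_state Q q \<rho> b \<mu> Z" and psi: "\<psi> \<in> hilb"
  shows "((\<lambda>k. exp (- \<mu> k) / Z * (cmod (ip (b k) \<psi>))\<^sup>2) has_sum Re (ip \<psi> (\<rho> \<psi>))) UNIV"
    and "ip \<psi> (\<rho> \<psi>) = of_real (Re (ip \<psi> (\<rho> \<psi>)))"
proof -
  note d = diagonal_quadratic[OF gibbs_bounded[OF g] gibbs_onb[OF g] gibbs_diag[OF g] psi]
  show 1: "((\<lambda>k. exp (- \<mu> k) / Z * (cmod (ip (b k) \<psi>))\<^sup>2) has_sum Re (ip \<psi> (\<rho> \<psi>))) UNIV"
    using has_sum_Re[OF d] by (simp only: Re_complex_of_real)
  show "ip \<psi> (\<rho> \<psi>) = of_real (Re (ip \<psi> (\<rho> \<psi>)))"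
    by (rule has_sum_unique[OF d has_sum_of_real[OF 1]])
qed

lemma density_matrix_gibbs:
  fixes \<rho> :: "'n::finite wf \<Rightarrow> 'n wf"
  assumes g: "gibbs_state Q q \<rho> b \<mu> Z" shows "density_matrix \<rho>"
  unfolding density_matrix_def
proof (intro conjI ballI)
  fix \<psi> :: "'n wf" assume psi: "\<psi> \<in> hilb"
  show "ip \<psi> (\<rho> \<psi>) \<in> \<real>" by (subst gibbs_quadratic(2)[OF g psi]) (rule Reals_of_real)
  show "0 \<le> Re (ip \<psi> (\<rho> \<psi>))"
    using gibbs_pos[OF g] by (intro has_sum_nonneg[OF gibbs_quadratic(1)[OF g psi]]) simp
qed (use gibbs_bounded[OF g] gibbs_trace[OF g] in auto)

text \<open>\<open>exp (- x)\<close> lies above its tangent at \<open>a\<close>; averaging over the spectral measure of \<open>\<psi>\<close> bounds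
  \<open>\<langle>\<psi>, \<rho> \<psi>\<rangle>\<close> from below by a function of \<open>q \<psi> \<psi>\<close>.\<close>

lemma exp_tangent: "exp (- a) * (1 + a - x) \<le> exp (- x)" for a x :: real
proof -
  have "exp (- a) * (1 + (a - x)) \<le> exp (- a) * exp (a - x)"
    by (intro mult_left_mono exp_ge_add_one_self) simp
  also have "\<dots> = exp (- x)" by (simp flip: exp_add)
  finally show ?thesis by (simp add: algebra_simps)
qed

text \<open>The tangent meets the curve only once, since ln y = y - 1 holds only for y = 1. This
  settles the equality case of the Gibbs inequality.\<close>

lemma exp_tangent_eq:
  fixes a x :: real
  assumes "exp (- x) = exp (- a) * (1 + a - x)" shows "x = a"
proof -
  have "exp (a - x) = exp a * exp (- x)" by (simp flip: exp_add)
  also have "\<dots> = 1 + (a - x)" unfolding assms by (simp add: exp_minus algebra_simps)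
  finally have "ln (exp (a - x)) = exp (a - x) - 1" unfolding ln_exp by simp
  from ln_eq_minus_one[OF exp_gt_zero this] show ?thesis by simp
qed

text \<open>The right side dominates a series of nonnegative tangent gaps weighted by the spectral
  measure of \<psi>. One term of the series is retained on the left: if the right side vanishes,
  every \<mu> k with a nonzero overlap must equal \<open>a\<close>.\<close>

lemma gibbs_lower_bound:
  assumes f: "hermitian_form Q q" and g: "gibbs_state Q q \<rho> b \<mu> Z"
    and psi: "\<psi> \<in> Q" "ip \<psi> \<psi> = 1"
  shows "(exp (- \<mu> k) - exp (- a) * (1 + a - \<mu> k)) * (cmod (ip (b k) \<psi>))\<^sup>2
    \<le> Z * Re (ip \<psi> (\<rho> \<psi>)) - exp (- a) * (1 + a - Re (q \<psi> \<psi>))"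
proof -
  note sys = gibbs_sys[OF g] and Z = gibbs_pos[OF g]
  obtain C where C: "\<And>\<psi>. \<psi> \<in> Q \<Longrightarrow> C * Re (ip \<psi> \<psi>) \<le> Re (q \<psi> \<psi>)" using gibbs_semibounded[OF g] by blast
  let ?w = "\<lambda>k. (cmod (ip (b k) \<psi>))\<^sup>2"
  have w: "(?w has_sum 1) UNIV"
    using onb_norm_has_sum[OF gibbs_onb[OF g] form_hilb[OF f psi(1)]] psi(2) by simp
  \<comment> \<open>Eigenvalues may be negative. Subtracting the lower bound \<open>C\<close> makes
    the series nonnegative, so that bounded partial sums imply convergence.\<close>
  have nn: "0 \<le> (\<mu> k - C) * ?w k" for k
    using form_eigenvalue_ge[OF sys C] by (intro mult_nonneg_nonneg) simp_all
  have bess: "(\<Sum>k<m. (\<mu> k - C) * ?w k) \<le> Re (q \<psi> \<psi>) - C" for m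
    using form_bessel[OF f sys C psi(1), of m] psi(2) by simp
  have sm: "summable (\<lambda>k. (\<mu> k - C) * ?w k)"
  proof (rule bounded_imp_summable[where B = "Re (q \<psi> \<psi>) - C"])
    show "(\<Sum>k\<le>m. (\<mu> k - C) * ?w k) \<le> Re (q \<psi> \<psi>) - C" for m
      using bess[of "Suc m"] by (simp add: lessThan_Suc_atMost)
  qed (rule nn)
  define R where "R = (\<Sum>k. (\<mu> k - C) * ?w k)"
  have R: "((\<lambda>k. (\<mu> k - C) * ?w k) has_sum R) UNIV"
    unfolding R_def by (rule sums_nonneg_imp_has_sum[OF summable_sums[OF sm] nn])
  have Rle: "R \<le> Re (q \<psi> \<psi>) - C"
    unfolding R_def by (rule suminf_le_const[OF sm bess])
  have "((\<lambda>k. Z * (exp (- \<mu> k) / Z * ?w k)) has_sum Z * Re (ip \<psi> (\<rho> \<psi>))) UNIV"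
    by (rule has_sum_cmult_right[OF gibbs_quadratic(1)[OF g form_hilb[OF f psi(1)]]])
  moreover have "((\<lambda>k. - (exp (- a) * (1 + a - C)) * ?w k + exp (- a) * ((\<mu> k - C) * ?w k)) has_sum
      - (exp (- a) * (1 + a - C)) * 1 + exp (- a) * R) UNIV"
    by (intro has_sum_add has_sum_cmult_right w R)
  ultimately have D: "((\<lambda>k. Z * (exp (- \<mu> k) / Z * ?w k) + (- (exp (- a) * (1 + a - C)) * ?w k + exp (- a) * ((\<mu> k - C) * ?w k)))
      has_sum Z * Re (ip \<psi> (\<rho> \<psi>)) + (- (exp (- a) * (1 + a - C)) * 1 + exp (- a) * R)) UNIV"
    by (rule has_sum_add)
  have "Z * (exp (- \<mu> k) / Z * ?w k) + (- (exp (- a) * (1 + a - C)) * ?w k + exp (- a) * ((\<mu> k - C) * ?w k))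
      = (exp (- \<mu> k) - exp (- a) * (1 + a - \<mu> k)) * ?w k" for k
    using Z by (simp add: algebra_simps)
  with D have D': "((\<lambda>k. (exp (- \<mu> k) - exp (- a) * (1 + a - \<mu> k)) * ?w k)
      has_sum Z * Re (ip \<psi> (\<rho> \<psi>)) - exp (- a) * (1 + a - C - R)) UNIV"
    by (simp add: algebra_simps)
  have "((\<lambda>k. (exp (- \<mu> k) - exp (- a) * (1 + a - \<mu> k)) * ?w k) has_sum
      (exp (- \<mu> k) - exp (- a) * (1 + a - \<mu> k)) * ?w k) {k}"
    using has_sum_finite[of "{k}" "\<lambda>k. (exp (- \<mu> k) - exp (- a) * (1 + a - \<mu> k)) * ?w k"] by simp
  then have "(exp (- \<mu> k) - exp (- a) * (1 + a - \<mu> k)) * ?w k \<le> Z * Re (ip \<psi> (\<rho> \<psi>)) - exp (- a) * (1 + a - C - R)"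
    by (rule has_sum_mono2[OF _ D']) (use exp_tangent in auto)
  also have "\<dots> \<le> Z * Re (ip \<psi> (\<rho> \<psi>)) - exp (- a) * (1 + a - Re (q \<psi> \<psi>))"
    using Rle by (intro diff_left_mono mult_left_mono) auto
  finally show ?thesis .
qed

section \<open>The Gibbs inequality and its equality case\<close>

lemma density_eigenvalue_nonneg:
  assumes "density_matrix \<rho>" "eigensystem (graph_of \<rho>) b p" shows "0 \<le> p k"
proof -
  note b = eigensystem_onb[OF assms(2)]
  have "bounded_op \<rho>" using assms(1) by (simp add: density_matrix_def)
  from diagonal_coeff[OF this b eigensystem_eq[OF assms(2)] onb_hilb[OF b], of k k]
  have "ip (b k) (\<rho> (b k)) = of_real (p k)" by (simp add: onb_ip[OF b])
  then show ?thesis using assms(1) onb_hilb[OF b, of k] unfolding density_matrix_def by (metis Re_complex_of_real)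
qed

lemma density_eigenvalues_has_sum:
  assumes "density_matrix \<rho>" "eigensystem (graph_of \<rho>) b p" shows "(p has_sum 1) UNIV"
  using has_sum_Re[OF eigensystem_trace[OF _ assms(2)], of 1] assms(1) by (simp add: density_matrix_def)

text \<open>Everything is evaluated in the eigenbasis of the competitor \<rho>', the one in which
  its energy is given. The terms \<open>?D k\<close> add up to e + ln Z - s, and each is
  nonnegative: for p k > 0 this is the tangent bound at a = - ln (p k * Z), chosen so that exp (- a)
  = p k * Z; for p k = 0 only the nonnegative expectation \<open>?r k\<close> remains.\<close>

lemma gibbs_inequality:
  assumes f: "hermitian_form Q q" and g: "gibbs_state Q q \<rho> b \<mu> Z"
    and d: "density_matrix \<rho>'" and sys': "eigensystem (graph_of \<rho>') b' p"
    and dom: "\<And>k. p k \<noteq> 0 \<Longrightarrow> b' k \<in> Q"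
    and e: "((\<lambda>k. p k * Re (q (b' k) (b' k))) has_sum e) UNIV"
    and s: "has_entropy \<rho>' s"
  shows "s \<le> e + ln Z" and "s = e + ln Z \<Longrightarrow> op_eq \<rho>' \<rho>"
proof -
  note Z = gibbs_pos[OF g] and b' = eigensystem_onb[OF sys']
  have bd: "bounded_op \<rho>'" using d by (simp add: density_matrix_def)
  let ?r = "\<lambda>k. Re (ip (b' k) (\<rho> (b' k)))" and ?h = "\<lambda>k. Re (q (b' k) (b' k))"
  let ?D = "\<lambda>k. ((?r k + (- 1) * p k) + p k * ln (p k)) + (p k * ?h k + p k * ln Z)"
  note p0 = density_eigenvalue_nonneg[OF d sys']
  note p1 = density_eigenvalues_has_sum[OF d sys']
  have "((\<lambda>k. ip (b' k) (\<rho> (b' k))) has_sum 1) UNIV"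
    using gibbs_trace[OF g] b' unfolding has_trace_def by blast
  from has_sum_Re[OF this] have r: "(?r has_sum 1) UNIV" by simp
  have D: "(?D has_sum ((1 + (- 1) * 1) + - s) + (e + 1 * ln Z)) UNIV"
    by (intro has_sum_add has_sum_cmult_right has_sum_cmult_left r p1 e entropy_has_sum[OF bd s sys'])
  have unit: "ip (b' k) (b' k) = 1" for k by (simp add: onb_ip[OF b'])
  have key: "(exp (- \<mu> j) - p k * Z * (1 + (- ln (p k * Z)) - \<mu> j)) * (cmod (ip (b j) (b' k)))\<^sup>2 \<le> Z * ?D k"
    if "p k > 0" for j k
  proof -
    have pZ: "p k * Z > 0" using that Z by simp
    have e1: "exp (- (- ln (p k * Z))) = p k * Z" using pZ by simp
    have "(exp (- \<mu> j) - p k * Z * (1 + (- ln (p k * Z)) - \<mu> j)) * (cmod (ip (b j) (b' k)))\<^sup>2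
        \<le> Z * ?r k - p k * Z * (1 + (- ln (p k * Z)) - ?h k)"
      using gibbs_lower_bound[OF f g dom unit, of k j "- ln (p k * Z)"] that unfolding e1 by simp
    also have "\<dots> = Z * ?D k"
      using that Z by (simp add: ln_mult algebra_simps)
    finally show ?thesis .
  qed
  have tang: "0 \<le> exp (- \<mu> j) - p k * Z * (1 + (- ln (p k * Z)) - \<mu> j)" if "p k > 0" for j k
    using exp_tangent[of "- ln (p k * Z)" "\<mu> j"] that Z by simp
  have r_nn: "0 \<le> ?r k" for k
    using density_matrix_gibbs[OF g] onb_hilb[OF b', of k] unfolding density_matrix_def by blast
  have D_nn: "0 \<le> ?D k" for k
  proof (cases "p k > 0")
    case True
    have "0 \<le> Z * ?D k"
      by (rule order_trans[OF mult_nonneg_nonneg[OF tang[OF True] zero_le_power2] key[OF True, of 0]])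
    then show ?thesis using Z by (simp add: zero_le_mult_iff)
  next
    case False
    then show ?thesis using p0[of k] r_nn[of k] by (simp add: not_less)
  qed
  have "0 \<le> ((1 + (- 1) * 1) + - s) + (e + 1 * ln Z)" by (rule has_sum_nonneg[OF D D_nn])
  then show "s \<le> e + ln Z" by simp
  assume eq: "s = e + ln Z"
  have "?D sums 0" using has_sum_imp_sums[OF D] eq by simp
  then have "summable ?D" "suminf ?D = 0" by (simp_all add: sums_iff)
  then have D0: "?D k = 0" for k using suminf_eq_zero_iff[of ?D] D_nn by metis
  \<comment> \<open>If p k = 0, the vanishing of \<open>?D k\<close> makes the expectation of \<rho>
    in b' k zero. All weights exp (- \<mu> j) / Z are positive, so b' k would be orthogonal to the
    whole basis \<open>b\<close>.\<close>
  have ppos: "p k > 0" for k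
  proof (rule ccontr)
    assume "\<not> p k > 0"
    then have "p k = 0" using p0[of k] by simp
    then have "?r k = 0" using D0[of k] by simp
    have "((\<lambda>j. exp (- \<mu> j) / Z * (cmod (ip (b j) (b' k)))\<^sup>2) has_sum 0) UNIV"
      using gibbs_quadratic(1)[OF g onb_hilb[OF b', of k]] unfolding \<open>?r k = 0\<close> .
    from has_sum_imp_sums[OF this] have "(\<lambda>j. exp (- \<mu> j) / Z * (cmod (ip (b j) (b' k)))\<^sup>2) sums 0" .
    then have "summable (\<lambda>j. exp (- \<mu> j) / Z * (cmod (ip (b j) (b' k)))\<^sup>2)" "(\<Sum>j. exp (- \<mu> j) / Z * (cmod (ip (b j) (b' k)))\<^sup>2) = 0"
      by (simp_all add: sums_iff)
    then have "exp (- \<mu> j) / Z * (cmod (ip (b j) (b' k)))\<^sup>2 = 0" for j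
      using suminf_eq_zero_iff[of "\<lambda>j. exp (- \<mu> j) / Z * (cmod (ip (b j) (b' k)))\<^sup>2"] Z by simp
    then have "ip (b j) (b' k) = 0" for j using Z by simp
    then have "((\<lambda>j. (cmod (ip (b j) (b' k)))\<^sup>2) has_sum 0) UNIV" by (simp add: has_sum_0)
    from has_sum_unique[OF this onb_norm_has_sum[OF gibbs_onb[OF g] onb_hilb[OF b', of k]]]
    show False by (simp add: unit)
  qed
  \<comment> \<open>Here the term retained in \<open>gibbs_lower_bound\<close> is used: the tangent
    gap at \<mu> j must vanish wherever b j and b' k overlap.\<close>
  have same: "exp (- \<mu> j) / Z = p k" if "ip (b j) (b' k) \<noteq> 0" for j k
  proof -
    have "(exp (- \<mu> j) - p k * Z * (1 + (- ln (p k * Z)) - \<mu> j)) * (cmod (ip (b j) (b' k)))\<^sup>2 \<le> 0"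
      using key[OF ppos, of j k] D0[of k] by simp
    then have 1: "exp (- \<mu> j) = p k * Z * (1 + (- ln (p k * Z)) - \<mu> j)"
      using tang[OF ppos, of j k] that by (simp add: mult_le_0_iff not_le)
    have eZ: "exp (- (- ln (p k * Z))) = p k * Z" using ppos[of k] Z by simp
    have "\<mu> j = - ln (p k * Z)" by (rule exp_tangent_eq) (simp only: 1 eZ)
    then have "exp (- \<mu> j) = p k * Z" using eZ by (simp only:)
    then show ?thesis using Z by simp
  qed
  \<comment> \<open>Thus \<rho> is diagonal in the eigenbasis of \<rho>' with the same eigenvalues,
    and the two operators agree.\<close>
  have diag: "wf_eq (\<rho> (b' k)) (\<lambda>z. of_real (p k) * b' k z)" for k
  proof (rule onb_eqI[OF gibbs_onb[OF g] bounded_op_hilb[OF gibbs_bounded[OF g] onb_hilb[OF b']] hilb_scale[OF onb_hilb[OF b']]])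
    fix j
    show "ip (b j) (\<rho> (b' k)) = ip (b j) (\<lambda>z. of_real (p k) * b' k z)"
      unfolding diagonal_coeff[OF gibbs_bounded[OF g] gibbs_onb[OF g] gibbs_diag[OF g] onb_hilb[OF b', of k]] ip_scale
      using same[of j k] by (cases "ip (b j) (b' k) = 0") simp_all
  qed
  show "op_eq \<rho>' \<rho>"
    unfolding op_eq_def
  proof
    fix \<psi> :: "'a wf" assume psi: "\<psi> \<in> hilb"
    show "wf_eq (\<rho>' \<psi>) (\<rho> \<psi>)"
    proof (rule onb_eqI[OF b' bounded_op_hilb[OF bd psi] bounded_op_hilb[OF gibbs_bounded[OF g] psi]])
      fix k
      show "ip (b' k) (\<rho>' \<psi>) = ip (b' k) (\<rho> \<psi>)"
        unfolding diagonal_coeff[OF bd b' eigensystem_eq[OF sys'] psi] diagonal_coeff[OF gibbs_bounded[OF g] b' diag psi] ..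
    qed
  qed
qed

text \<open>Since \<open>\<Sum>k. exp (- \<mu> k)\<close> converges, an eigenvector of a Gibbs state is a finite combination of
  the eigenvectors of the Hamiltonian.\<close>

lemma gibbs_eigenvector:
  assumes f: "hermitian_form Q q" and g: "gibbs_state Q q \<rho> b \<mu> Z"
    and psi: "\<psi> \<in> Q" "ip \<psi> \<psi> \<noteq> 0" and ev: "wf_eq (\<rho> \<psi>) (\<lambda>z. of_real p * \<psi> z)"
  shows "p > 0" and "\<And>\<phi>. \<phi> \<in> Q \<Longrightarrow> q \<phi> \<psi> = of_real (- ln (p * Z)) * ip \<phi> \<psi>"
proof -
  note b = gibbs_onb[OF g] and sys = gibbs_sys[OF g] and Z = gibbs_pos[OF g] and h = form_hilb[OF f psi(1)]
  let ?J = "{k. ip (b k) \<psi> \<noteq> 0}"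
  have J: "exp (- \<mu> k) / Z = p" if "k \<in> ?J" for k
  proof -
    have "complex_of_real (exp (- \<mu> k) / Z) = of_real p"
      by (rule diagonal_eigenvector[OF gibbs_bounded[OF g] b gibbs_diag[OF g] h ev]) (use that in simp)
    then show ?thesis by (simp only: of_real_eq_iff)
  qed
  have "?J \<noteq> {}"
  proof
    assume "?J = {}"
    then have "wf_eq \<psi> (\<lambda>z. 0)" by (intro onb_eqI[OF b h hilb_zero]) auto
    then show False using psi(2) ip_self_zero_iff[OF hilb_sq_int[OF h]] by simp
  qed
  then obtain k0 where k0: "exp (- \<mu> k0) / Z = p" using J by blast
  show p: "p > 0" unfolding k0[symmetric] using Z by simp
  have "(\<lambda>k. exp (- \<mu> k) / Z) \<longlonglongrightarrow> 0"
    using has_sum_imp_sums[OF gibbs_weights_has_sum[OF g]] by (intro summable_LIMSEQ_zero sums_summable)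
  from order_tendstoD(2)[OF this p] obtain N where N: "\<And>k. k \<ge> N \<Longrightarrow> exp (- \<mu> k) / Z < p"
    unfolding eventually_sequentially by blast
  have "?J \<subseteq> {..<N}"
  proof
    fix k assume "k \<in> ?J"
    from J[OF this] N[of k] show "k \<in> {..<N}" by (cases "k < N") auto
  qed
  then have fin: "finite ?J" by (rule finite_subset) simp
  let ?s = "\<lambda>z. \<Sum>k\<in>?J. ip (b k) \<psi> * b k z"
  have s: "?s \<in> Q" by (intro form_dom_sum[OF f fin] form_op_dom[OF sys])
  note sh = form_hilb[OF f s]
  have "ip (b k) ?s = ip (b k) \<psi>" for k
  proof -
    have "ip (b k) ?s = (\<Sum>j\<in>?J. ip (b j) \<psi> * ip (b k) (b j))"
      by (rule ip_sum[OF fin onb_hilb[OF b] onb_hilb[OF b]])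
    also have "\<dots> = (\<Sum>j\<in>?J. if j = k then ip (b j) \<psi> else 0)"
      by (intro sum.cong refl) (simp add: onb_ip[OF b])
    also have "\<dots> = ip (b k) \<psi>" using fin by (simp add: sum.delta)
    finally show ?thesis .
  qed
  then have eq: "wf_eq \<psi> ?s" by (intro onb_eqI[OF b h sh]) simp
  fix \<phi> assume phi: "\<phi> \<in> Q"
  note ph = form_hilb[OF f phi]
  \<comment> \<open>\<psi> equals the finite sum only almost everywhere; the form is transferred
    because it vanishes on null functions.\<close>
  let ?d = "\<lambda>z. (-1) * ?s z + \<psi> z"
  have d: "?d \<in> Q" by (rule form_dom_lin[OF f s psi(1)])
  have "wf_eq ?d (\<lambda>z. 0)" using eq unfolding wf_eq_def by eventually_elim simp
  from form_null[OF f phi d this] have "q \<phi> \<psi> = q \<phi> ?s"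
    using form_lin[OF f phi s psi(1), of "-1"] by simp
  also have "\<dots> = (\<Sum>k\<in>?J. ip (b k) \<psi> * (of_real (\<mu> k) * ip \<phi> (b k)))"
    by (simp add: form_sum[OF f phi fin form_op_dom[OF sys]] form_op_eigen[OF sys phi])
  also have "\<dots> = (\<Sum>k\<in>?J. of_real (- ln (p * Z)) * (ip (b k) \<psi> * ip \<phi> (b k)))"
  proof (intro sum.cong refl)
    fix k assume "k \<in> ?J"
    from J[OF this] have "p * Z = exp (- \<mu> k)" using Z by (simp add: field_simps)
    then have "\<mu> k = - ln (p * Z)" by simp
    then show "ip (b k) \<psi> * (of_real (\<mu> k) * ip \<phi> (b k)) = of_real (- ln (p * Z)) * (ip (b k) \<psi> * ip \<phi> (b k))"
      by (simp only: mult_ac)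
  qed
  also have "\<dots> = of_real (- ln (p * Z)) * ip \<phi> ?s"
    by (simp add: ip_sum[OF fin ph onb_hilb[OF b]] sum_distrib_left)
  also have "ip \<phi> ?s = ip \<phi> \<psi>"
    by (rule ip_cong[OF wf_eq_sym[OF eq] ph[THEN hilb_sq_int] sh[THEN hilb_sq_int] h[THEN hilb_sq_int]])
  finally show "q \<phi> \<psi> = of_real (- ln (p * Z)) * ip \<phi> \<psi>" .
qed

text \<open>The eigenbasis b' comes with the energy constraint and need not be \<open>b\<close>.
  Still, each occupied b' k is an eigenvector of the form, with eigenvalue - ln (p k * Z), so that
  the entropy and the form value match term by term.\<close>

lemma gibbs_entropy:
  assumes f: "hermitian_form Q q" and g: "gibbs_state Q q \<rho> b \<mu> Z"
    and sys': "eigensystem (graph_of \<rho>) b' p"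
    and dom: "\<And>k. p k \<noteq> 0 \<Longrightarrow> b' k \<in> Q"
    and e: "((\<lambda>k. p k * Re (q (b' k) (b' k))) has_sum e) UNIV"
    and s: "has_entropy \<rho> s"
  shows "s = e + ln Z"
proof -
  note b' = eigensystem_onb[OF sys'] and d = density_matrix_gibbs[OF g]
  have unit: "ip (b' k) (b' k) = 1" for k by (simp add: onb_ip[OF b'])
  have "p k * ln (p k) = (- 1) * (p k * Re (q (b' k) (b' k))) + p k * (- ln Z)" for k
  proof (cases "p k = 0")
    case False
    have "ip (b' k) (b' k) \<noteq> 0" by (simp add: unit)
    note ev = gibbs_eigenvector[OF f g dom[OF False] this eigensystem_eq[OF sys']]
    have "q (b' k) (b' k) = of_real (- ln (p k * Z))" using ev(2)[OF dom[OF False]] unit[of k] by simp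
    then have "Re (q (b' k) (b' k)) = - (ln (p k) + ln Z)" using ev(1) gibbs_pos[OF g] by (simp add: ln_mult)
    then show ?thesis by (simp only:) (simp add: algebra_simps)
  qed simp
  moreover have "((\<lambda>k. (- 1) * (p k * Re (q (b' k) (b' k))) + p k * (- ln Z)) has_sum (- 1) * e + 1 * (- ln Z)) UNIV"
    by (intro has_sum_add has_sum_cmult_right has_sum_cmult_left e density_eigenvalues_has_sum[OF d sys'])
  ultimately have "((\<lambda>k. p k * ln (p k)) has_sum (- 1) * e + 1 * (- ln Z)) UNIV" by simp
  from has_sum_unique[OF this entropy_has_sum[OF gibbs_bounded[OF g] s sys']] show ?thesis by simp
qed

subsection \<open>Densities\<close>

lemma sum_permutes:
  assumes "\<pi> permutes (UNIV :: 'n::finite set)" shows "(\<Sum>i\<in>UNIV. f (\<pi> i)) = (\<Sum>i\<in>UNIV. f i)"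
  by (rule sum.reindex_bij_betw[OF permutes_imp_bij[OF assms]])

lemma one_body_permute:
  assumes "\<pi> permutes (UNIV :: 'n::finite set)" shows "one_body g (\<chi> i. x $ \<pi> i) = one_body g (x :: (real^3)^'n)"
  using sum_permutes[OF assms, of "\<lambda>i. g (x $ i)"] by (simp add: one_body_def)

lemma mult_bounded_sq_int:
  fixes w :: "(real^3)^'n::finite \<Rightarrow> real"
  assumes w: "w \<in> borel_measurable borel" and B: "\<And>x. \<bar>w x\<bar> \<le> B" and sq: "\<psi> \<in> sq_int"
  shows "mult w \<psi> \<in> sq_int"
  unfolding sq_int_def mem_Collect_eq
proof (intro conjI)
  show m: "mult w \<psi> \<in> borel_measurable conf" by (rule mult_measurable[OF w sq])
  show "integrable conf (\<lambda>z. (cmod (mult w \<psi> z))\<^sup>2)"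
  proof (rule Bochner_Integration.integrable_bound)
    show "integrable conf (\<lambda>z. B\<^sup>2 * (cmod (\<psi> z))\<^sup>2)"
      by (rule integrable_mult_right[OF sq_int_integrable[OF sq]])
    show "(\<lambda>z. (cmod (mult w \<psi> z))\<^sup>2) \<in> borel_measurable conf" using m by measurable
    have "(cmod (mult w \<psi> z))\<^sup>2 \<le> B\<^sup>2 * (cmod (\<psi> z))\<^sup>2" for z
    proof -
      have "(cmod (mult w \<psi> z))\<^sup>2 = (w (fst z))\<^sup>2 * (cmod (\<psi> z))\<^sup>2"
        by (simp add: mult_def norm_mult power_mult_distrib)
      also have "\<dots> \<le> B\<^sup>2 * (cmod (\<psi> z))\<^sup>2"
        using B[of "fst z"] by (intro mult_right_mono) (simp_all add: abs_le_square_iff[symmetric])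
      finally show ?thesis .
    qed
    then show "AE z in conf. norm ((cmod (mult w \<psi> z))\<^sup>2) \<le> norm (B\<^sup>2 * (cmod (\<psi> z))\<^sup>2)"
      by (intro always_eventually allI) simp
  qed
qed

lemma mult_bounded_hilb:
  fixes w :: "(real^3)^'n::finite \<Rightarrow> real"
  assumes w: "w \<in> borel_measurable borel" and B: "\<And>x. \<bar>w x\<bar> \<le> B"
    and sym: "\<And>\<pi> x. \<pi> permutes UNIV \<Longrightarrow> w (\<chi> i. x $ \<pi> i) = w x" and psi: "\<psi> \<in> hilb"
  shows "mult w \<psi> \<in> hilb"
  unfolding hilb_def mem_Collect_eq
proof (intro conjI mult_bounded_sq_int[OF w B hilb_sq_int[OF psi]])
  show "antisymmetric (mult w \<psi>)"
    unfolding antisymmetric_def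
  proof (intro allI impI)
    fix \<pi> :: "'n \<Rightarrow> 'n" assume p: "\<pi> permutes UNIV"
    have "AE z in conf. \<psi> (\<chi> i. fst z $ \<pi> i, \<chi> i. snd z $ \<pi> i) = of_int (sign \<pi>) * \<psi> z"
      using psi p unfolding hilb_def antisymmetric_def by simp
    then show "AE z in conf. mult w \<psi> (\<chi> i. fst z $ \<pi> i, \<chi> i. snd z $ \<pi> i) = of_int (sign \<pi>) * mult w \<psi> z"
      by eventually_elim (simp add: mult_def sym[OF p])
  qed
qed

lemma ip_mult_self: "ip \<psi> (mult w \<psi>) = of_real (LINT z|conf. w (fst z) * (cmod (\<psi> z))\<^sup>2)"
proof -
  have "cnj (\<psi> z) * mult w \<psi> z = of_real (w (fst z) * (cmod (\<psi> z))\<^sup>2)" for z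
    unfolding mult_def of_real_mult cnj_mult_self[symmetric] by (simp only: mult_ac)
  then show ?thesis unfolding ip_def by (simp only: integral_complex_of_real)
qed

lemma one_body_bound:
  assumes "\<And>y. \<bar>g y\<bar> \<le> B" shows "\<bar>one_body g (x :: (real^3)^'n::finite)\<bar> \<le> real CARD('n) * B"
proof -
  have "\<bar>one_body g x\<bar> \<le> (\<Sum>i\<in>UNIV. \<bar>g (x $ i)\<bar>)" unfolding one_body_def by (rule sum_abs)
  also have "\<dots> \<le> (\<Sum>i\<in>(UNIV::'n set). B)" by (intro sum_mono assms)
  finally show ?thesis by simp
qed

text \<open>Since the trace may be taken in any basis, it is taken in the eigenbasis of \<rho>,
  where each diagonal element is p k times the expectation of the multiplication operator.\<close>

lemma density_has_sum_bounded:
  fixes \<rho> :: "'n::finite wf \<Rightarrow> 'n wf"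
  assumes bd: "bounded_op \<rho>" and n: "has_density \<rho> n" and sys: "eigensystem (graph_of \<rho>) b p"
    and g: "g \<in> borel_measurable borel" and B: "\<And>y. \<bar>g y\<bar> \<le> B"
  shows "((\<lambda>k. p k * (LINT z|conf. one_body g (fst z) * (cmod (b k z))\<^sup>2)) has_sum (LINT x|lborel. g x * n x)) UNIV"
    and "integrable conf (\<lambda>z. one_body g (fst z) * (cmod (b k z))\<^sup>2)"
proof -
  note onb = eigensystem_onb[OF sys]
  have gb: "bounded (range g)" unfolding bounded_iff using B by auto
  have mh: "mult (one_body g) (b k) \<in> hilb" for k
    by (rule mult_bounded_hilb[OF one_body_measurable[OF g] one_body_bound[OF B] one_body_permute onb_hilb[OF onb]])
  have "ip (b k) (\<rho> (mult (one_body g) (b k))) = of_real (p k * (LINT z|conf. one_body g (fst z) * (cmod (b k z))\<^sup>2))" for k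
    unfolding diagonal_coeff[OF bd onb eigensystem_eq[OF sys] mh] ip_mult_self of_real_mult ..
  moreover have "((\<lambda>k. ip (b k) (\<rho> (mult (one_body g) (b k)))) has_sum (of_real (LINT x|lborel. g x * n x))) UNIV"
    using n g gb onb unfolding has_density_def has_trace_def by blast
  ultimately have "((\<lambda>k. complex_of_real (p k * (LINT z|conf. one_body g (fst z) * (cmod (b k z))\<^sup>2))) has_sum
      (of_real (LINT x|lborel. g x * n x))) UNIV" by simp
  from has_sum_Re[OF this]
  show "((\<lambda>k. p k * (LINT z|conf. one_body g (fst z) * (cmod (b k z))\<^sup>2)) has_sum (LINT x|lborel. g x * n x)) UNIV"
    by (simp only: Re_complex_of_real)
  show "integrable conf (\<lambda>z. one_body g (fst z) * (cmod (b k z))\<^sup>2)"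
  proof (rule Bochner_Integration.integrable_bound)
    show "integrable conf (\<lambda>z. (real CARD('n) * B) * (cmod (b k z))\<^sup>2)"
      by (rule integrable_mult_right[OF sq_int_integrable[OF onb_sq_int[OF onb]]])
    note [measurable] = fst_conf_measurable[OF one_body_measurable[OF g]] sq_int_measurable[OF onb_sq_int[OF onb]]
    show "(\<lambda>z. one_body g (fst z) * (cmod (b k z))\<^sup>2) \<in> borel_measurable conf" by measurable
    have "\<bar>one_body g (fst z)\<bar> * (cmod (b k z))\<^sup>2 \<le> (real CARD('n) * B) * (cmod (b k z))\<^sup>2" for z
      by (intro mult_right_mono one_body_bound B) simp
    then show "AE z in conf. norm (one_body g (fst z) * (cmod (b k z))\<^sup>2) \<le> norm ((real CARD('n) * B) * (cmod (b k z))\<^sup>2)"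
      using order_trans[OF abs_ge_zero B[of undefined]] by (intro always_eventually allI) (simp add: abs_mult)
  qed
qed

text \<open>Truncate \<open>\<bar>\<alpha>\<bar>\<close> and \<open>\<alpha>\<close>, and pass to the limit by monotone and dominated convergence.\<close>

lemma density_has_sum:
  fixes \<rho> :: "'n::finite wf \<Rightarrow> 'n wf"
  assumes d: "density_matrix \<rho>" and n: "has_density \<rho> n" and sys: "eigensystem (graph_of \<rho>) b p"
    and a: "\<alpha> \<in> borel_measurable borel" and an: "integrable lborel (\<lambda>x. \<alpha> x * n x)"
  shows "p k \<noteq> 0 \<Longrightarrow> b k \<in> mult_dom (one_body \<alpha>)"
    and "((\<lambda>k. p k * Re (ip (b k) (mult (one_body \<alpha>) (b k)))) has_sum (LINT x|lborel. \<alpha> x * n x)) UNIV"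
proof -
  have bd: "bounded_op \<rho>" using d by (simp add: density_matrix_def)
  note [measurable] = a
  note onb = eigensystem_onb[OF sys] and p0 = density_eigenvalue_nonneg[OF d sys]
  have nint: "integrable lborel n" using n by (simp add: has_density_def)
  note [measurable] = borel_measurable_integrable[OF nint]
  define K where "K = (LINT x|lborel. \<bar>\<alpha> x * n x\<bar>)"
  define am where "am m y = min \<bar>\<alpha> y\<bar> (real m)" for m y
  define I where "I g k = (LINT z|conf. one_body g (fst z) * (cmod (b k z))\<^sup>2)" for g k
  have am_meas: "am m \<in> borel_measurable borel" for m unfolding am_def by measurable
  have am_bd: "\<bar>am m y\<bar> \<le> real m" for m y by (simp add: am_def)
  have am_le: "\<bar>am m y\<bar> \<le> \<bar>\<alpha> y\<bar>" for m y by (simp add: am_def)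
  note am_int = density_has_sum_bounded(2)[OF bd n sys am_meas am_bd]
  note am_sum = density_has_sum_bounded(1)[OF bd n sys am_meas am_bd, folded I_def]
  have I_nn: "0 \<le> I (am m) k" for m k
    unfolding I_def one_body_def by (intro integral_nonneg_AE always_eventually allI mult_nonneg_nonneg sum_nonneg) (auto simp: am_def)
  \<comment> \<open>No sign of \<open>n\<close> is assumed, hence the absolute value in
    \<open>K\<close>.\<close>
  have int_le: "(LINT x|lborel. am m x * n x) \<le> K" for m
    unfolding K_def
  proof (rule integral_mono)
    show "integrable lborel (\<lambda>x. \<bar>\<alpha> x * n x\<bar>)" using an by (rule integrable_abs)
    show le: "am m x * n x \<le> \<bar>\<alpha> x * n x\<bar>" for x
    proof -
      have "am m x * n x \<le> \<bar>am m x\<bar> * \<bar>n x\<bar>" by (metis abs_ge_self abs_mult)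
      also have "\<dots> \<le> \<bar>\<alpha> x\<bar> * \<bar>n x\<bar>" by (intro mult_right_mono am_le) simp
      finally show ?thesis by (simp add: abs_mult)
    qed
    show "integrable lborel (\<lambda>x. am m x * n x)"
    proof (rule Bochner_Integration.integrable_bound[OF an])
      show "(\<lambda>x. am m x * n x) \<in> borel_measurable lborel" using am_meas[of m] by measurable
      show "AE x in lborel. norm (am m x * n x) \<le> norm (\<alpha> x * n x)"
        using am_le[of m] by (intro always_eventually allI) (simp add: abs_mult mult_right_mono)
    qed
  qed
  \<comment> \<open>The bound is uniform in the truncation level \<open>m\<close> and in the number
    of terms \<open>M\<close>, so both limits can be taken later.\<close>
  have part: "(\<Sum>k<M. p k * I (am m) k) \<le> K" for m M
  proof -
    have "(\<Sum>k<M. p k * I (am m) k) \<le> (LINT x|lborel. am m x * n x)"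
      unfolding sums_unique[OF has_sum_imp_sums[OF am_sum[of m]]]
      by (rule sum_le_suminf[OF sums_summable[OF has_sum_imp_sums[OF am_sum[of m]]] finite_lessThan])
        (rule mult_nonneg_nonneg[OF p0 I_nn])
    with int_le[of m] show ?thesis by linarith
  qed
  let ?A = "\<lambda>y. \<bar>\<alpha> y\<bar>"
  have abs_lim: "integrable conf (\<lambda>z. one_body ?A (fst z) * (cmod (b k z))\<^sup>2) \<and> (\<lambda>m. I (am m) k) \<longlonglongrightarrow> I ?A k"
    if "p k \<noteq> 0" for k
  proof -
    have pk: "p k > 0" using p0[of k] that by simp
    \<comment> \<open>One summand is at most the partial sum; dividing by p k > 0 bounds the
      truncated expectations in each occupied eigenvector separately.\<close>
    have bnd: "I (am m) k \<le> K / p k" for m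
    proof -
      have "p k * I (am m) k \<le> (\<Sum>j<Suc k. p j * I (am m) j)"
        using p0 I_nn by (intro member_le_sum[of k "{..<Suc k}" "\<lambda>j. p j * I (am m) j"]) (auto intro: mult_nonneg_nonneg)
      then show ?thesis using part[where M = "Suc k" and m = m] pk by (simp add: field_simps)
    qed
    have mono1: "one_body (am m) x * c \<le> one_body (am m') x * c" if "m \<le> m'" "0 \<le> c" for m m' c and x :: "(real^3)^'n"
      unfolding one_body_def am_def by (intro mult_right_mono sum_mono that(2)) (use that(1) in auto)
    have inc: "incseq (\<lambda>m. I (am m) k)"
      unfolding I_def by (intro incseq_SucI integral_mono am_int mono1) auto
    obtain L where L: "(\<lambda>m. I (am m) k) \<longlonglongrightarrow> L" and "\<forall>m. I (am m) k \<le> L"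
      by (rule incseq_convergent[OF inc allI[OF bnd]])
    have lim: "(\<lambda>m. one_body (am m) x * c) \<longlonglongrightarrow> one_body ?A x * c" for x :: "(real^3)^'n" and c
    proof -
      have "(\<lambda>m. am m y) \<longlonglongrightarrow> \<bar>\<alpha> y\<bar>" for y
      proof (rule tendsto_eventually)
        obtain m0 :: nat where "\<bar>\<alpha> y\<bar> \<le> real m0" using real_arch_simple by blast
        then show "\<forall>\<^sub>F m in sequentially. am m y = \<bar>\<alpha> y\<bar>"
          by (intro eventually_sequentiallyI[of m0]) (simp add: am_def)
      qed
      then show ?thesis unfolding one_body_def by (intro tendsto_mult tendsto_sum tendsto_const)
    qed
    note [measurable] = fst_conf_measurable[OF one_body_measurable[of ?A]] sq_int_measurable[OF onb_sq_int[OF onb]]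
    have A: "integrable conf (\<lambda>z. one_body ?A (fst z) * (cmod (b k z))\<^sup>2)" "(LINT z|conf. one_body ?A (fst z) * (cmod (b k z))\<^sup>2) = L"
    proof -
      have m: "AE z in conf. mono (\<lambda>m. one_body (am m) (fst z) * (cmod (b k z))\<^sup>2)"
        by (intro always_eventually allI monoI mono1) auto
      have l: "AE z in conf. (\<lambda>m. one_body (am m) (fst z) * (cmod (b k z))\<^sup>2) \<longlonglongrightarrow> one_body ?A (fst z) * (cmod (b k z))\<^sup>2"
        by (intro always_eventually allI lim)
      have u: "(\<lambda>z. one_body ?A (fst z) * (cmod (b k z))\<^sup>2) \<in> borel_measurable conf"
        using fst_conf_measurable[OF one_body_measurable[of ?A]] sq_int_measurable[OF onb_sq_int[OF onb, of k]] by measurable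
      show "integrable conf (\<lambda>z. one_body ?A (fst z) * (cmod (b k z))\<^sup>2)"
        by (rule integrable_monotone_convergence[OF am_int m l L[unfolded I_def] u])
      show "(LINT z|conf. one_body ?A (fst z) * (cmod (b k z))\<^sup>2) = L"
        by (rule integral_monotone_convergence[OF am_int m l L[unfolded I_def] u])
    qed
    with L show ?thesis unfolding I_def by simp
  qed
  have one_le: "\<bar>one_body g x\<bar> \<le> one_body ?A x" if "\<And>y. \<bar>g y\<bar> \<le> \<bar>\<alpha> y\<bar>" for g and x :: "(real^3)^'n"
    unfolding one_body_def by (rule order_trans[OF sum_abs sum_mono]) (rule that)
  have one_nn: "0 \<le> one_body ?A x" for x :: "(real^3)^'n"
    unfolding one_body_def by (rule sum_nonneg) simp
  have dom: "b k \<in> mult_dom (one_body \<alpha>)" if pk: "p k \<noteq> 0" for k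
    unfolding mult_dom_def mem_Collect_eq
  proof (intro conjI onb_hilb[OF onb] Bochner_Integration.integrable_bound[OF conjunct1[OF abs_lim[OF pk]]])
    note [measurable] = fst_conf_measurable[OF one_body_measurable[OF a]] sq_int_measurable[OF onb_sq_int[OF onb, of k]]
    show "(\<lambda>z. \<bar>one_body \<alpha> (fst z)\<bar> * (cmod (b k z))\<^sup>2) \<in> borel_measurable conf" by measurable
    have "\<bar>one_body \<alpha> (fst z)\<bar> * (cmod (b k z))\<^sup>2 \<le> one_body ?A (fst z) * (cmod (b k z))\<^sup>2" for z
      by (intro mult_right_mono one_le) auto
    then show "AE z in conf. norm (\<bar>one_body \<alpha> (fst z)\<bar> * (cmod (b k z))\<^sup>2) \<le> norm (one_body ?A (fst z) * (cmod (b k z))\<^sup>2)"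
      by (intro always_eventually allI) (simp add: abs_mult one_nn)
  qed
  show "p k \<noteq> 0 \<Longrightarrow> b k \<in> mult_dom (one_body \<alpha>)" by (rule dom)
  \<comment> \<open>The summable majorant for the signed series. Where p k = 0 the integral
    \<open>I ?A k\<close> may be meaningless, but the factor p k removes it.\<close>
  define h where "h k = p k * I ?A k" for k
  have h_lim: "(\<lambda>m. p k * I (am m) k) \<longlonglongrightarrow> h k" for k
    unfolding h_def using abs_lim[of k] by (cases "p k = 0") (auto intro: tendsto_mult_left)
  have h_nn: "0 \<le> h k" for k
    by (rule LIMSEQ_le_const[OF h_lim]) (intro exI allI impI mult_nonneg_nonneg p0 I_nn)
  have hK: "(\<Sum>k<M. h k) \<le> K" for M
    by (rule LIMSEQ_le_const2[OF tendsto_sum[OF h_lim]]) (intro exI allI impI part)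
  have h_sum: "summable h"
    by (rule bounded_imp_summable[OF h_nn, where B = K]) (use hK[of "Suc _"] in \<open>simp only: lessThan_Suc_atMost\<close>)
  \<comment> \<open>Bounded functions converging pointwise to \<alpha>, each dominated by |\<alpha>|
    and therefore admissible in \<open>has_density\<close>.\<close>
  define tm where "tm m y = (if \<bar>\<alpha> y\<bar> \<le> real m then \<alpha> y else 0)" for m y
  have tm_meas: "tm m \<in> borel_measurable borel" for m unfolding tm_def by measurable
  have tm_bd: "\<bar>tm m y\<bar> \<le> real m" for m y by (simp add: tm_def)
  have tm_le: "\<bar>tm m y\<bar> \<le> \<bar>\<alpha> y\<bar>" for m y by (simp add: tm_def)
  have tm_lim: "(\<lambda>m. tm m y) \<longlonglongrightarrow> \<alpha> y" for y
  proof (rule tendsto_eventually)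
    obtain m0 :: nat where "\<bar>\<alpha> y\<bar> \<le> real m0" using real_arch_simple by blast
    then show "\<forall>\<^sub>F m in sequentially. tm m y = \<alpha> y"
      by (intro eventually_sequentiallyI[of m0]) (simp add: tm_def)
  qed
  note tm_sum = density_has_sum_bounded(1)[OF bd n sys tm_meas tm_bd, folded I_def]
  have I_bound: "\<bar>I g k\<bar> \<le> I ?A k" if g: "g \<in> borel_measurable borel" "\<And>y. \<bar>g y\<bar> \<le> \<bar>\<alpha> y\<bar>" and pk: "p k \<noteq> 0" for g k
  proof -
    note [measurable] = fst_conf_measurable[OF one_body_measurable[OF g(1)]] sq_int_measurable[OF onb_sq_int[OF onb, of k]]
    have le: "norm (one_body g (fst z) * (cmod (b k z))\<^sup>2) \<le> one_body ?A (fst z) * (cmod (b k z))\<^sup>2" for z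
      using one_le[OF g(2), of "fst z"] by (simp add: abs_mult mult_right_mono)
    have "integrable conf (\<lambda>z. one_body g (fst z) * (cmod (b k z))\<^sup>2)"
    proof (rule Bochner_Integration.integrable_bound[OF conjunct1[OF abs_lim[OF pk]]])
      show "(\<lambda>z. one_body g (fst z) * (cmod (b k z))\<^sup>2) \<in> borel_measurable conf" by measurable
      show "AE z in conf. norm (one_body g (fst z) * (cmod (b k z))\<^sup>2) \<le> norm (one_body ?A (fst z) * (cmod (b k z))\<^sup>2)"
        by (intro always_eventually allI order_trans[OF le]) (simp only: real_norm_def abs_ge_self)
    qed
    moreover have "integrable conf (\<lambda>z. one_body ?A (fst z) * (cmod (b k z))\<^sup>2)"
      using abs_lim[OF pk] by (rule conjunct1)
    ultimately have "norm (LINT z|conf. one_body g (fst z) * (cmod (b k z))\<^sup>2) \<le> (LINT z|conf. one_body ?A (fst z) * (cmod (b k z))\<^sup>2)"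
      using le by (intro order_trans[OF Bochner_Integration.integral_norm_bound integral_mono] integrable_norm)
    then show ?thesis unfolding I_def real_norm_def .
  qed
  have I_lim: "(\<lambda>m. p k * I (tm m) k) \<longlonglongrightarrow> p k * I \<alpha> k" for k
  proof (cases "p k = 0")
    case False
    have "(\<lambda>m. I (tm m) k) \<longlonglongrightarrow> I \<alpha> k"
      unfolding I_def
    proof (rule integral_dominated_convergence[OF _ _ conjunct1[OF abs_lim[OF False]]])
      note bm = sq_int_measurable[OF onb_sq_int[OF onb, of k]]
      show "(\<lambda>z. one_body \<alpha> (fst z) * (cmod (b k z))\<^sup>2) \<in> borel_measurable conf"
        using fst_conf_measurable[OF one_body_measurable[OF a]] bm by measurable
      show "(\<lambda>z. one_body (tm m) (fst z) * (cmod (b k z))\<^sup>2) \<in> borel_measurable conf" for m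
        using fst_conf_measurable[OF one_body_measurable[OF tm_meas]] bm by measurable
      show "AE z in conf. (\<lambda>m. one_body (tm m) (fst z) * (cmod (b k z))\<^sup>2) \<longlonglongrightarrow> one_body \<alpha> (fst z) * (cmod (b k z))\<^sup>2"
        unfolding one_body_def by (intro always_eventually allI tendsto_mult tendsto_sum tendsto_const tm_lim)
      show "AE z in conf. norm (one_body (tm m) (fst z) * (cmod (b k z))\<^sup>2) \<le> one_body ?A (fst z) * (cmod (b k z))\<^sup>2" for m
        using one_le[OF tm_le] by (intro always_eventually allI) (simp add: abs_mult mult_right_mono)
    qed
    then show ?thesis by (rule tendsto_mult_left)
  qed simp
  have h_bound: "norm (p k * I g k) \<le> h k" if g: "g \<in> borel_measurable borel" "\<And>y. \<bar>g y\<bar> \<le> \<bar>\<alpha> y\<bar>" for g k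
    using I_bound[OF g, of k] p0[of k] by (cases "p k = 0") (simp_all add: h_def abs_mult mult_left_mono)
  \<comment> \<open>Tannery's theorem, that is, dominated convergence for series with majorant
    \<open>h\<close>, exchanges the sum with the limit of the truncations.\<close>
  have "(\<lambda>m. \<Sum>k. p k * I (tm m) k) \<longlonglongrightarrow> (\<Sum>k. p k * I \<alpha> k)"
  proof -
    have "\<forall>\<^sub>F (k, m) in at_top \<times>\<^sub>F sequentially. norm (p k * I (tm m) k) \<le> h k"
      by (rule always_eventually) (simp only: split_paired_All case_prod_conv, intro allI h_bound[OF tm_meas tm_le])
    from tannerys_theorem[OF I_lim this h_sum] show ?thesis by simp
  qed
  moreover have "(\<Sum>k. p k * I (tm m) k) = (LINT x|lborel. tm m x * n x)" for m
    using has_sum_imp_sums[OF tm_sum[of m]] by (rule sums_unique[symmetric])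
  moreover have "(\<lambda>m. LINT x|lborel. tm m x * n x) \<longlonglongrightarrow> (LINT x|lborel. \<alpha> x * n x)"
  proof (rule integral_dominated_convergence)
    show "integrable lborel (\<lambda>x. \<bar>\<alpha> x * n x\<bar>)" using an by (rule integrable_abs)
    show "(\<lambda>x. \<alpha> x * n x) \<in> borel_measurable lborel" using an by (rule borel_measurable_integrable)
    show "(\<lambda>x. tm m x * n x) \<in> borel_measurable lborel" for m using tm_meas[of m] by measurable
    show "AE x in lborel. (\<lambda>m. tm m x * n x) \<longlonglongrightarrow> \<alpha> x * n x"
      by (intro always_eventually allI tendsto_mult tendsto_const tm_lim)
    show "AE x in lborel. norm (tm m x * n x) \<le> \<bar>\<alpha> x * n x\<bar>" for m
      using tm_le[of m] by (intro always_eventually allI) (simp add: abs_mult mult_right_mono)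
  qed
  ultimately have lim: "(\<Sum>k. p k * I \<alpha> k) = (LINT x|lborel. \<alpha> x * n x)"
    by (simp add: LIMSEQ_unique)
  have bnd: "norm (p k * I \<alpha> k) \<le> h k" for k by (rule h_bound[OF a order_refl])
  have sn: "summable (\<lambda>k. norm (p k * I \<alpha> k))"
    by (rule summable_comparison_test'[OF h_sum, of 0]) (use bnd in simp)
  have "((\<lambda>k. p k * I \<alpha> k) has_sum (\<Sum>k. p k * I \<alpha> k)) UNIV"
    by (rule norm_summable_imp_has_sum[OF sn summable_sums[OF summable_norm_cancel[OF sn]]])
  then have "((\<lambda>k. p k * I \<alpha> k) has_sum (LINT x|lborel. \<alpha> x * n x)) UNIV"
    unfolding lim .
  then show "((\<lambda>k. p k * Re (ip (b k) (mult (one_body \<alpha>) (b k)))) has_sum (LINT x|lborel. \<alpha> x * n x)) UNIV"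
    unfolding ip_mult_self Re_complex_of_real I_def .
qed

subsection \<open>Trial states\<close>

lemma trial_dom_zero: "trial_dom v (\<lambda>_. 0) = ham_dom v"
  by (auto simp: trial_dom_def ham_dom_def mult_dom_def one_body_def)

lemma mult_one_body_zero: "mult (one_body (\<lambda>_. 0)) \<psi> = (\<lambda>z. 0)"
  by (simp add: mult_def one_body_def)

lemma trial_form_zero: "trial_form v \<beta> (\<lambda>_. 0) = (\<lambda>\<phi> \<psi>. of_real \<beta> * ham_form v \<phi> \<psi>)"
  by (simp add: trial_form_def[abs_def] mult_one_body_zero)

lemma constraintsD:
  assumes "constraints v e n \<rho>"
  shows constraints_density_matrix: "density_matrix \<rho>" and constraints_energy: "has_energy v \<rho> e"
    and constraints_density: "has_density \<rho> n" and constraints_bounded: "bounded_op \<rho>"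
  using assms by (simp_all add: constraints_def density_matrix_def)

text \<open>Integrability of \<alpha> n already puts every occupied eigenvector into the form domain
  of A. Hence every state obeying the constraints can be compared with the Gibbs state for any such
  \<alpha>, and its form value depends on \<open>e\<close> and \<open>n\<close> only.\<close>

lemma constraints_form:
  assumes c: "constraints v e n \<rho>" and a: "\<alpha> \<in> borel_measurable borel"
    and an: "integrable lborel (\<lambda>x. \<alpha> x * n x)"
  shows "\<exists>b p. eigensystem (graph_of \<rho>) b p \<and> (\<forall>k. p k \<noteq> 0 \<longrightarrow> b k \<in> trial_dom v \<alpha>) \<and>
    ((\<lambda>k. p k * Re (trial_form v \<beta> \<alpha> (b k) (b k))) has_sum (\<beta> * e + (LINT x|lborel. \<alpha> x * n x))) UNIV"
proof -
  obtain b p where sys: "eigensystem (graph_of \<rho>) b p" and dom: "\<forall>k. p k \<noteq> 0 \<longrightarrow> b k \<in> ham_dom v"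
    and e: "((\<lambda>k. p k * Re (ham_form v (b k) (b k))) has_sum e) UNIV"
    using constraints_energy[OF c] unfolding has_energy_def by (elim exE conjE)
  note D = density_has_sum[OF constraints_density_matrix[OF c] constraints_density[OF c] sys a an]
  have "p k * Re (trial_form v \<beta> \<alpha> (b k) (b k)) =
      \<beta> * (p k * Re (ham_form v (b k) (b k))) + p k * Re (ip (b k) (mult (one_body \<alpha>) (b k)))" for k
    by (simp add: trial_form_def algebra_simps)
  moreover have "((\<lambda>k. \<beta> * (p k * Re (ham_form v (b k) (b k))) + p k * Re (ip (b k) (mult (one_body \<alpha>) (b k))))
      has_sum (\<beta> * e + (LINT x|lborel. \<alpha> x * n x))) UNIV"
    by (intro has_sum_add has_sum_cmult_right e D(2))
  ultimately have "((\<lambda>k. p k * Re (trial_form v \<beta> \<alpha> (b k) (b k))) has_sum (\<beta> * e + (LINT x|lborel. \<alpha> x * n x))) UNIV"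
    by simp
  moreover have "\<forall>k. p k \<noteq> 0 \<longrightarrow> b k \<in> trial_dom v \<alpha>"
    using dom D(1) unfolding trial_dom_def by simp
  ultimately show ?thesis using sys by (intro exI conjI)
qed

lemma trial_gibbs_inequality:
  assumes v: "v \<in> borel_measurable borel" and a: "\<alpha> \<in> borel_measurable borel"
    and g: "gibbs_state (trial_dom v \<alpha>) (trial_form v \<beta> \<alpha>) \<rho> b \<mu> Z"
    and c: "constraints v e n \<rho>'" and an: "integrable lborel (\<lambda>x. \<alpha> x * n x)" and s: "has_entropy \<rho>' s"
  shows "s \<le> \<beta> * e + (LINT x|lborel. \<alpha> x * n x) + ln Z"
    and "s = \<beta> * e + (LINT x|lborel. \<alpha> x * n x) + ln Z \<Longrightarrow> op_eq \<rho>' \<rho>"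
proof -
  obtain b' p where sys: "eigensystem (graph_of \<rho>') b' p" and dom: "\<forall>k. p k \<noteq> 0 \<longrightarrow> b' k \<in> trial_dom v \<alpha>"
    and sum: "((\<lambda>k. p k * Re (trial_form v \<beta> \<alpha> (b' k) (b' k))) has_sum (\<beta> * e + (LINT x|lborel. \<alpha> x * n x))) UNIV"
    using constraints_form[where \<beta> = \<beta>, OF c a an] by (elim exE conjE)
  note G = gibbs_inequality[OF hermitian_trial_form[OF v a] g constraints_density_matrix[OF c] sys dom[rule_format] sum s]
  show "s \<le> \<beta> * e + (LINT x|lborel. \<alpha> x * n x) + ln Z" by (rule G(1))
  show "s = \<beta> * e + (LINT x|lborel. \<alpha> x * n x) + ln Z \<Longrightarrow> op_eq \<rho>' \<rho>" by (rule G(2))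
qed

lemma trial_gibbs_entropy:
  assumes v: "v \<in> borel_measurable borel" and a: "\<alpha> \<in> borel_measurable borel"
    and g: "gibbs_state (trial_dom v \<alpha>) (trial_form v \<beta> \<alpha>) \<rho> b \<mu> Z"
    and c: "constraints v e n \<rho>" and an: "integrable lborel (\<lambda>x. \<alpha> x * n x)" and s: "has_entropy \<rho> s"
  shows "s = \<beta> * e + (LINT x|lborel. \<alpha> x * n x) + ln Z"
proof -
  obtain b' p where sys: "eigensystem (graph_of \<rho>) b' p" and dom: "\<forall>k. p k \<noteq> 0 \<longrightarrow> b' k \<in> trial_dom v \<alpha>"
    and sum: "((\<lambda>k. p k * Re (trial_form v \<beta> \<alpha> (b' k) (b' k))) has_sum (\<beta> * e + (LINT x|lborel. \<alpha> x * n x))) UNIV"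
    using constraints_form[where \<beta> = \<beta>, OF c a an] by (elim exE conjE)
  from gibbs_entropy[OF hermitian_trial_form[OF v a] g sys dom[rule_format] sum s] show ?thesis .
qed

section \<open>Values of the trial entropy and of the Massieu functional\<close>

lemma trialD:
  assumes "trial v e n \<beta> \<alpha> \<rho>"
  shows trial_max: "max_entropy v e n \<rho>" and trial_measurable: "\<alpha> \<in> borel_measurable borel"
    and trial_integrable: "integrable lborel (\<lambda>x. \<alpha> x * n x)"
    and trial_normalized: "normalized_exp (trial_dom v \<alpha>) (trial_form v \<beta> \<alpha>) \<rho>"
    and trial_constraints: "constraints v e n \<rho>"
  using assms unfolding trial_def max_entropy_def trial_dom_def trial_form_def[abs_def] by simp_all

text \<open>Two maximizers bound each other's entropy, so \<open>trial_entropy\<close> is well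
  defined whatever multipliers the trial states carry.\<close>

lemma max_entropy_value:
  fixes \<rho> \<rho>' :: "'n::finite wf \<Rightarrow> 'n wf"
  assumes m: "max_entropy v e n \<rho>" and m': "max_entropy v e n \<rho>'"
    and s: "has_entropy \<rho> s" and s': "has_entropy \<rho>' s'"
  shows "s = s'"
proof -
  have le: "s2 \<le> s1" if m1: "max_entropy v e n \<rho>1" and m2: "max_entropy v e n \<rho>2"
    and s1: "has_entropy \<rho>1 s1" and s2: "has_entropy \<rho>2 s2" for \<rho>1 \<rho>2 :: "'n wf \<Rightarrow> 'n wf" and s1 s2
  proof -
    obtain t where t: "has_entropy \<rho>1 t" "\<forall>(\<rho>' :: 'n wf \<Rightarrow> 'n wf) s'. constraints v e n \<rho>' \<and> has_entropy \<rho>' s' \<longrightarrow> s' \<le> t"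
      using m1 unfolding max_entropy_def by (elim conjE exE)
    have c: "constraints v e n \<rho>1" "constraints v e n \<rho>2" using m1 m2 by (simp_all add: max_entropy_def)
    have "s2 \<le> t" using t(2)[rule_format, OF conjI[OF c(2) s2]] .
    also have "t = s1" by (rule has_entropy_unique[OF constraints_bounded[OF c(1)] t(1) s1])
    finally show ?thesis .
  qed
  from le[OF m m' s s'] le[OF m' m s' s] show ?thesis by simp
qed

lemma trial_has_entropy:
  assumes "trial v e n \<beta> \<alpha> \<rho>" obtains s where "has_entropy \<rho> s"
  using trial_max[OF assms] unfolding max_entropy_def by (elim conjE exE)

lemma trial_entropy_eq:
  fixes \<rho> :: "'n::finite wf \<Rightarrow> 'n wf"
  assumes t: "trial v e n \<beta> \<alpha> \<rho>" and s: "has_entropy \<rho> s"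
  shows "trial_entropy TYPE('n) v e n = s"
  unfolding trial_entropy_def
proof (rule the_equality)
  show "\<exists>\<beta> \<alpha> (\<rho> :: 'n wf \<Rightarrow> 'n wf). trial v e n \<beta> \<alpha> \<rho> \<and> has_entropy \<rho> s"
    using t s by (intro exI conjI)
  fix s' assume "\<exists>\<beta> \<alpha> (\<rho> :: 'n wf \<Rightarrow> 'n wf). trial v e n \<beta> \<alpha> \<rho> \<and> has_entropy \<rho> s'"
  then obtain \<beta>' \<alpha>' and \<rho>' :: "'n wf \<Rightarrow> 'n wf" where t': "trial v e n \<beta>' \<alpha>' \<rho>'" and s': "has_entropy \<rho>' s'"
    by (elim exE conjE)
  show "s' = s" by (rule max_entropy_value[OF trial_max[OF t'] trial_max[OF t] s' s])
qed

text \<open>Trial states with the same \<open>\<beta>\<close> and \<open>n\<close> bound each other's Massieu function by the Gibbs inequality.\<close>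

lemma massieu_eq:
  fixes \<rho> :: "'n::finite wf \<Rightarrow> 'n wf"
  assumes v: "v \<in> borel_measurable borel" and t: "trial v e n \<beta> \<alpha> \<rho>" and s: "has_entropy \<rho> s"
  shows "massieu TYPE('n) v \<beta> n = s - \<beta> * e"
proof -
  have le: "s2 - \<beta> * e2 \<le> s1 - \<beta> * e1"
    if t1: "trial v e1 n \<beta> \<alpha>1 \<rho>1" and s1: "has_entropy \<rho>1 s1" and t2: "trial v e2 n \<beta> \<alpha>2 \<rho>2" and s2: "has_entropy \<rho>2 s2"
    for e1 e2 s1 s2 \<alpha>1 \<alpha>2 and \<rho>1 \<rho>2 :: "'n wf \<Rightarrow> 'n wf"
  proof -
    obtain b \<mu> Z where g: "gibbs_state (trial_dom v \<alpha>1) (trial_form v \<beta> \<alpha>1) \<rho>1 b \<mu> Z"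
      using normalized_exp_gibbs[OF trial_normalized[OF t1]] by (elim exE)
    from trial_gibbs_inequality(1)[OF v trial_measurable[OF t1] g trial_constraints[OF t2] trial_integrable[OF t1] s2]
      trial_gibbs_entropy[OF v trial_measurable[OF t1] g trial_constraints[OF t1] trial_integrable[OF t1] s1]
    show ?thesis by linarith
  qed
  show ?thesis
    unfolding massieu_def
  proof (rule the_equality)
    show "\<exists>e' \<alpha> (\<rho> :: 'n wf \<Rightarrow> 'n wf) s'. trial v e' n \<beta> \<alpha> \<rho> \<and> has_entropy \<rho> s' \<and> s - \<beta> * e = s' - \<beta> * e'"
      by (rule exI[of _ e], rule exI[of _ \<alpha>], rule exI[of _ \<rho>], rule exI[of _ s]) (simp add: t s)
    fix m assume "\<exists>e \<alpha> (\<rho> :: 'n wf \<Rightarrow> 'n wf) s. trial v e n \<beta> \<alpha> \<rho> \<and> has_entropy \<rho> s \<and> m = s - \<beta> * e"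
    then obtain e' \<alpha>' s' and \<rho>' :: "'n wf \<Rightarrow> 'n wf" where t': "trial v e' n \<beta> \<alpha>' \<rho>'" and s': "has_entropy \<rho>' s'" and m: "m = s' - \<beta> * e'"
      by (elim exE conjE)
    from le[OF t s t' s'] le[OF t' s' t s] m show "m = s - \<beta> * e" by linarith
  qed
qed

lemma canonical_gibbs:
  assumes "canonical v \<beta> c"
  obtains b \<mu> Z where "gibbs_state (trial_dom v (\<lambda>_. 0)) (trial_form v \<beta> (\<lambda>_. 0)) c b \<mu> Z"
  using normalized_exp_gibbs assms unfolding canonical_def trial_dom_zero trial_form_zero by blast

lemma zero_trial_inequality:
  assumes v: "v \<in> borel_measurable borel"
    and g: "gibbs_state (trial_dom v (\<lambda>_. 0)) (trial_form v \<beta> (\<lambda>_. 0)) c b \<mu> Z"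
    and c: "constraints v e n \<rho>" and s: "has_entropy \<rho> s"
  shows "s \<le> \<beta> * e + ln Z" and "s = \<beta> * e + ln Z \<Longrightarrow> op_eq \<rho> c"
  using trial_gibbs_inequality[OF v _ g c _ s] by simp_all

lemma zero_trial_entropy:
  assumes v: "v \<in> borel_measurable borel"
    and g: "gibbs_state (trial_dom v (\<lambda>_. 0)) (trial_form v \<beta> (\<lambda>_. 0)) c b \<mu> Z"
    and c: "constraints v e n c" and s: "has_entropy c s"
  shows "s = \<beta> * e + ln Z"
  using trial_gibbs_entropy[OF v _ g c _ s] by simp

subsection \<open>Multiplication by symmetric test functions\<close>

lemma test_function_bounded:
  assumes "test_function f f'"
  shows "\<exists>B. \<forall>x. \<bar>f x\<bar> \<le> B" and "\<exists>B. \<forall>x. \<bar>blinfun_apply (f' x) h\<bar> \<le> B"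
proof -
  obtain B R where B: "\<forall>x h. \<bar>f x\<bar> \<le> B * indicator (cball 0 R) x \<and> \<bar>blinfun_apply (f' x) h\<bar> \<le> B * norm h * indicator (cball 0 R) x"
    using test_function_bounds[OF assms] by (elim exE)
  have "\<bar>f x\<bar> \<le> \<bar>B\<bar>" for x
    using B[rule_format, of x h] by (cases "x \<in> cball 0 R") auto
  then show "\<exists>B. \<forall>x. \<bar>f x\<bar> \<le> B" by (intro exI allI)
  have "\<bar>blinfun_apply (f' x) h\<bar> \<le> \<bar>B * norm h\<bar>" for x
    using B[rule_format, of x h] by (cases "x \<in> cball 0 R") auto
  then show "\<exists>B. \<forall>x. \<bar>blinfun_apply (f' x) h\<bar> \<le> B" by (intro exI allI)
qed

lemma test_function_sum:
  fixes f :: "'i \<Rightarrow> (real^3)^'n::finite \<Rightarrow> real"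
  assumes "finite I" "\<And>i. i \<in> I \<Longrightarrow> test_function (f i) (f' i)"
  shows "test_function (\<lambda>x. \<Sum>i\<in>I. f i x) (\<lambda>x. \<Sum>i\<in>I. f' i x)"
  using assms
proof (induction I rule: finite_induct)
  case empty
  then show ?case unfolding test_function_def
    by (auto intro!: has_derivative_eq_rhs[OF has_derivative_const])
next
  case (insert j I)
  then have j: "test_function (f j) (f' j)" and I: "test_function (\<lambda>x. \<Sum>i\<in>I. f i x) (\<lambda>x. \<Sum>i\<in>I. f' i x)" by auto
  have "test_function (\<lambda>x. f j x + (\<Sum>i\<in>I. f i x)) (\<lambda>x. f' j x + (\<Sum>i\<in>I. f' i x))"
    unfolding test_function_def
  proof (intro conjI allI)
    fix x
    have "blinfun_apply (f' j x + (\<Sum>i\<in>I. f' i x)) = (\<lambda>h. blinfun_apply (f' j x) h + blinfun_apply (\<Sum>i\<in>I. f' i x) h)"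
      by (simp add: fun_eq_iff blinfun.add_left)
    then show "((\<lambda>x. f j x + (\<Sum>i\<in>I. f i x)) has_derivative blinfun_apply (f' j x + (\<Sum>i\<in>I. f' i x))) (at x)"
      using has_derivative_add[OF test_function_derivative[OF j] test_function_derivative[OF I]] by simp
    show "continuous_on UNIV (\<lambda>x. f' j x + (\<Sum>i\<in>I. f' i x))"
      by (intro continuous_on_add test_function_continuous_derivative[OF j] test_function_continuous_derivative[OF I])
    show "bounded {x. f j x + (\<Sum>i\<in>I. f i x) \<noteq> 0}"
      by (rule bounded_subset[OF iffD2[OF bounded_Un conjI[OF test_function_bounded_support[OF j] test_function_bounded_support[OF I]]]]) auto
  qed
  then show ?case using insert by simp
qed

lemma norm_permute:
  assumes "\<pi> permutes (UNIV :: 'n::finite set)" shows "norm (\<chi> i. x $ \<pi> i) = norm (x :: (real^3)^'n)"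
  using sum_permutes[OF assms, of "\<lambda>i. (norm (x $ i))\<^sup>2"] by (simp add: norm_vec_def L2_set_def)

lemma linear_permute: "bounded_linear (\<lambda>x :: (real^3)^'n::finite. \<chi> i. x $ \<pi> i)"
  by (intro linear_conv_bounded_linear[THEN iffD1] linearI) (simp_all add: vec_eq_iff)

lemma permute_measurable: "(\<lambda>x :: (real^3)^'n::finite. \<chi> i. x $ \<pi> i) \<in> borel_measurable borel"
  by (intro borel_measurable_continuous_onI bounded_linear.continuous_on[OF linear_permute] continuous_on_id)

lemma test_function_permute:
  fixes f :: "(real^3)^'n::finite \<Rightarrow> real"
  assumes f: "test_function f f'" and p: "\<pi> permutes UNIV"
  shows "\<exists>g'. test_function (\<lambda>x. f (\<chi> i. x $ \<pi> i)) g'"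
proof -
  let ?P = "\<lambda>x :: (real^3)^'n. \<chi> i. x $ \<pi> i"
  let ?B = "Blinfun ?P"
  have B: "blinfun_apply ?B = ?P" by (rule bounded_linear_Blinfun_apply[OF linear_permute])
  have cP: "continuous_on UNIV ?P" by (rule bounded_linear.continuous_on[OF linear_permute continuous_on_id])
  have "test_function (\<lambda>x. f (?P x)) (\<lambda>x. f' (?P x) o\<^sub>L ?B)"
    unfolding test_function_def
  proof (intro conjI allI)
    fix x
    have "blinfun_apply (f' (?P x) o\<^sub>L ?B) = (\<lambda>h. blinfun_apply (f' (?P x)) (?P h))"
      by (simp add: fun_eq_iff B)
    then show "((\<lambda>x. f (?P x)) has_derivative blinfun_apply (f' (?P x) o\<^sub>L ?B)) (at x)"
      using has_derivative_compose[OF bounded_linear_imp_has_derivative[OF linear_permute] test_function_derivative[OF f]] by simp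
    show "continuous_on UNIV (\<lambda>x. f' (?P x) o\<^sub>L ?B)"
      by (intro continuous_intros continuous_on_compose2[OF test_function_continuous_derivative[OF f] cP]) auto
    obtain R where R: "\<And>x. f x \<noteq> 0 \<Longrightarrow> norm x \<le> R"
      using test_function_bounded_support[OF f] by (auto simp: bounded_iff)
    have "norm x \<le> R" if "f (?P x) \<noteq> 0" for x using R[OF that] by (simp add: norm_permute[OF p])
    then show "bounded {x. f (?P x) \<noteq> 0}" unfolding bounded_iff by blast
  qed
  then show ?thesis by (intro exI)
qed

lemma symmetrized_test_function:
  fixes f :: "(real^3)^'n::finite \<Rightarrow> real"
  assumes f: "test_function f f'"
  shows "\<exists>F'. test_function (\<lambda>x. \<Sum>\<pi> | \<pi> permutes UNIV. f (\<chi> i. x $ \<pi> i)) F'"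
    and "\<sigma> permutes UNIV \<Longrightarrow> (\<Sum>\<pi> | \<pi> permutes UNIV. f (\<chi> i. (\<chi> i. x $ \<sigma> i) $ \<pi> i)) = (\<Sum>\<pi> | \<pi> permutes UNIV. f (\<chi> i. x $ \<pi> i))"
proof -
  have "\<forall>\<pi>\<in>{\<pi>. \<pi> permutes UNIV}. \<exists>g'. test_function (\<lambda>x. f (\<chi> i. x $ \<pi> i)) g'"
    using test_function_permute[OF f] by simp
  from bchoice[OF this] obtain G where G: "\<forall>\<pi>\<in>{\<pi>. \<pi> permutes UNIV}. test_function (\<lambda>x. f (\<chi> i. x $ \<pi> i)) (G \<pi>)"
    by (elim exE)
  have "test_function (\<lambda>x. \<Sum>\<pi> | \<pi> permutes UNIV. f (\<chi> i. x $ \<pi> i)) (\<lambda>x. \<Sum>\<pi> | \<pi> permutes UNIV. G \<pi> x)"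
    by (rule test_function_sum[OF finite_permutations[OF finite] G[rule_format]])
  then show "\<exists>F'. test_function (\<lambda>x. \<Sum>\<pi> | \<pi> permutes UNIV. f (\<chi> i. x $ \<pi> i)) F'" by (intro exI)
  assume s: "\<sigma> permutes UNIV"
  show "(\<Sum>\<pi> | \<pi> permutes UNIV. f (\<chi> i. (\<chi> i. x $ \<sigma> i) $ \<pi> i)) = (\<Sum>\<pi> | \<pi> permutes UNIV. f (\<chi> i. x $ \<pi> i))"
    \<comment> \<open>Permuting the argument by \<sigma> replaces \<pi> by \<sigma> composed with
      \<pi>, which merely reorders the sum over the group.\<close>
    using setum_permutations_compose_left[OF s, of "\<lambda>\<pi>. f (\<chi> i. x $ \<pi> i)"] by simp
qed

text \<open>The weak product rule: \<eta> is tested against \<open>f * g\<close>, again a test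
  function, and the derivative of \<open>f\<close> is moved to the other side.\<close>

lemma has_momentum_mult:
  fixes f :: "(real^3)^'n::finite \<Rightarrow> real"
  assumes f: "test_function f f'" and m: "has_momentum i a \<psi> \<eta>" and psi: "\<psi> \<in> sq_int"
  shows "has_momentum i a (mult f \<psi>) (\<lambda>z. (- \<i>) * mult (\<lambda>x. blinfun_apply (f' x) (axis i (axis a 1))) \<psi> z + mult f \<eta> z)"
    (is "has_momentum i a _ (\<lambda>z. (- \<i>) * mult ?d \<psi> z + mult f \<eta> z)")
  unfolding has_momentum_def
proof (intro conjI allI impI)
  obtain B where fb: "\<forall>x. \<bar>f x\<bar> \<le> B" using test_function_bounded(1)[OF f] by (elim exE)
  obtain B' where db: "\<forall>x. \<bar>?d x\<bar> \<le> B'"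
    using test_function_bounded(2)[OF f, of "axis i (axis a 1)"] by (elim exE)
  note eta = has_momentum_sq_int[OF m]
  note sq_d = mult_bounded_sq_int[OF test_function_derivative_measurable[OF f] db[rule_format] psi]
    and sq_f = mult_bounded_sq_int[OF test_function_measurable[OF f] fb[rule_format]]
  show "(\<lambda>z. (- \<i>) * mult ?d \<psi> z + mult f \<eta> z) \<in> sq_int" by (rule sq_int_lin[OF sq_d sq_f[OF eta]])
  fix g :: "(real^3)^'n \<Rightarrow> real" and g' s assume g: "test_function g g'"
  let ?e = "\<lambda>x. blinfun_apply (g' x) (axis i (axis a 1))"
  note i1 = test_function_integrable_product(1)[OF g sq_d, of s]
    and i2 = test_function_integrable_product(1)[OF g sq_f[OF eta], of s]
    and i3 = test_function_integrable_product(2)[OF g sq_f[OF psi], of s "axis i (axis a 1)"]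
  have "(LINT x|lborel. ((- \<i>) * mult ?d \<psi> (x, s) + mult f \<eta> (x, s)) * of_real (g x)) =
      (LINT x|lborel. (- \<i>) * (mult ?d \<psi> (x, s) * of_real (g x)) + mult f \<eta> (x, s) * of_real (g x))"
    by (simp add: algebra_simps)
  also have "\<dots> = (- \<i>) * (LINT x|lborel. mult ?d \<psi> (x, s) * of_real (g x)) + (LINT x|lborel. mult f \<eta> (x, s) * of_real (g x))"
    by (subst Bochner_Integration.integral_add[OF integrable_mult_right[OF i1] i2]) simp
  also have "(LINT x|lborel. mult f \<eta> (x, s) * of_real (g x)) = (LINT x|lborel. \<eta> (x, s) * of_real (f x * g x))"
    by (simp add: mult_def mult_ac)
  also have "\<dots> = \<i> * (LINT x|lborel. \<psi> (x, s) * of_real (blinfun_apply (f x *\<^sub>R g' x + g x *\<^sub>R f' x) (axis i (axis a 1))))"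
    by (rule has_momentumD[OF m test_function_mult[OF f g]])
  also have "(LINT x|lborel. \<psi> (x, s) * of_real (blinfun_apply (f x *\<^sub>R g' x + g x *\<^sub>R f' x) (axis i (axis a 1)))) =
      (LINT x|lborel. mult f \<psi> (x, s) * of_real (?e x) + mult ?d \<psi> (x, s) * of_real (g x))"
    by (simp add: mult_def blinfun.add_left blinfun.scaleR_left algebra_simps)
  also have "\<dots> = (LINT x|lborel. mult f \<psi> (x, s) * of_real (?e x)) + (LINT x|lborel. mult ?d \<psi> (x, s) * of_real (g x))"
    by (rule Bochner_Integration.integral_add[OF i3 i1])
  finally show "(LINT x|lborel. ((- \<i>) * mult ?d \<psi> (x, s) + mult f \<eta> (x, s)) * of_real (g x)) =
      \<i> * (LINT x|lborel. mult f \<psi> (x, s) * of_real (?e x))"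
    by (simp add: algebra_simps)
qed

lemma mult_mult_dom:
  fixes f :: "(real^3)^'n::finite \<Rightarrow> real"
  assumes w: "w \<in> borel_measurable borel" and f: "f \<in> borel_measurable borel" and B: "\<And>x. \<bar>f x\<bar> \<le> B"
    and sym: "\<And>\<pi> x. \<pi> permutes UNIV \<Longrightarrow> f (\<chi> i. x $ \<pi> i) = f x" and psi: "\<psi> \<in> mult_dom w"
  shows "mult f \<psi> \<in> mult_dom w"
  unfolding mult_dom_def mem_Collect_eq
proof (intro conjI mult_bounded_hilb[OF f B sym mult_dom_hilb[OF psi]])
  show "integrable conf (\<lambda>z. \<bar>w (fst z)\<bar> * (cmod (mult f \<psi> z))\<^sup>2)"
  proof (rule Bochner_Integration.integrable_bound)
    show "integrable conf (\<lambda>z. B\<^sup>2 * (\<bar>w (fst z)\<bar> * (cmod (\<psi> z))\<^sup>2))"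
      using psi unfolding mult_dom_def by (intro integrable_mult_right) simp
    note [measurable] = fst_conf_measurable[OF w] mult_measurable[OF f hilb_sq_int[OF mult_dom_hilb[OF psi]]]
    show "(\<lambda>z. \<bar>w (fst z)\<bar> * (cmod (mult f \<psi> z))\<^sup>2) \<in> borel_measurable conf" by measurable
    have "\<bar>w (fst z)\<bar> * (cmod (mult f \<psi> z))\<^sup>2 \<le> B\<^sup>2 * (\<bar>w (fst z)\<bar> * (cmod (\<psi> z))\<^sup>2)" for z
    proof -
      have "(cmod (mult f \<psi> z))\<^sup>2 = (f (fst z))\<^sup>2 * (cmod (\<psi> z))\<^sup>2"
        by (simp add: mult_def norm_mult power_mult_distrib)
      also have "\<dots> \<le> B\<^sup>2 * (cmod (\<psi> z))\<^sup>2"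
        using B[of "fst z"] by (intro mult_right_mono) (simp_all add: abs_le_square_iff[symmetric])
      finally have "\<bar>w (fst z)\<bar> * (cmod (mult f \<psi> z))\<^sup>2 \<le> \<bar>w (fst z)\<bar> * (B\<^sup>2 * (cmod (\<psi> z))\<^sup>2)"
        by (rule mult_left_mono) simp
      then show ?thesis by (simp only: mult_ac)
    qed
    then show "AE z in conf. norm (\<bar>w (fst z)\<bar> * (cmod (mult f \<psi> z))\<^sup>2) \<le> norm (B\<^sup>2 * (\<bar>w (fst z)\<bar> * (cmod (\<psi> z))\<^sup>2))"
      by (intro always_eventually allI) (simp add: abs_mult)
  qed
qed

text \<open>Makes a localized eigenvector admissible in the eigenvalue equations. Differentiability
  keeps it in the kinetic domain and symmetry keeps it antisymmetric, so indicators of level sets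
  cannot be used directly.\<close>

lemma mult_trial_dom:
  fixes f :: "(real^3)^'n::finite \<Rightarrow> real"
  assumes v: "v \<in> borel_measurable borel" and a: "\<alpha> \<in> borel_measurable borel" and f: "test_function f f'"
    and sym: "\<And>\<pi> x. \<pi> permutes UNIV \<Longrightarrow> f (\<chi> i. x $ \<pi> i) = f x" and psi: "\<psi> \<in> trial_dom v \<alpha>"
  shows "mult f \<psi> \<in> trial_dom v \<alpha>"
proof -
  obtain B where fb: "\<forall>x. \<bar>f x\<bar> \<le> B" using test_function_bounded(1)[OF f] by (elim exE)
  note fm = test_function_measurable[OF f]
  have D: "\<psi> \<in> ham_dom v" "\<psi> \<in> mult_dom (one_body \<alpha>)" using psi by (simp_all add: trial_dom_def)
  note k = ham_domD(1)[OF D(1)]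
  have "mult f \<psi> \<in> kinetic_dom"
    unfolding kinetic_dom_def mem_Collect_eq
  proof (intro conjI allI mult_bounded_hilb[OF fm fb[rule_format] sym kinetic_dom_hilb[OF k]])
    show "\<exists>\<eta>. has_momentum i a (mult f \<psi>) \<eta>" for i a
      by (rule exI, rule has_momentum_mult[OF f momentum_works[OF k] hilb_sq_int[OF kinetic_dom_hilb[OF k]]])
  qed
  moreover have "mult f \<psi> \<in> mult_dom coulomb" by (rule mult_mult_dom[OF coulomb_measurable fm fb[rule_format] sym ham_domD(2)[OF D(1)]])
  moreover have "mult f \<psi> \<in> mult_dom (one_body v)" by (rule mult_mult_dom[OF one_body_measurable[OF v] fm fb[rule_format] sym ham_domD(3)[OF D(1)]])
  moreover have "mult f \<psi> \<in> mult_dom (one_body \<alpha>)" by (rule mult_mult_dom[OF one_body_measurable[OF a] fm fb[rule_format] sym D(2)])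
  ultimately show ?thesis by (simp add: trial_dom_def ham_dom_def)
qed

section \<open>From symmetric test functions to symmetric Borel sets\<close>

lemma sigma_finite_conf: "sigma_finite_measure (conf :: (((real^3)^'n::finite) \<times> (bool^'n)) measure)"
proof -
  interpret pair_sigma_finite "lborel :: ((real^3)^'n::finite) measure" "count_space UNIV :: (bool^'n) measure"
    by (rule pair_sigma_finite_conf)
  show ?thesis unfolding conf_def by (rule sigma_finite_measure_axioms)
qed

lemma test_function_comp_integrable:
  fixes h :: "'z \<Rightarrow> complex"
  assumes f: "test_function f f'" and T: "T \<in> borel_measurable M" and h: "integrable M h"
  shows "integrable M (\<lambda>z. h z * of_real (f (T z)))"
proof -
  obtain B where fb: "\<forall>x. \<bar>f x\<bar> \<le> B" using test_function_bounded(1)[OF f] by (elim exE)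
  show ?thesis
  proof (rule Bochner_Integration.integrable_bound[OF integrable_mult_right[OF h, of "of_real B"]])
    have [measurable]: "(\<lambda>z. f (T z)) \<in> borel_measurable M" by (rule measurable_compose[OF T test_function_measurable[OF f]])
    have [measurable]: "h \<in> borel_measurable M" using h by (rule borel_measurable_integrable)
    show "(\<lambda>z. h z * of_real (f (T z))) \<in> borel_measurable M" by measurable
    have "norm (h z * of_real (f (T z))) \<le> norm (of_real B * h z)" for z
    proof -
      have "cmod (h z) * \<bar>f (T z)\<bar> \<le> cmod (h z) * \<bar>B\<bar>"
        using fb[rule_format, of "T z"] by (intro mult_left_mono) auto
      then show ?thesis by (simp add: norm_mult mult.commute)
    qed
    then show "AE z in M. norm (h z * of_real (f (T z))) \<le> norm (of_real B * h z)" by simp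
  qed
qed

text \<open>A finite sum of integrals along different maps \<open>T i\<close> is one integral along
  a single map on the disjoint union \<open>count_space UNIV \<Otimes>\<^sub>M M\<close>, to which
  the result for one map applies.\<close>

lemma set_integral_test_functions_zero_family:
  fixes T :: "'i::finite \<Rightarrow> 'z \<Rightarrow> (real^3)^'n::finite" and h :: "'i \<Rightarrow> 'z \<Rightarrow> complex"
  assumes M: "sigma_finite_measure M" and T: "\<And>i. T i \<in> borel_measurable M" and h: "\<And>i. integrable M (h i)"
    and zero: "\<And>f f'. test_function f f' \<Longrightarrow> (\<Sum>i\<in>UNIV. LINT z|M. h i z * of_real (f (T i z))) = 0"
    and B: "B \<in> sets borel"
  shows "(\<Sum>i\<in>UNIV. LINT z:(T i -` B \<inter> space M)|M. h i z) = 0"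
proof -
  let ?C = "count_space UNIV :: 'i measure"
  interpret M: sigma_finite_measure M by (rule M)
  interpret pair_sigma_finite ?C M
    by (simp add: pair_sigma_finite_def sigma_finite_measure_count_space_finite M)
  have int: "integrable (?C \<Otimes>\<^sub>M M) (\<lambda>p. g (fst p) (snd p))"
    and sum: "(LINT p|(?C \<Otimes>\<^sub>M M). g (fst p) (snd p)) = (\<Sum>i\<in>UNIV. LINT z|M. g i z)"
    if g: "\<And>i. integrable M (g i)" for g :: "'i \<Rightarrow> 'z \<Rightarrow> complex"
  proof -
    show i: "integrable (?C \<Otimes>\<^sub>M M) (\<lambda>p. g (fst p) (snd p))"
    proof (rule Fubini_integrable)
      show "(\<lambda>p. g (fst p) (snd p)) \<in> borel_measurable (?C \<Otimes>\<^sub>M M)"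
        by (rule measurable_pair_measure_countable1) (simp_all add: countable_finite borel_measurable_integrable[OF g])
    qed (simp_all add: integrable_count_space g)
    from integral_fst'[OF i] show "(LINT p|(?C \<Otimes>\<^sub>M M). g (fst p) (snd p)) = (\<Sum>i\<in>UNIV. LINT z|M. g i z)"
      by (simp add: lebesgue_integral_count_space_finite)
  qed
  let ?T = "\<lambda>p. T (fst p) (snd p)"
  have Tm: "?T \<in> borel_measurable (?C \<Otimes>\<^sub>M M)"
    by (rule measurable_pair_measure_countable1) (simp_all add: countable_finite T)
  have "(LINT p:(?T -` B \<inter> space (?C \<Otimes>\<^sub>M M))|(?C \<Otimes>\<^sub>M M). h (fst p) (snd p)) = 0"
  proof (rule set_integral_test_functions_zero[OF Tm int[OF h] _ B])
    fix f :: "(real^3)^'n \<Rightarrow> real" and f' assume f: "test_function f f'"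
    from sum[of "\<lambda>i z. h i z * of_real (f (T i z))", OF test_function_comp_integrable[OF f T h]] zero[OF f]
    show "(LINT p|(?C \<Otimes>\<^sub>M M). h (fst p) (snd p) * of_real (f (?T p))) = 0" by simp
  qed
  moreover have "(LINT p:(?T -` B \<inter> space (?C \<Otimes>\<^sub>M M))|(?C \<Otimes>\<^sub>M M). h (fst p) (snd p))
      = (\<Sum>i\<in>UNIV. LINT z:(T i -` B \<inter> space M)|M. h i z)"
  proof -
    have "(LINT p:(?T -` B \<inter> space (?C \<Otimes>\<^sub>M M))|(?C \<Otimes>\<^sub>M M). h (fst p) (snd p)) =
      (LINT p|(?C \<Otimes>\<^sub>M M). indicator (T (fst p) -` B \<inter> space M) (snd p) *\<^sub>R h (fst p) (snd p))"
      unfolding set_lebesgue_integral_def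
      by (intro Bochner_Integration.integral_cong refl) (auto simp: indicator_def space_pair_measure)
    also have "\<dots> = (\<Sum>i\<in>UNIV. LINT z|M. indicator (T i -` B \<inter> space M) z *\<^sub>R h i z)"
      by (rule sum[of "\<lambda>i z. indicator (T i -` B \<inter> space M) z *\<^sub>R h i z"]) (intro integrable_mult_indicator h measurable_sets[OF T B])
    finally show ?thesis by (simp only: set_lebesgue_integral_def)
  qed
  ultimately show ?thesis by simp
qed

text \<open>Only symmetric test functions preserve antisymmetry. Summing over all permutations removes the
  restriction, because the Borel sets of interest are themselves symmetric.\<close>

lemma symmetric_set_integral_zero:
  fixes h :: "((real^3)^'n::finite) \<times> (bool^'n) \<Rightarrow> real"
  assumes h: "integrable conf h"
    and zero: "\<And>F F'. test_function F F' \<Longrightarrow> (\<And>\<pi> x. \<pi> permutes UNIV \<Longrightarrow> F (\<chi> i. x $ \<pi> i) = F x) \<Longrightarrow>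
      (LINT z|conf. complex_of_real (h z) * of_real (F (fst z))) = 0"
    and B: "B \<in> sets borel" and sym: "\<And>\<pi> x. \<pi> permutes UNIV \<Longrightarrow> (\<chi> i. x $ \<pi> i) \<in> B \<longleftrightarrow> x \<in> B"
  shows "(LINT z:{z. fst z \<in> B}|conf. h z) = 0"
proof -
  let ?T = "\<lambda>\<pi> z. (\<chi> i. fst z $ \<pi> i) :: (real^3)^'n"
  \<comment> \<open>The index type consists of all maps from particle labels to themselves; those
    that are not permutations contribute the zero function.\<close>
  let ?H = "\<lambda>\<pi> z. if \<pi> permutes (UNIV :: 'n set) then complex_of_real (h z) else 0"
  have hc: "integrable conf (\<lambda>z. complex_of_real (h z))" using h by simp
  have T: "?T \<pi> \<in> borel_measurable conf" for \<pi>
    by (rule measurable_compose[OF fst_measurable_conf permute_measurable])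
  have Z: "(\<Sum>\<pi>\<in>UNIV. LINT z:(?T \<pi> -` B \<inter> space conf)|conf. ?H \<pi> z) = 0"
  proof (rule set_integral_test_functions_zero_family[OF sigma_finite_conf T _ _ B])
    show "integrable conf (?H \<pi>)" for \<pi>
      using hc by (cases "\<pi> permutes (UNIV :: 'n set)") simp_all
    fix f :: "(real^3)^'n \<Rightarrow> real" and f' assume f: "test_function f f'"
    let ?F = "\<lambda>x. \<Sum>\<pi> | \<pi> permutes UNIV. f (\<chi> i. x $ \<pi> i)"
    obtain F' where F: "test_function ?F F'" using symmetrized_test_function(1)[OF f] by (elim exE)
    have "(\<Sum>\<pi>\<in>UNIV. LINT z|conf. ?H \<pi> z * of_real (f (?T \<pi> z))) =
        (\<Sum>\<pi> | \<pi> permutes (UNIV :: 'n set). LINT z|conf. complex_of_real (h z) * of_real (f (?T \<pi> z)))"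
      by (rule sum.mono_neutral_cong_right) auto
    also have "\<dots> = (LINT z|conf. (\<Sum>\<pi> | \<pi> permutes (UNIV :: 'n set). complex_of_real (h z) * of_real (f (?T \<pi> z))))"
      by (rule Bochner_Integration.integral_sum[symmetric]) (rule test_function_comp_integrable[OF f T hc])
    also have "\<dots> = (LINT z|conf. complex_of_real (h z) * of_real (?F (fst z)))"
      by (simp only: sum_distrib_left of_real_sum)
    also have "\<dots> = 0" by (rule zero[OF F symmetrized_test_function(2)[OF f]])
    finally show "(\<Sum>\<pi>\<in>UNIV. LINT z|conf. ?H \<pi> z * of_real (f (?T \<pi> z))) = 0" .
  qed
  have "(LINT z:(?T \<pi> -` B \<inter> space conf)|conf. ?H \<pi> z) = (if \<pi> permutes (UNIV :: 'n set) then of_real (LINT z:{z. fst z \<in> B}|conf. h z) else 0)" for \<pi>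
  proof (cases "\<pi> permutes (UNIV :: 'n set)")
    case True
    then have "?T \<pi> -` B \<inter> space conf = {z. fst z \<in> B}" using sym[OF True] by auto
    moreover have "r *\<^sub>R complex_of_real y = complex_of_real (r *\<^sub>R y)" for r y
      by (simp add: scaleR_conv_of_real)
    ultimately show ?thesis using True unfolding set_lebesgue_integral_def
      by (simp only: if_True integral_complex_of_real)
  qed (simp add: set_lebesgue_integral_def)
  with Z have "(\<Sum>\<pi>\<in>UNIV. if \<pi> permutes (UNIV :: 'n set) then complex_of_real (LINT z:{z. fst z \<in> B}|conf. h z) else 0) = 0"
    by (simp only:)
  then have "of_nat (card {\<pi>. \<pi> permutes (UNIV :: 'n set)}) * complex_of_real (LINT z:{z. fst z \<in> B}|conf. h z) = 0"
    by (simp add: sum.If_cases)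
  \<comment> \<open>Symmetry of \<open>B\<close> makes all contributions of permutations equal;
    their number, a factorial, can be cancelled.\<close>
  moreover have "card {\<pi>. \<pi> permutes (UNIV :: 'n set)} \<noteq> 0"
    using card_permutations[OF refl finite, of "UNIV :: 'n set"] by simp
  ultimately show ?thesis by simp
qed

text \<open>The function (w - \<gamma>) |\<psi>|^2 integrates to 0 over every symmetric Borel set.
  The sets where w > \<gamma> and where w < \<gamma> are symmetric, and on each of them this
  function has a fixed sign.\<close>

lemma localization:
  fixes \<psi> :: "'n::finite wf"
  assumes w: "w \<in> borel_measurable borel" and sym: "\<And>\<pi> x. \<pi> permutes UNIV \<Longrightarrow> w (\<chi> i. x $ \<pi> i) = w x"
    and psi: "\<psi> \<in> mult_dom w"
    and eq: "\<And>F F'. test_function F F' \<Longrightarrow> (\<And>\<pi> x. \<pi> permutes UNIV \<Longrightarrow> F (\<chi> i. x $ \<pi> i) = F x) \<Longrightarrow>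
      ip (mult F \<psi>) (mult w \<psi>) = of_real \<gamma> * ip (mult F \<psi>) \<psi>"
  shows "AE z in conf. \<psi> z \<noteq> 0 \<longrightarrow> w (fst z) = \<gamma>"
proof -
  note sq = hilb_sq_int[OF mult_dom_hilb[OF psi]]
  let ?h = "\<lambda>z. (w (fst z) - \<gamma>) * (cmod (\<psi> z))\<^sup>2"
  note [measurable] = fst_conf_measurable[OF w] sq_int_measurable[OF sq]
  have wint: "integrable conf (\<lambda>z. w (fst z) * (cmod (\<psi> z))\<^sup>2)"
  proof (rule Bochner_Integration.integrable_bound)
    show "integrable conf (\<lambda>z. \<bar>w (fst z)\<bar> * (cmod (\<psi> z))\<^sup>2)" using psi by (simp add: mult_dom_def)
    show "(\<lambda>z. w (fst z) * (cmod (\<psi> z))\<^sup>2) \<in> borel_measurable conf" by measurable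
  qed (simp add: abs_mult)
  have hint: "integrable conf ?h"
    using Bochner_Integration.integrable_diff[OF wint integrable_mult_right[OF sq_int_integrable[OF sq], of \<gamma>]]
    by (simp add: left_diff_distrib)
  have h0: "(LINT z|conf. complex_of_real (?h z) * of_real (F (fst z))) = 0"
    if F: "test_function F F'" and Fs: "\<And>\<pi> x. \<pi> permutes UNIV \<Longrightarrow> F (\<chi> i. x $ \<pi> i) = F x" for F F'
  proof -
    obtain B where fb: "\<forall>x. \<bar>F x\<bar> \<le> B" using test_function_bounded(1)[OF F] by (elim exE)
    note sF = mult_mult_dom[OF w test_function_measurable[OF F] fb[rule_format] Fs psi]
      and sF2 = mult_bounded_sq_int[OF test_function_measurable[OF F] fb[rule_format] sq]
    have "complex_of_real (?h z) * of_real (F (fst z)) = cnj (mult F \<psi> z) * mult w \<psi> z - of_real \<gamma> * (cnj (mult F \<psi> z) * \<psi> z)" for z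
    proof -
      have "cnj (mult F \<psi> z) * mult w \<psi> z - of_real \<gamma> * (cnj (mult F \<psi> z) * \<psi> z)
        = of_real (w (fst z) - \<gamma>) * (cnj (\<psi> z) * \<psi> z) * of_real (F (fst z))"
        by (simp add: mult_def algebra_simps)
      also have "\<dots> = complex_of_real (?h z) * of_real (F (fst z))"
        unfolding cnj_mult_self by (simp only: of_real_mult)
      finally show ?thesis by (rule HOL.sym)
    qed
    then have "(LINT z|conf. complex_of_real (?h z) * of_real (F (fst z))) =
        (LINT z|conf. cnj (mult F \<psi> z) * mult w \<psi> z - of_real \<gamma> * (cnj (mult F \<psi> z) * \<psi> z))"
      by (intro Bochner_Integration.integral_cong refl)
    also have "\<dots> = (LINT z|conf. cnj (mult F \<psi> z) * mult w \<psi> z - cnj (mult F \<psi> z) * (of_real \<gamma> * \<psi> z))"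
      by (simp only: mult.left_commute)
    also have "\<dots> = ip (mult F \<psi>) (mult w \<psi>) - ip (mult F \<psi>) (\<lambda>z. of_real \<gamma> * \<psi> z)"
      unfolding ip_def
      by (rule Bochner_Integration.integral_diff[OF mult_dom_integrable[OF w sF psi] ip_integrable[OF sF2 sq_int_scale[OF sq]]])
    also have "\<dots> = ip (mult F \<psi>) (mult w \<psi>) - of_real \<gamma> * ip (mult F \<psi>) \<psi>"
      by (simp only: ip_scale)
    finally show ?thesis using eq[OF F Fs] by simp
  qed
  \<comment> \<open>The factor \<open>c\<close> is 1 or -1 and carries the sign of w - \<gamma> on
    \<open>B\<close>, so that both level sets are handled at once.\<close>
  have zero: "AE z in conf. indicator {z. fst z \<in> B} z *\<^sub>R ?h z = 0"
    if B: "B \<in> sets borel" and Bsym: "\<And>\<pi> x. \<pi> permutes UNIV \<Longrightarrow> (\<chi> i. x $ \<pi> i) \<in> B \<longleftrightarrow> x \<in> B"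
      and c: "c \<noteq> 0" and sgn: "\<And>x. x \<in> B \<Longrightarrow> 0 \<le> c * (w x - \<gamma>)" for B and c :: real
  proof -
    have Bm: "{z. fst z \<in> B} \<in> sets conf"
      using measurable_sets[OF fst_measurable_conf B] by (simp add: vimage_def)
    have int: "integrable conf (\<lambda>z. c * (indicator {z. fst z \<in> B} z *\<^sub>R ?h z))"
      by (intro integrable_mult_right integrable_mult_indicator Bm hint)
    have z0: "(LINT z|conf. c * (indicator {z. fst z \<in> B} z *\<^sub>R ?h z)) = 0"
      using symmetric_set_integral_zero[OF hint h0 B Bsym] unfolding set_lebesgue_integral_def by simp
    have nn: "0 \<le> c * (indicator {z. fst z \<in> B} z *\<^sub>R ?h z)" for z
    proof (cases "fst z \<in> B")
      case True
      have "0 \<le> c * (w (fst z) - \<gamma>) * (cmod (\<psi> z))\<^sup>2" by (rule mult_nonneg_nonneg[OF sgn[OF True]]) simp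
      then show ?thesis using True by (simp add: mult.assoc)
    qed simp
    have "AE z in conf. c * (indicator {z. fst z \<in> B} z *\<^sub>R ?h z) = 0"
      using integral_nonneg_eq_0_iff_AE[OF int] nn z0 by simp
    then show ?thesis by eventually_elim (use c in simp)
  qed
  have Bs: "{x. w x > \<gamma>} \<in> sets borel" "{x. w x < \<gamma>} \<in> sets borel"
    using w by measurable
  have "AE z in conf. indicator {z. fst z \<in> {x. w x > \<gamma>}} z *\<^sub>R ?h z = 0"
    by (rule zero[OF Bs(1), where c = 1]) (simp_all add: sym)
  moreover have "AE z in conf. indicator {z. fst z \<in> {x. w x < \<gamma>}} z *\<^sub>R ?h z = 0"
    by (rule zero[OF Bs(2), where c = "-1"]) (simp_all add: sym)
  ultimately show ?thesis
  proof eventually_elim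
    fix z assume 1: "indicator {z. fst z \<in> {x. w x > \<gamma>}} z *\<^sub>R ?h z = 0" "indicator {z. fst z \<in> {x. w x < \<gamma>}} z *\<^sub>R ?h z = 0"
    show "\<psi> z \<noteq> 0 \<longrightarrow> w (fst z) = \<gamma>"
      by (rule linorder_cases[of "w (fst z)" \<gamma>]) (use 1 in \<open>auto simp: indicator_def\<close>)
  qed
qed

subsection \<open>Null sets of configurations\<close>

lemma AE_not_in_negligible:
  fixes S :: "'a::euclidean_space set"
  assumes "S \<in> sets borel" "negligible S" shows "AE x in lborel. x \<notin> S"
proof -
  have "S \<in> null_sets lebesgue" using assms(2) by (simp add: negligible_iff_null_sets)
  then have "S \<in> null_sets lborel" using assms(1) by (subst null_sets_completion_iff[symmetric]) simp_all
  then show ?thesis by (rule AE_not_in)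
qed

lemma AE_norm_neq: "AE x in lborel. norm (x :: 'a::euclidean_space) \<noteq> r"
proof -
  have "negligible (sphere (0::'a) r)"
    using negligible_convex_frontier[OF convex_cball, of "0::'a" r] by (simp add: frontier_cball)
  then have "AE x in lborel. x \<notin> sphere (0::'a) r" by (intro AE_not_in_negligible) simp_all
  then show ?thesis by eventually_elim simp
qed

lemma AE_conf_fstI:
  assumes ae: "AE x in lborel. P x" and P: "{x. P x} \<in> sets borel"
  shows "AE z in conf. P (fst z)"
proof (rule AE_confI)
  have "{z. fst z \<in> {x. P x}} \<in> sets conf"
    using measurable_sets[OF fst_measurable_conf P] by (simp add: vimage_def)
  then show "Measurable.pred conf (\<lambda>z. P (fst z))" by (simp add: pred_def)
  show "AE x in lborel. P (fst (x, s))" for s using ae by simp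
qed

section \<open>Null sets of one-particle positions\<close>

lemma mem_box_vec: "x \<in> box L U \<longleftrightarrow> (\<forall>j. x $ j \<in> box (L $ j) (U $ j))" for x :: "('a::euclidean_space)^'n::finite"
  by (auto simp: mem_box Basis_vec_def inner_axis)

lemma One_inner_Basis: "One \<bullet> b = 1" if "b \<in> Basis" for b :: "'a::euclidean_space"
proof -
  have "One \<bullet> b = (\<Sum>i\<in>Basis. if i = b then 1 else 0)"
    unfolding inner_sum_left by (intro sum.cong refl) (simp add: inner_Basis that)
  then show ?thesis using that by simp
qed

lemma prod_Basis_vec:
  fixes w :: "('a::euclidean_space)^'n::finite"
  shows "(\<Prod>b\<in>Basis. w \<bullet> b) = (\<Prod>j\<in>UNIV. \<Prod>b\<in>Basis. (w $ j) \<bullet> b)"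
proof -
  have B: "(Basis :: ('a^'n) set) = (\<lambda>(j, b). axis j b) ` (UNIV \<times> Basis)"
    by (auto simp: Basis_vec_def)
  have inj: "inj_on (\<lambda>(j, b). axis j b :: 'a^'n) (UNIV \<times> Basis)"
  proof (rule inj_onI, clarify)
    fix j j' :: 'n and b b' :: 'a assume b: "b \<in> Basis" "b' \<in> Basis" and eq: "axis j b = (axis j' b' :: 'a^'n)"
    have "b \<noteq> 0" using b by auto
    then have j: "j = j'" using arg_cong[OF eq, of "\<lambda>x. x $ j"] by (auto simp: axis_def split: if_splits)
    then show "j = j' \<and> b = b'" using arg_cong[OF eq, of "\<lambda>x. x $ j"] by (simp add: axis_def)
  qed
  show ?thesis
    unfolding B prod.reindex[OF inj] prod.cartesian_product
    by (intro prod.cong refl) (auto simp: inner_axis)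
qed

text \<open>Lebesgue measure on one-particle space is the image, under the i-th position, of
  configuration space restricted to the cylinder \<open>?S\<close> where every other particle lies
  in a unit cube. Comparing the volumes of boxes proves this, and null sets then descend.\<close>

lemma AE_component:
  fixes P :: "real^3 \<Rightarrow> bool" and i :: "'n::finite"
  assumes P: "{y. P y} \<in> sets borel" and ae: "AE x :: (real^3)^'n in lborel. P (x $ i)"
  shows "AE y in lborel. P y"
proof -
  let ?S = "\<Inter>j\<in>UNIV - {i}. (\<lambda>x :: (real^3)^'n. x $ j) -` box 0 One"
  have S: "?S \<in> sets borel"
  proof (cases "UNIV - {i} = {}")
    case False
    have "(\<lambda>x :: (real^3)^'n. x $ j) -` box 0 One \<in> sets borel" for j
      using measurable_sets[OF vec_nth_measurable, of "box 0 One" j] by simp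
    then show ?thesis using False by (intro sets.finite_INT) auto
  next
    case True
    show ?thesis unfolding True by simp
  qed
  let ?M = "distr (density lborel (indicator ?S)) borel (\<lambda>x :: (real^3)^'n. x $ i)"
  have M: "lborel = ?M"
  proof (rule lborel_eqI)
    fix l u :: "real^3" assume le: "\<And>b. b \<in> Basis \<Longrightarrow> l \<bullet> b \<le> u \<bullet> b"
    let ?L = "(\<chi> j. if j = i then l else 0) :: (real^3)^'n" and ?U = "(\<chi> j. if j = i then u else One) :: (real^3)^'n"
    have X: "(\<lambda>x :: (real^3)^'n. x $ i) -` box l u \<in> sets lborel"
      using measurable_sets[OF vec_nth_measurable, of "box l u" i] by simp
    have "emeasure ?M (box l u) = emeasure (density lborel (indicator ?S)) ((\<lambda>x :: (real^3)^'n. x $ i) -` box l u)"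
      by (subst emeasure_distr) (simp_all add: vec_nth_measurable)
    also have "\<dots> = emeasure lborel (?S \<inter> (\<lambda>x :: (real^3)^'n. x $ i) -` box l u)"
      by (rule emeasure_restricted[OF _ X]) (use S in simp)
    also have "?S \<inter> (\<lambda>x :: (real^3)^'n. x $ i) -` box l u = box ?L ?U"
      by (auto simp: mem_box_vec set_eq_iff split: if_splits)
    also have "emeasure lborel (box ?L ?U) = (\<Prod>b\<in>Basis. (?U - ?L) \<bullet> b)"
    proof (rule emeasure_lborel_box)
      fix b :: "(real^3)^'n" assume "b \<in> Basis"
      then obtain j c where b: "b = axis j c" "c \<in> Basis" by (auto simp: Basis_vec_def)
      show "?L \<bullet> b \<le> ?U \<bullet> b" using le[OF b(2)] One_inner_Basis[OF b(2)]
        by (cases "j = i") (simp_all add: b(1) inner_axis)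
    qed
    also have "(\<Prod>b\<in>Basis. (?U - ?L) \<bullet> b) = (\<Prod>j\<in>UNIV. if j = i then (\<Prod>b\<in>Basis. (u - l) \<bullet> b) else 1)"
      unfolding prod_Basis_vec[of "?U - ?L"]
    proof (intro prod.cong refl)
      fix j
      show "(\<Prod>b\<in>Basis. (?U - ?L) $ j \<bullet> b) = (if j = i then (\<Prod>b\<in>Basis. (u - l) \<bullet> b) else 1)"
      proof (rule case_split[of "j = i"])
        assume "j \<noteq> i"
        then have "(?U - ?L) $ j = One" and "(if j = i then (\<Prod>b\<in>Basis. (u - l) \<bullet> b) else 1) = 1" by simp_all
        then show ?thesis by (simp only:) (intro prod.neutral ballI One_inner_Basis)
      qed simp
    qed
    also have "\<dots> = (\<Prod>b\<in>Basis. (u - l) \<bullet> b)" by (rule trans[OF prod.delta[OF finite]]) simp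
    finally show "emeasure ?M (box l u) = (\<Prod>b\<in>Basis. (u - l) \<bullet> b)" .
  qed simp
  have "AE y in ?M. P y"
  proof (subst AE_distr_iff)
    show "(\<lambda>x. x $ i) \<in> borel_measurable (density lborel (indicator ?S))" using vec_nth_measurable by simp
    show "{y \<in> space borel. P y} \<in> sets borel" using P by simp
    show "AE x in density lborel (indicator ?S). P (x $ i)"
      using S ae by (subst AE_density) (auto elim: eventually_mono)
  qed
  then show ?thesis unfolding M[symmetric] .
qed

section \<open>Constancy from translation invariance\<close>

lemma AE_lborel_translate:
  fixes t :: "'a::euclidean_space"
  assumes "{x. P x} \<in> sets borel" "AE x in lborel. P x" shows "AE x in lborel. P (t + x)"
proof -
  have "AE x in distr lborel borel ((+) t). P x" unfolding lborel_distr_plus by (rule assms(2))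
  then show ?thesis by (subst (asm) AE_distr_iff) (use assms(1) in simp_all)
qed

text \<open>The exceptional null set depends on the shift \<open>t\<close>. Fubini exchanges the
  quantifiers, which provides one point y with \<alpha> (y + t) = \<alpha> y for almost all t; the
  value at this point is the constant.\<close>

lemma translation_invariant_const:
  fixes \<alpha> :: "real^3 \<Rightarrow> real"
  assumes [measurable]: "\<alpha> \<in> borel_measurable borel" and inv: "\<And>t. AE y in lborel. \<alpha> (y + t) = \<alpha> y"
  shows "\<exists>c. AE y in lborel. \<alpha> y = c"
proof -
  have "{p \<in> space (lborel \<Otimes>\<^sub>M lborel). \<alpha> (snd p + fst p) = \<alpha> (snd p)} \<in> sets (lborel \<Otimes>\<^sub>M lborel)"
    by measurable
  from lborel_pair.AE_commute[OF this] have "AE y in lborel. AE t in lborel. \<alpha> (y + t) = \<alpha> y" using inv by simp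
  moreover have "ae_filter (lborel :: (real^3) measure) \<noteq> bot" by (simp add: ae_filter_eq_bot_iff)
  ultimately obtain y where y: "AE t in lborel. \<alpha> (y + t) = \<alpha> y" using eventually_happens' by blast
  have "AE t in lborel. \<alpha> (y + (- y + t)) = \<alpha> y" by (rule AE_lborel_translate[OF _ y]) measurable
  then show ?thesis by (intro exI) simp
qed

text \<open>Moving one particle by \<open>t\<close> and leaving the others fixed changes the sum by
  \<alpha> (x $ i + t) - \<alpha> (x $ i), which must therefore vanish almost everywhere.\<close>

lemma one_body_const:
  assumes a: "\<alpha> \<in> borel_measurable borel" and ae: "AE x :: (real^3)^'n::finite in lborel. one_body \<alpha> x = \<kappa>"
  shows "\<exists>c. AE y in lborel. \<alpha> y = c"
proof (rule translation_invariant_const[OF a])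
  fix t :: "real^3"
  obtain i :: 'n where True by blast
  have m: "{x :: (real^3)^'n. one_body \<alpha> x = \<kappa>} \<in> sets borel"
    using one_body_measurable[OF a] by measurable
  have "AE x :: (real^3)^'n in lborel. \<alpha> (x $ i + t) = \<alpha> (x $ i)"
    using AE_lborel_translate[OF m ae, of "axis i t"] ae
  proof eventually_elim
    fix x :: "(real^3)^'n" assume x: "one_body \<alpha> (axis i t + x) = \<kappa>" "one_body \<alpha> x = \<kappa>"
    have "(\<Sum>j\<in>UNIV - {i}. \<alpha> ((axis i t + x) $ j)) = (\<Sum>j\<in>UNIV - {i}. \<alpha> (x $ j))"
      by (intro sum.cong refl) (simp add: axis_def)
    then have "one_body \<alpha> (axis i t + x) - one_body \<alpha> x = \<alpha> (t + x $ i) - \<alpha> (x $ i)"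
      unfolding one_body_def sum.remove[OF finite UNIV_I, of _ i] by simp
    then show "\<alpha> (x $ i + t) = \<alpha> (x $ i)" using x by (simp add: add.commute)
  qed
  moreover have "{y. \<alpha> (y + t) = \<alpha> y} \<in> sets borel" using a by measurable
  ultimately show "AE y in lborel. \<alpha> (y + t) = \<alpha> y"
    by (intro AE_component[where P = "\<lambda>y. \<alpha> (y + t) = \<alpha> y" and i = i])
qed

subsection \<open>An eigenspace cannot be localized\<close>

text \<open>Gaussian elimination with fewer equations than unknowns: the equation \<open>j0\<close>
  is solved for one unknown \<open>i0\<close> and substituted into the others.\<close>

lemma homogeneous_system_solution:
  fixes a :: "'j \<Rightarrow> 'i \<Rightarrow> 'a::field"
  assumes "finite J" "finite I" "card J < card I"
  shows "\<exists>x. (\<exists>i\<in>I. x i \<noteq> 0) \<and> (\<forall>j\<in>J. (\<Sum>i\<in>I. x i * a j i) = 0)"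
  using assms
proof (induction J arbitrary: I a rule: finite_induct)
  case empty
  then have "I \<noteq> {}" by auto
  then show ?case by (intro exI[of _ "\<lambda>_. 1"]) auto
next
  case (insert j0 J)
  show ?case
  proof (cases "\<forall>i\<in>I. a j0 i = 0")
    case True
    have "card J < card I" using insert by simp
    from insert.IH[OF insert.prems(1) this, of a] obtain x
      where "\<exists>i\<in>I. x i \<noteq> 0" "\<forall>j\<in>J. (\<Sum>i\<in>I. x i * a j i) = 0" by (elim exE conjE)
    moreover have "(\<Sum>i\<in>I. x i * a j0 i) = 0" using True by (intro sum.neutral) simp
    ultimately show ?thesis by (intro exI[of _ x]) simp
  next
    case False
    then obtain i0 where i0: "i0 \<in> I" "a j0 i0 \<noteq> 0" by auto
    have "card J < card (I - {i0})" using insert i0 by simp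
    from insert.IH[OF finite_Diff[OF insert.prems(1)] this, of "\<lambda>j i. a j i - a j i0 * a j0 i / a j0 i0"] obtain x
      where nz: "\<exists>i\<in>I - {i0}. x i \<noteq> 0"
        and eq: "\<forall>j\<in>J. (\<Sum>i\<in>I - {i0}. x i * (a j i - a j i0 * a j0 i / a j0 i0)) = 0" by (elim exE conjE)
    define s where "s = (\<Sum>i\<in>I - {i0}. x i * a j0 i)"
    \<comment> \<open>Back substitution: the value at \<open>i0\<close> is forced by the equation
      \<open>j0\<close>, and the sum over the remaining unknowns is abbreviated by
      \<open>s\<close>.\<close>
    define y where "y = x(i0 := - s / a j0 i0)"
    have sum: "(\<Sum>i\<in>I. y i * a j i) = - s / a j0 i0 * a j i0 + (\<Sum>i\<in>I - {i0}. x i * a j i)" for j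
    proof -
      have "(\<Sum>i\<in>I - {i0}. y i * a j i) = (\<Sum>i\<in>I - {i0}. x i * a j i)"
        by (intro sum.cong refl) (simp add: y_def)
      then show ?thesis using sum.remove[OF insert.prems(1) i0(1), of "\<lambda>i. y i * a j i"] by (simp add: y_def)
    qed
    have "(\<Sum>i\<in>I. y i * a j0 i) = 0" unfolding sum s_def[symmetric] using i0(2) by simp
    moreover have "(\<Sum>i\<in>I. y i * a j i) = 0" if "j \<in> J" for j
    proof -
      have "(\<Sum>i\<in>I - {i0}. x i * (a j i - a j i0 * a j0 i / a j0 i0)) =
          (\<Sum>i\<in>I - {i0}. x i * a j i - a j i0 / a j0 i0 * (x i * a j0 i))"
        by (intro sum.cong refl) (simp add: algebra_simps)
      also have "\<dots> = (\<Sum>i\<in>I - {i0}. x i * a j i) - a j i0 / a j0 i0 * s"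
        by (simp add: sum_subtractf sum_distrib_left s_def)
      finally have "(\<Sum>i\<in>I - {i0}. x i * a j i) - a j i0 / a j0 i0 * s = 0"
        using eq[rule_format, OF that] by (simp only:)
      then show ?thesis unfolding sum by (simp add: mult.commute)
    qed
    moreover have "\<exists>i\<in>I. y i \<noteq> 0" using nz by (auto simp: y_def)
    ultimately show ?thesis by (intro exI[of _ y]) simp
  qed
qed

text \<open>Otherwise the functions \<open>g\<^sup>i b j\<^sub>0\<close> with \<open>g x = 1 / (1 + \<bar>x\<bar>)\<close> would all lie in a finite-dimensional
  space, and some nontrivial polynomial in \<open>g\<close> would vanish where \<open>b j\<^sub>0\<close> does not.\<close>

lemma finitely_many_overlaps_impossible:
  fixes b :: "nat \<Rightarrow> 'n::finite wf"
  assumes b: "onb b" and J: "finite J"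
    and disj: "\<And>k. k \<notin> J \<Longrightarrow> AE z in conf. cnj (b k z) * b j0 z = 0"
  shows False
proof -
  \<comment> \<open>Powers of \<open>g\<close> are bounded, so products stay in the Hilbert space,
    and they depend on |x| only, so that antisymmetry survives. A value of \<open>g\<close> fixes
    |x|, hence each value is attained on a null set.\<close>
  define g where "g x = 1 / (1 + norm x)" for x :: "(real^3)^'n"
  let ?u = "\<lambda>i. mult (\<lambda>x. g x ^ i) (b j0)"
  have g_meas: "(\<lambda>x. g x ^ i) \<in> borel_measurable borel" for i unfolding g_def by measurable
  have g_bd: "\<bar>g x ^ i\<bar> \<le> 1" for i x
  proof -
    have "1 / (1 + norm x) \<le> 1 / 1" by (rule divide_left_mono) (auto simp: add_pos_nonneg)
    then have "0 \<le> g x" "g x \<le> 1" by (simp_all add: g_def)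
    then show ?thesis by (simp add: power_le_one)
  qed
  have u: "?u i \<in> hilb" for i
    by (rule mult_bounded_hilb[OF g_meas g_bd _ onb_hilb[OF b]]) (simp add: g_def norm_permute)
  let ?n = "card J"
  \<comment> \<open>The powers 0 to \<open>?n\<close> give one unknown more than there are
    conditions, so some nontrivial combination is orthogonal to all \<open>b k\<close> with
    \<open>k\<close> in \<open>J\<close>. Disjoint supports make it orthogonal to the
    others.\<close>
  have "card J < card {..?n}" by simp
  from homogeneous_system_solution[OF J finite_atMost this, of "\<lambda>k i. ip (b k) (?u i)"] obtain x
    where nz: "\<exists>i\<in>{..?n}. x i \<noteq> 0" and sys: "\<forall>k\<in>J. (\<Sum>i\<le>?n. x i * ip (b k) (?u i)) = 0" by (elim exE conjE)
  let ?\<phi> = "\<lambda>z. \<Sum>i\<le>?n. x i * ?u i z"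
  have phi: "?\<phi> \<in> hilb" by (rule hilb_sum[OF finite_atMost u])
  have "ip (b k) ?\<phi> = 0" for k
  proof -
    have "ip (b k) ?\<phi> = (\<Sum>i\<le>?n. x i * ip (b k) (?u i))" by (rule ip_sum[OF finite_atMost onb_hilb[OF b] u])
    also have "\<dots> = 0"
    proof (cases "k \<in> J")
      case False
      have "ip (b k) (?u i) = 0" for i
        unfolding ip_def
      proof (rule integral_eq_zero_AE)
        show "AE z in conf. cnj (b k z) * ?u i z = 0"
          using disj[OF False] by eventually_elim (auto simp: mult_def)
      qed
      then show ?thesis by simp
    qed (use sys in simp)
    finally show ?thesis .
  qed
  then have "wf_eq ?\<phi> (\<lambda>z. 0)" by (intro onb_eqI[OF b phi hilb_zero]) simp
  \<comment> \<open>At a root t = g x the norm of x equals 1 / t - 1. The finitely many roots thus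
    confine x to finitely many spheres; the real part only serves to include complex roots in the
    same formula.\<close>
  let ?R = "{t. (\<Sum>i\<le>?n. x i * t ^ i) = 0}"
  have R: "finite ?R" using nz by (subst polyfun_finite_roots) auto
  have "AE z in conf. \<forall>t\<in>?R. norm (fst z) \<noteq> Re (1 / t) - 1"
    by (rule AE_finite_allI[OF R], rule AE_conf_fstI[OF AE_norm_neq]) measurable
  with \<open>wf_eq ?\<phi> (\<lambda>z. 0)\<close> have "wf_eq (b j0) (\<lambda>z. 0)"
    unfolding wf_eq_def
  proof eventually_elim
    fix z assume 1: "(\<Sum>i\<le>?n. x i * ?u i z) = 0" and 2: "\<forall>t\<in>?R. norm (fst z) \<noteq> Re (1 / t) - 1"
    let ?t = "complex_of_real (g (fst z))"
    have "(\<Sum>i\<le>?n. x i * ?u i z) = (\<Sum>i\<le>?n. x i * ?t ^ i) * b j0 z"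
      by (simp add: mult_def sum_distrib_right mult.assoc)
    moreover have "?t \<notin> ?R"
    proof
      assume "?t \<in> ?R"
      with 2 have "norm (fst z) \<noteq> Re (1 / ?t) - 1" by blast
      moreover have "1 / ?t = complex_of_real (1 + norm (fst z))" by (simp add: g_def)
      ultimately show False by (simp only: Re_complex_of_real)
    qed
    ultimately show "b j0 z = 0" using 1 by simp
  qed
  then have "ip (b j0) (b j0) = 0" using ip_self_zero_iff[OF onb_sq_int[OF b]] by simp
  then show False by (simp add: onb_ip[OF b])
qed

subsection \<open>Antisymmetric functions without zeros\<close>

text \<open>A vector in the kernel would consist of the coefficients of a nonzero polynomial of
  degree at most N - 1 with N distinct roots. The bijection \<open>e\<close> turns particle labels
  into exponents.\<close>

lemma vandermonde_det_nonzero: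
  fixes y :: "'n::finite \<Rightarrow> real" and e :: "'n \<Rightarrow> nat"
  assumes y: "inj y" and e: "bij_betw e UNIV {..<CARD('n)}"
  shows "det (\<chi> i j. y i ^ e j) \<noteq> 0"
proof
  let ?V = "(\<chi> i j. y i ^ e j) :: real^'n^'n" and ?m = "CARD('n) - 1"
  assume "det ?V = 0"
  then have "\<not> (\<exists>B. B ** ?V = mat 1)" using invertible_det_nz[of ?V] invertible_left_inverse[of ?V] by blast
  then obtain c where c: "?V *v c = 0" "c \<noteq> 0" unfolding matrix_left_invertible_ker by blast
  then obtain j where j: "c $ j \<noteq> 0" by (auto simp: vec_eq_iff)
  define c' where "c' k = c $ (inv_into UNIV e k)" for k
  have inj: "inj e" using e by (simp add: bij_betw_def)
  have c'e: "c' (e k) = c $ k" for k unfolding c'_def by (simp add: inv_f_f[OF inj])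
  have m: "Suc ?m = CARD('n)" using zero_less_card_finite[where 'a='n] by linarith
  have "{..<CARD('n)} = {..?m}" by (simp only: lessThan_Suc_atMost[symmetric] m)
  then have poly: "(\<Sum>k\<le>?m. c' k * t ^ k) = (\<Sum>k\<in>UNIV. c $ k * t ^ e k)" for t
    using sum.reindex_bij_betw[OF e, of "\<lambda>k. c' k * t ^ k"] by (simp add: c'e)
  have "e j \<in> {..<CARD('n)}" using e unfolding bij_betw_def by blast
  then have "e j \<le> ?m" using m by simp
  moreover have "c' (e j) \<noteq> 0" using j by (simp add: c'e)
  ultimately have "\<exists>k\<le>?m. c' k \<noteq> 0" by (intro exI conjI)
  from polyfun_rootbound[OF this]
  have fin: "finite {t. (\<Sum>k\<le>?m. c' k * t ^ k) = 0}" "card {t. (\<Sum>k\<le>?m. c' k * t ^ k) = 0} \<le> ?m"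
    by simp_all
  have "(\<Sum>k\<in>UNIV. c $ k * y i ^ e k) = 0" for i
    using arg_cong[OF c(1), of "\<lambda>x. x $ i"] by (simp add: matrix_vector_mult_def mult.commute)
  then have "range y \<subseteq> {t. (\<Sum>k\<le>?m. c' k * t ^ k) = 0}" unfolding poly by auto
  from card_mono[OF fin(1) this] fin(2) have "card (range y) \<le> ?m" by linarith
  with card_image[OF y] m show False by linarith
qed

text \<open>The witness is the Vandermonde determinant in the first coordinates of the positions.
  Permuting particles permutes its rows, and it vanishes only if two first coordinates coincide,
  which confines x to finitely many hyperplanes.\<close>

lemma ex_antisymmetric_nonzero:
  "\<exists>d :: (real^3)^'n::finite \<Rightarrow> real. d \<in> borel_measurable borel \<and>
     (\<forall>\<pi> x. \<pi> permutes UNIV \<longrightarrow> d (\<chi> i. x $ \<pi> i) = of_int (sign \<pi>) * d x) \<and>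
     (AE x in lborel. d x \<noteq> 0)"
proof -
  obtain e :: "'n \<Rightarrow> nat" where e: "bij_betw e UNIV {..<CARD('n)}"
    using ex_bij_betw_finite_nat[of "UNIV :: 'n set"] by (auto simp: atLeast0LessThan)
  define d where "d x = det (\<chi> i j. (x $ i $ 1) ^ e j)" for x :: "(real^3)^'n"
  have "continuous_on UNIV (\<lambda>x :: (real^3)^'n. d x)"
    unfolding d_def det_def by (intro continuous_intros)
  then have 1: "d \<in> borel_measurable borel" by (rule borel_measurable_continuous_onI)
  have 2: "d (\<chi> i. x $ \<pi> i) = of_int (sign \<pi>) * d x" if "\<pi> permutes UNIV" for \<pi> x
    using det_permute_rows[OF that, of "\<chi> i j. (x $ i $ 1) ^ e j"] by (simp add: d_def)
  have "AE x :: (real^3)^'n in lborel. x $ i $ 1 \<noteq> x $ j $ 1" if ij: "i \<noteq> j" for i j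
  proof -
    let ?a = "axis i (axis 1 1) - axis j (axis 1 1) :: (real^3)^'n"
    have a: "?a \<bullet> x = x $ i $ 1 - x $ j $ 1" for x
      by (simp add: inner_diff_left inner_commute[of "axis _ _"] inner_axis)
    have "?a \<noteq> 0"
    proof
      assume "?a = 0"
      from arg_cong[OF this, of "\<lambda>x. x $ i $ 1"] show False using ij by (simp add: axis_def)
    qed
    then have "negligible {x. ?a \<bullet> x = 0}" by (intro negligible_hyperplane) simp
    then have "AE x in lborel. x \<notin> {x. ?a \<bullet> x = 0}" by (intro AE_not_in_negligible) measurable
    then show ?thesis by eventually_elim (simp add: a)
  qed
  then have "AE x :: (real^3)^'n in lborel. \<forall>p\<in>{p. fst p \<noteq> snd p}. x $ fst p $ 1 \<noteq> x $ snd p $ 1"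
    by (intro AE_finite_allI) simp_all
  then have 3: "AE x in lborel. d x \<noteq> 0"
  proof eventually_elim
    fix x :: "(real^3)^'n" assume x: "\<forall>p\<in>{p. fst p \<noteq> snd p}. x $ fst p $ 1 \<noteq> x $ snd p $ 1"
    have "inj (\<lambda>i. x $ i $ 1)"
    proof (rule injI, rule ccontr)
      fix i j assume "x $ i $ 1 = x $ j $ 1" "i \<noteq> j"
      then show False using x[rule_format, of "(i, j)"] by simp
    qed
    from vandermonde_det_nonzero[OF this e] show "d x \<noteq> 0" by (simp add: d_def)
  qed
  show ?thesis using 1 2 3 by (intro exI conjI allI impI)
qed

lemma indicator_cball_integrable_conf:
  "integrable (conf :: (((real^3)^'n::finite) \<times> (bool^'n)) measure) (\<lambda>z. indicator (cball 0 R) (fst z) :: real)"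
proof -
  interpret C: sigma_finite_measure "count_space UNIV :: (bool^'n) measure"
    by (simp add: sigma_finite_measure_count_space_finite)
  have "emeasure conf (cball (0 :: (real^3)^'n) R \<times> (UNIV :: (bool^'n) set)) =
      emeasure lborel (cball (0 :: (real^3)^'n) R) * emeasure (count_space UNIV) (UNIV :: (bool^'n) set)"
    unfolding conf_def by (rule C.emeasure_pair_measure_Times) simp_all
  also have "emeasure (count_space UNIV) (UNIV :: (bool^'n) set) = of_nat (card (UNIV :: (bool^'n) set))"
    by (rule emeasure_count_space_finite) simp_all
  also have "emeasure lborel (cball (0 :: (real^3)^'n) R) * of_nat (card (UNIV :: (bool^'n) set)) < \<infinity>"
    using emeasure_lborel_cball_finite[of "0 :: (real^3)^'n" R]
    by (simp only: ennreal_mult_less_top of_nat_less_top infinity_ennreal_def simp_thms)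
  finally have fin: "emeasure conf (cball (0 :: (real^3)^'n) R \<times> (UNIV :: (bool^'n) set)) < \<infinity>" .
  have "cball (0 :: (real^3)^'n) R \<times> (UNIV :: (bool^'n) set) \<in> sets conf"
    unfolding conf_def by (intro pair_measureI) simp_all
  from integrable_real_indicator[OF this fin]
  have "integrable conf (indicator (cball (0 :: (real^3)^'n) R \<times> (UNIV :: (bool^'n) set)) :: _ \<Rightarrow> real)" .
  moreover have "indicator (cball 0 R \<times> UNIV) = (\<lambda>z :: ((real^3)^'n) \<times> (bool^'n). indicator (cball 0 R) (fst z) :: real)"
    by (auto simp: indicator_def fun_eq_iff)
  ultimately show ?thesis by simp
qed

text \<open>If \<open>d\<close> is antisymmetric, then so is \<open>sgn d\<close> times the indicator of a bounded part of \<open>S\<close>. This is a vector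
  orthogonal to the basis.\<close>

lemma symmetric_set_null:
  fixes b :: "nat \<Rightarrow> 'n::finite wf"
  assumes b: "onb b" and S: "S \<in> sets borel" and sym: "\<And>\<pi> x. \<pi> permutes UNIV \<Longrightarrow> (\<chi> i. x $ \<pi> i) \<in> S \<longleftrightarrow> x \<in> S"
    and zero: "\<And>k. AE z in conf. fst z \<in> S \<longrightarrow> b k z = 0"
  shows "AE x in lborel. x \<notin> S"
proof -
  obtain d :: "(real^3)^'n \<Rightarrow> real" where d1: "d \<in> borel_measurable borel"
    and d2: "\<forall>\<pi> x. \<pi> permutes UNIV \<longrightarrow> d (\<chi> i. x $ \<pi> i) = of_int (sign \<pi>) * d x"
    and dnz: "AE x in lborel. d x \<noteq> 0"
    using ex_antisymmetric_nonzero by (elim exE conjE)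
  have R: "AE x in lborel. norm x \<le> real R \<longrightarrow> x \<notin> S" for R :: nat
  proof -
    define w where "w x = indicator (S \<inter> cball 0 (real R)) x * sgn (d x)" for x
    \<comment> \<open>The vector does not depend on the spins, so the sign of a permutation has to
      come from the positions alone; the sign of \<open>d\<close> supplies it.\<close>
    let ?\<psi> = "\<lambda>z :: ((real^3)^'n) \<times> (bool^'n). complex_of_real (w (fst z))"
    have w: "w \<in> borel_measurable borel"
    proof -
      note [measurable] = S d1
      have [measurable]: "cball (0 :: (real^3)^'n) (real R) \<in> sets borel" by (simp add: borel_closed)
      show ?thesis unfolding w_def sgn_if by measurable
    qed
    have m: "?\<psi> \<in> borel_measurable conf" using fst_conf_measurable[OF w] by measurable
    have "?\<psi> \<in> sq_int"
      unfolding sq_int_def mem_Collect_eq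
    proof (intro conjI m Bochner_Integration.integrable_bound[OF indicator_cball_integrable_conf[of "real R"]])
      show "(\<lambda>z. (cmod (?\<psi> z))\<^sup>2) \<in> borel_measurable conf" using m by measurable
      show "AE z in conf. norm ((cmod (?\<psi> z))\<^sup>2) \<le> norm (indicator (cball 0 (real R)) (fst z) :: real)"
        by (intro always_eventually allI) (auto simp: w_def indicator_def sgn_if)
    qed
    moreover have "antisymmetric ?\<psi>"
      unfolding antisymmetric_def
    proof (intro allI impI always_eventually)
      fix \<pi> :: "'n \<Rightarrow> 'n" and z :: "((real^3)^'n) \<times> (bool^'n)" assume p: "\<pi> permutes UNIV"
      have "w (\<chi> i. fst z $ \<pi> i) = of_int (sign \<pi>) * w (fst z)"
        unfolding w_def d2[rule_format, OF p] sgn_mult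
        by (auto simp: indicator_def sym[OF p] norm_permute[OF p] sign_def)
      then show "?\<psi> (\<chi> i. fst z $ \<pi> i, \<chi> i. snd z $ \<pi> i) = of_int (sign \<pi>) * ?\<psi> z" by simp
    qed
    ultimately have psi: "?\<psi> \<in> hilb" by (simp add: hilb_def)
    have "ip (b k) ?\<psi> = 0" for k
      unfolding ip_def
    proof (rule integral_eq_zero_AE)
      show "AE z in conf. cnj (b k z) * ?\<psi> z = 0"
        using zero[of k] by eventually_elim (auto simp: w_def indicator_def)
    qed
    then have "wf_eq ?\<psi> (\<lambda>z. 0)" by (intro onb_eqI[OF b psi hilb_zero]) simp
    then have "AE x in lborel. w x = 0"
      unfolding wf_eq_def using AE_conf_fst[of "\<lambda>x. complex_of_real (w x) = 0"] by simp
    with dnz show ?thesis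
      by eventually_elim (auto simp: w_def indicator_def sgn_if split: if_splits)
  qed
  then have "AE x in lborel. \<forall>R :: nat. norm x \<le> real R \<longrightarrow> x \<notin> S"
    unfolding AE_all_countable by (rule allI)
  then show ?thesis
  proof eventually_elim
    fix x assume "\<forall>R :: nat. norm x \<le> real R \<longrightarrow> x \<notin> S"
    moreover obtain R :: nat where "norm x \<le> real R" using real_arch_simple[of "norm x"] by (elim exE)
    ultimately show "x \<notin> S" by blast
  qed
qed

subsection \<open>The multiplier function\<close>

text \<open>On each common eigenvector \<open>b k\<close> the operators \<open>\<beta>' H + A\<close> and \<open>\<beta> H\<close>, with \<open>A = \<Sum>\<^sub>i \<alpha>(x\<^sub>i)\<close>, are scalars,
  so \<open>A\<close> is a constant \<open>\<gamma> k\<close> where \<open>b k\<close> does not vanish. If \<open>\<beta>' \<noteq> \<beta>\<close>, then \<open>\<gamma> k\<close> determines the eigenvalue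
  \<open>\<mu> k\<close>, and finite multiplicity is violated.\<close>

lemma gibbs_multiplier_const:
  fixes \<rho> c :: "'n::finite wf \<Rightarrow> 'n wf"
  assumes v: "v \<in> borel_measurable borel" and a: "\<alpha> \<in> borel_measurable borel" and beta: "\<beta> \<noteq> 0"
    and g: "gibbs_state (trial_dom v \<alpha>) (trial_form v \<beta>' \<alpha>) \<rho> b \<mu> Z"
    and gc: "gibbs_state (trial_dom v (\<lambda>_. 0)) (trial_form v \<beta> (\<lambda>_. 0)) c bc \<mu>c Zc"
    and eq: "op_eq \<rho> c"
  shows "\<exists>\<alpha>_eq. AE x in lborel. \<alpha> x = \<alpha>_eq"
proof -
  note b = gibbs_onb[OF g] and Z = gibbs_pos[OF g] and Zc = gibbs_pos[OF gc]
  let ?A = "one_body \<alpha> :: (real^3)^'n \<Rightarrow> real"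
  note A = one_body_measurable[OF a]
  \<comment> \<open>The same operator has eigenvalue exp (- \<mu> k) / Z in the normalization of
    \<rho>. Read in the normalization of \<open>c\<close>, this assigns to \<beta> H the eigenvalue
    \<mu> k - L on b k.\<close>
  define L where "L = ln (Zc / Z)"
  \<comment> \<open>Subtracting \<beta>' H, with eigenvalue \<beta>' (\<mu> k - L) / \<beta>, from
    the total eigenvalue \<mu> k leaves the scalar by which A acts on b k.\<close>
  define \<gamma> where "\<gamma> k = \<mu> k - \<beta>' / \<beta> * (\<mu> k - L)" for k
  have dom: "b k \<in> trial_dom v \<alpha>" for k by (rule form_op_dom[OF gibbs_sys[OF g]])
  then have dom0: "b k \<in> trial_dom v (\<lambda>_. 0)" and domA: "b k \<in> mult_dom ?A" for k
    by (simp_all add: trial_dom_def ham_dom_def mult_dom_def one_body_def)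
  have form: "ip \<phi> (mult ?A (b k)) = of_real (\<gamma> k) * ip \<phi> (b k)" if phi: "\<phi> \<in> trial_dom v \<alpha>" for \<phi> k
  proof -
    have ev: "wf_eq (c (b k)) (\<lambda>z. of_real (exp (- \<mu> k) / Z) * b k z)"
      using eq onb_hilb[OF b, of k] unfolding op_eq_def
      by (intro wf_eq_trans[OF wf_eq_sym gibbs_diag[OF g]]) simp
    have nz: "ip (b k) (b k) \<noteq> 0" by (simp add: onb_ip[OF b])
    have phi0: "\<phi> \<in> trial_dom v (\<lambda>_. 0)"
      unfolding trial_dom_zero using phi by (simp add: trial_dom_def)
    have "trial_form v \<beta> (\<lambda>_. 0) \<phi> (b k) = of_real (- ln (exp (- \<mu> k) / Z * Zc)) * ip \<phi> (b k)"
      by (rule gibbs_eigenvector(2)[OF hermitian_trial_form[OF v borel_measurable_const] gc dom0 nz ev phi0])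
    moreover have "- ln (exp (- \<mu> k) / Z * Zc) = \<mu> k - L"
    proof -
      have "ln (exp (- \<mu> k) / Z * Zc) = ln (exp (- \<mu> k) * (Zc / Z))" by simp
      also have "\<dots> = - \<mu> k + L" using Z Zc by (simp add: L_def ln_mult ln_div)
      finally show ?thesis by simp
    qed
    ultimately have "of_real \<beta> * ham_form v \<phi> (b k) = of_real (\<mu> k - L) * ip \<phi> (b k)"
      by (simp only: trial_form_zero)
    then have H: "ham_form v \<phi> (b k) = of_real ((\<mu> k - L) / \<beta>) * ip \<phi> (b k)"
      using beta by (simp add: field_simps)
    have "of_real \<beta>' * ham_form v \<phi> (b k) + ip \<phi> (mult ?A (b k)) = of_real (\<mu> k) * ip \<phi> (b k)"
      using form_op_eigen[OF gibbs_sys[OF g] phi, of k] by (simp only: trial_form_def)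
    then have X: "ip \<phi> (mult ?A (b k)) = of_real (\<mu> k) * ip \<phi> (b k) - of_real \<beta>' * (of_real ((\<mu> k - L) / \<beta>) * ip \<phi> (b k))"
      unfolding H by (simp only: eq_diff_eq add.commute)
    have "\<gamma> k = \<mu> k - \<beta>' * ((\<mu> k - L) / \<beta>)" by (simp add: \<gamma>_def)
    then show ?thesis unfolding X by (simp only: of_real_diff of_real_mult left_diff_distrib mult.assoc)
  qed
  have loc: "AE z in conf. b k z \<noteq> 0 \<longrightarrow> ?A (fst z) = \<gamma> k" for k
  proof (rule localization[OF A one_body_permute domA])
    fix F F' assume "test_function F F'" "\<And>\<pi> x. \<pi> permutes (UNIV :: 'n set) \<Longrightarrow> F (\<chi> i. x $ \<pi> i) = F x"
    from form[OF mult_trial_dom[OF v a this dom]]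
    show "ip (mult F (b k)) (mult ?A (b k)) = of_real (\<gamma> k) * ip (mult F (b k)) (b k)" .
  qed
  have bb: "\<beta>' = \<beta>"
  proof (rule ccontr)
    assume ne: "\<beta>' \<noteq> \<beta>"
    \<comment> \<open>As a function of \<mu> k, the constant \<gamma> k is affine with slope 1 -
      \<beta>' / \<beta>, which is nonzero here. So only finitely many b k share the constant of b
      0, while the supports of all others are essentially disjoint from that of b 0.\<close>
    have inj: "\<mu> k = \<mu> 0" if "\<gamma> k = \<gamma> 0" for k
    proof -
      have "(1 - \<beta>' / \<beta>) * (\<mu> k - \<mu> 0) = 0" using that by (simp add: \<gamma>_def algebra_simps)
      then show ?thesis using ne beta by simp
    qed
    have "(\<lambda>k. exp (- \<mu> k) / Z) \<longlonglongrightarrow> 0"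
      by (rule summable_LIMSEQ_zero[OF sums_summable[OF has_sum_imp_sums[OF gibbs_weights_has_sum[OF g]]]])
    from order_tendstoD(2)[OF this, of "exp (- \<mu> 0) / Z"] Z
    obtain N where N: "\<And>k. k \<ge> N \<Longrightarrow> exp (- \<mu> k) / Z < exp (- \<mu> 0) / Z"
      by (auto simp: eventually_sequentially)
    have "{k. \<gamma> k = \<gamma> 0} \<subseteq> {..<N}"
    proof
      fix k assume "k \<in> {k. \<gamma> k = \<gamma> 0}"
      then have "\<gamma> k = \<gamma> 0" by simp
      then have "\<mu> k = \<mu> 0" by (rule inj)
      then show "k \<in> {..<N}" using N[of k] by (cases "k < N") auto
    qed
    then have "finite {k. \<gamma> k = \<gamma> 0}" by (rule finite_subset) simp
    moreover have "AE z in conf. cnj (b k z) * b 0 z = 0" if "k \<notin> {k. \<gamma> k = \<gamma> 0}" for k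
      using loc[of k] loc[of 0] by eventually_elim (use that in auto)
    ultimately show False by (rule finitely_many_overlaps_impossible[OF b])
  qed
  \<comment> \<open>For equal temperatures the eigenvalue drops out, so the constant is the same on
    all supports.\<close>
  have gL: "\<gamma> k = L" for k using beta by (simp add: \<gamma>_def bb)
  have "AE x in lborel. x \<notin> {x. ?A x \<noteq> L}"
  proof (rule symmetric_set_null[OF b])
    show "{x. ?A x \<noteq> L} \<in> sets borel" using A by measurable
    show "(\<chi> i. x $ \<pi> i) \<in> {x. ?A x \<noteq> L} \<longleftrightarrow> x \<in> {x. ?A x \<noteq> L}" if "\<pi> permutes UNIV" for \<pi> x
      by (simp add: one_body_permute[OF that])
    show "AE z in conf. fst z \<in> {x. ?A x \<noteq> L} \<longrightarrow> b k z = 0" for k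
      using loc[of k] by eventually_elim (auto simp: gL)
  qed
  then have "AE x in lborel. ?A x = L" by simp
  then show ?thesis by (rule one_body_const[OF a])
qed

theorem mainTheorem4:
  fixes v n_eq :: "real^3 \<Rightarrow> real" and \<beta> E S_c :: real
    and c :: "'n::finite wf \<Rightarrow> 'n wf"
  assumes "v \<in> borel_measurable borel" and "\<beta> > 0"
    and "canonical v \<beta> c"
    and "has_energy v c E" and "has_entropy c S_c" and "has_density c n_eq"
  shows
    "(n_eq \<in> entropy_dom TYPE('n) v E \<and>
      (\<forall>n \<in> entropy_dom TYPE('n) v E.
         trial_entropy TYPE('n) v E n \<le> trial_entropy TYPE('n) v E n_eq) \<and>
      (\<exists>\<alpha>_eq. trial v E n_eq \<beta> (\<lambda>_. \<alpha>_eq) c) \<and>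
      (\<forall>\<beta>' \<alpha> \<rho>. trial v E n_eq \<beta>' \<alpha> (\<rho> :: 'n wf \<Rightarrow> 'n wf) \<longrightarrow>
         (\<exists>\<alpha>_eq. AE x in lborel. \<alpha> x = \<alpha>_eq) \<and> op_eq \<rho> c)) \<and>
     (n_eq \<in> potential_dom TYPE('n) v \<beta> \<and>
      (\<forall>n \<in> potential_dom TYPE('n) v \<beta>.
         density_potential TYPE('n) v \<beta> n_eq \<le> density_potential TYPE('n) v \<beta> n))"
proof -
  note v = assms(1) and \<beta> = assms(2)
  obtain b \<mu> Z where g: "gibbs_state (trial_dom v (\<lambda>_. 0)) (trial_form v \<beta> (\<lambda>_. 0)) c b \<mu> Z"
    by (rule canonical_gibbs[OF assms(3)])
  have c: "constraints v E n_eq c"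
    unfolding constraints_def using density_matrix_gibbs[OF g] assms(4,6) by (intro conjI)
  note S = zero_trial_entropy[OF v g c assms(5)]
  have max: "max_entropy v E n_eq c"
    unfolding max_entropy_def
  proof (intro conjI c exI[of _ S_c] allI impI assms(5))
    fix \<rho> :: "'n wf \<Rightarrow> 'n wf" and s assume "constraints v E n_eq \<rho> \<and> has_entropy \<rho> s"
    then have "constraints v E n_eq \<rho>" and "has_entropy \<rho> s" by (rule conjunct1, rule conjunct2)
    from zero_trial_inequality(1)[OF v g this] show "s \<le> S_c" using S by (simp only:)
  qed
  have "normalized_exp (trial_dom v (\<lambda>_. 0)) (trial_form v \<beta> (\<lambda>_. 0)) c"
    using assms(3) unfolding canonical_def trial_dom_zero trial_form_zero .
  \<comment> \<open>The canonical matrix is a trial state with the constant multiplier 0, which is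
    also the witness for \<open>\<alpha>_eq\<close>.\<close>
  then have t0: "trial v E n_eq \<beta> (\<lambda>_. 0) c"
    unfolding trial_def trial_dom_def trial_form_def[abs_def] using max by simp
  have le: "s \<le> \<beta> * e + ln Z" if "trial v e n \<beta>' \<alpha> \<rho>" and "has_entropy \<rho> s"
    for e n \<beta>' \<alpha> s and \<rho> :: "'n wf \<Rightarrow> 'n wf"
    by (rule zero_trial_inequality(1)[OF v g trial_constraints[OF that(1)] that(2)])
  have 1: "n_eq \<in> entropy_dom TYPE('n) v E" and 2: "n_eq \<in> potential_dom TYPE('n) v \<beta>"
    unfolding entropy_dom_def potential_dom_def mem_Collect_eq using t0 by (intro exI, assumption)+
  have 3: "\<exists>\<alpha>_eq. trial v E n_eq \<beta> (\<lambda>_. \<alpha>_eq) c"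
    using t0 by (intro exI)
  have 4: "trial_entropy TYPE('n) v E n \<le> trial_entropy TYPE('n) v E n_eq" if n: "n \<in> entropy_dom TYPE('n) v E" for n
  proof -
    obtain \<beta>' \<alpha> and \<rho> :: "'n wf \<Rightarrow> 'n wf" where t: "trial v E n \<beta>' \<alpha> \<rho>"
      using n unfolding entropy_dom_def mem_Collect_eq by (elim exE)
    obtain s where s: "has_entropy \<rho> s" by (rule trial_has_entropy[OF t])
    from le[OF t s] show ?thesis
      unfolding trial_entropy_eq[OF t s] trial_entropy_eq[OF t0 assms(5)] S .
  qed
  have 5: "(\<exists>\<alpha>_eq. AE x in lborel. \<alpha> x = \<alpha>_eq) \<and> op_eq \<rho> c" if t: "trial v E n_eq \<beta>' \<alpha> \<rho>"
    for \<beta>' \<alpha> and \<rho> :: "'n wf \<Rightarrow> 'n wf"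
  proof -
    obtain s where s: "has_entropy \<rho> s" by (rule trial_has_entropy[OF t])
    \<comment> \<open>Both matrices maximize the entropy under the same constraints. The equality
      case of the Gibbs inequality then applies, whatever multipliers \<beta>' and \<alpha>
      represent \<rho>.\<close>
    have "s = S_c" by (rule max_entropy_value[OF trial_max[OF t] max s assms(5)])
    then have "s = \<beta> * E + ln Z" using S by (simp only:)
    then have eq: "op_eq \<rho> c" by (rule zero_trial_inequality(2)[OF v g trial_constraints[OF t] s])
    obtain b' \<mu>' Z' where g': "gibbs_state (trial_dom v \<alpha>) (trial_form v \<beta>' \<alpha>) \<rho> b' \<mu>' Z'"
      using normalized_exp_gibbs[OF trial_normalized[OF t]] by (elim exE)
    have "\<beta> \<noteq> 0" using \<beta> by simp
    then have "\<exists>\<alpha>_eq. AE x in lborel. \<alpha> x = \<alpha>_eq"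
      by (rule gibbs_multiplier_const[OF v trial_measurable[OF t] _ g' g eq])
    then show ?thesis using eq by (intro conjI)
  qed
  have 6: "density_potential TYPE('n) v \<beta> n_eq \<le> density_potential TYPE('n) v \<beta> n"
    if n: "n \<in> potential_dom TYPE('n) v \<beta>" for n
  proof -
    obtain e \<alpha> and \<rho> :: "'n wf \<Rightarrow> 'n wf" where t: "trial v e n \<beta> \<alpha> \<rho>"
      using n unfolding potential_dom_def mem_Collect_eq by (elim exE)
    obtain s where s: "has_entropy \<rho> s" by (rule trial_has_entropy[OF t])
    \<comment> \<open>The bound s - \<beta> e \<le> ln Z no longer mentions the energy on its right
      side, so trial states of different energies can be compared; the canonical matrix attains
      it.\<close>
    have "massieu TYPE('n) v \<beta> n \<le> massieu TYPE('n) v \<beta> n_eq"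
      unfolding massieu_eq[OF v t s] massieu_eq[OF v t0 assms(5)] using le[OF t s] S by linarith
    then show ?thesis
      using \<beta> by (simp add: density_potential_def divide_right_mono)
  qed
  show ?thesis
    by (intro conjI ballI allI impI 1 2 3 4 conjunct1[OF 5] conjunct2[OF 5] 6)
qed

end
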